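(* Let $\kappa\in\mathbb C$ with $\operatorname{Re}\kappa>0$, $\operatorname{Im}\kappa<0$, let $\eta_\pm\in\hat{\mathbb C}$ and $\eta_-\ne\eta_+$. Let $\varepsilon(\cdot)$ be a minimum-time control from the initial state $x(s_-)=\eta_-$ of the control system to the target state $x(s_+)=\eta_+$ (so $s_+=s_-+T^{\min}_\kappa(\eta_-,\eta_+)<\infty$). Then $\varepsilon(\cdot)$ is a bang-bang control on $[s_-,s_+]$, and there exist a constant $\lambda_0\in[0,+\infty)$ and a nontrivial solution $y$ of $y''=-\kappa^2\varepsilon(s)y$ on $[s_-,s_+]$ with $\frac{y'(s_\pm)}{\mathrm i\kappa y(s_\pm)}=\eta_\pm$ (understood as $y(s_\pm)=0$ when $\eta_\pm=\infty$) such that $$\varepsilon(s)=\begin{cases}n_1^2,&\text{if }\operatorname{Im}(y^2(s))<0,\\ n_2^2,&\text{if }\operatorname{Im}(y^2(s))>0,\end{cases}$$ and $$\operatorname{Im}\bigl(\varepsilon(s)y^2(s)+\kappa^{-2}(y'(s))^2\bigr)=\lambda_0\quad\text{for all }s\in[s_-,s_+].$$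
   Context: Fix constants $0<n_1<n_2$; $\hat{\mathbb C}=\mathbb C\cup\{\infty\}$. Feasible controls are $\varepsilon\in L^\infty((s_-,\infty);\mathbb R)$ with $n_1^2\le\varepsilon\le n_2^2$ a.e. The state $x(s)\in\hat{\mathbb C}$ of the control system evolves by $x'=\mathrm i\kappa(-x^2+\varepsilon)$ in the chart $\mathbb C$ and, near $\infty$, by $\tilde x'=\mathrm i\kappa(-1+\varepsilon\tilde x^2)$ for $\tilde x=-1/x$. $T^{\min}_\kappa(\eta_-,\eta_+)$ is the infimum of $t\ge0$ such that some feasible control steers $x(s_-)=\eta_-$ to $x(s_-+t)=\eta_+$; a control doing this in time $T^{\min}_\kappa(\eta_-,\eta_+)<\infty$ is a minimum-time control. A control is bang-bang on $[s_-,s_+]$ if, after a possible correction on a set of measure zero, it is piecewise constant (there is a finite partition $s_-=b_0<b_1<\dots<b_{n+1}=s_+$ with the control constant on each $(b_j,b_{j+1})$) and takes only the values $n_1^2$ and $n_2^2$ (after a possible correction at the partition points). This correction is assumed to have been made; equalities for $\varepsilon$ as an $L^\infty$-function are understood up to such correction. *)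

theory Defs
  imports "HOL-Analysis.Analysis"
begin

datatype riemann_sphere = Fin complex | Infty

(* x tilde = -1/x; only meaningful off the point Fin 0. *)
fun chart_inf :: "riemann_sphere \<Rightarrow> complex" where
  "chart_inf (Fin z) = - 1 / z"
| "chart_inf Infty = 0"

(* Only meaningful off Infty. *)
fun chart_fin :: "riemann_sphere \<Rightarrow> complex" where
  "chart_fin (Fin z) = z"
| "chart_fin Infty = 0"

(* For an interval J: z is absolutely continuous on compact subintervals of J
   and z' = f a.e. on J (Caratheodory sense), in integral form. *)
definition ae_primitive_on :: "real set \<Rightarrow> (real \<Rightarrow> complex) \<Rightarrow> (real \<Rightarrow> complex) \<Rightarrow> bool" where
  "ae_primitive_on J z f \<longleftrightarrow>
     (\<forall>u\<in>J. \<forall>v\<in>J. u \<le> v \<longrightarrow>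
        f absolutely_integrable_on {u..v} \<and> integral {u..v} f = z v - z u)"

(* Representatives of the L-infinity classes of feasible controls on (s_-, infinity). *)
definition feasible_control :: "real \<Rightarrow> real \<Rightarrow> real \<Rightarrow> (real \<Rightarrow> real) \<Rightarrow> bool" where
  "feasible_control n1 n2 sm \<epsilon> \<longleftrightarrow>
     \<epsilon> \<in> borel_measurable (lebesgue_on {sm<..}) \<and>
     (AE s in lebesgue_on {sm<..}. n1\<^sup>2 \<le> \<epsilon> s \<and> \<epsilon> s \<le> n2\<^sup>2)"

(* Near every time of [a,b] the path stays in the domain of one of the two charts
   and solves the control system written in that chart. *)
definition trajectory ::
  "complex \<Rightarrow> (real \<Rightarrow> real) \<Rightarrow> real \<Rightarrow> real \<Rightarrow> (real \<Rightarrow> riemann_sphere) \<Rightarrow> bool" where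
  "trajectory \<kappa> \<epsilon> a b x \<longleftrightarrow>
     (\<forall>s\<in>{a..b}. \<exists>\<delta>>0. \<exists>J. J = {a..b} \<inter> {s - \<delta>..s + \<delta>} \<and>
        ((\<forall>r\<in>J. x r \<noteq> Infty) \<and>
           ae_primitive_on J (\<lambda>r. chart_fin (x r))
             (\<lambda>r. \<i> * \<kappa> * (- (chart_fin (x r))\<^sup>2 + of_real (\<epsilon> r)))
         \<or>
         (\<forall>r\<in>J. x r \<noteq> Fin 0) \<and>
           ae_primitive_on J (\<lambda>r. chart_inf (x r))
             (\<lambda>r. \<i> * \<kappa> * (- 1 + of_real (\<epsilon> r) * (chart_inf (x r))\<^sup>2))))"

definition steers ::
  "complex \<Rightarrow> (real \<Rightarrow> real) \<Rightarrow> real \<Rightarrow> real \<Rightarrow> riemann_sphere \<Rightarrow> riemann_sphere \<Rightarrow> bool" where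
  "steers \<kappa> \<epsilon> a b \<eta>m \<eta>p \<longleftrightarrow> (\<exists>x. trajectory \<kappa> \<epsilon> a b x \<and> x a = \<eta>m \<and> x b = \<eta>p)"

(* Infimum in the extended reals: infinite if the target is not reachable. *)
definition min_time ::
  "real \<Rightarrow> real \<Rightarrow> complex \<Rightarrow> real \<Rightarrow> riemann_sphere \<Rightarrow> riemann_sphere \<Rightarrow> ereal" where
  "min_time n1 n2 \<kappa> sm \<eta>m \<eta>p =
     Inf {ereal t |t. 0 \<le> t \<and> (\<exists>\<epsilon>. feasible_control n1 n2 sm \<epsilon> \<and> steers \<kappa> \<epsilon> sm (sm + t) \<eta>m \<eta>p)}"

definition min_time_control ::
  "real \<Rightarrow> real \<Rightarrow> complex \<Rightarrow> real \<Rightarrow> real \<Rightarrow> riemann_sphere \<Rightarrow> riemann_sphere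
    \<Rightarrow> (real \<Rightarrow> real) \<Rightarrow> bool" where
  "min_time_control n1 n2 \<kappa> sm sp \<eta>m \<eta>p \<epsilon> \<longleftrightarrow>
     feasible_control n1 n2 sm \<epsilon> \<and>
     ereal (sp - sm) = min_time n1 n2 \<kappa> sm \<eta>m \<eta>p \<and>
     steers \<kappa> \<epsilon> sm sp \<eta>m \<eta>p"

(* Bang-bang representative, i.e. after the correction on a null set has been made. *)
definition bang_bang_on :: "real \<Rightarrow> real \<Rightarrow> real \<Rightarrow> real \<Rightarrow> (real \<Rightarrow> real) \<Rightarrow> bool" where
  "bang_bang_on n1 n2 sm sp \<epsilon> \<longleftrightarrow>
     (\<exists>n. \<exists>b :: nat \<Rightarrow> real. b 0 = sm \<and> b (Suc n) = sp \<and>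
        (\<forall>j\<le>n. b j < b (Suc j) \<and> \<epsilon> constant_on {b j<..<b (Suc j)})) \<and>
     (\<forall>s\<in>{sm..sp}. \<epsilon> s \<in> {n1\<^sup>2, n2\<^sup>2})"

(* y is a solution on [a,b] of y'' = -kappa^2 eps y with derivative y' = dy:
   y is continuously differentiable, y' is absolutely continuous, the equation holds a.e. *)
definition schroedinger_solution ::
  "complex \<Rightarrow> (real \<Rightarrow> real) \<Rightarrow> real \<Rightarrow> real \<Rightarrow> (real \<Rightarrow> complex) \<Rightarrow> (real \<Rightarrow> complex) \<Rightarrow> bool" where
  "schroedinger_solution \<kappa> \<epsilon> a b y dy \<longleftrightarrow>
     (\<forall>s\<in>{a..b}. (y has_vector_derivative dy s) (at s within {a..b})) \<and>
     ae_primitive_on {a..b} dy (\<lambda>s. - \<kappa>\<^sup>2 * of_real (\<epsilon> s) * y s)"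

(* The value of y'/(i kappa y) in the Riemann sphere, for (y,y') not both 0. *)
definition riccati_quotient :: "complex \<Rightarrow> complex \<Rightarrow> complex \<Rightarrow> riemann_sphere" where
  "riccati_quotient \<kappa> y dy = (if y = 0 then Infty else Fin (dy / (\<i> * \<kappa> * y)))"

end

theory Submission
  imports Defs
begin

text \<open>The Riccati system is the projection of a linear one: if \<open>p' = \<i>\<kappa> q\<close> and \<open>q' = \<i>\<kappa> \<epsilon> p\<close>, then
\<open>x = q / p\<close> moves on the Riemann sphere according to \<open>x' = \<i>\<kappa> (\<epsilon> - x\<^sup>2)\<close>, and \<open>p\<close> solves
\<open>p'' = - \<kappa>\<^sup>2 \<epsilon> p\<close>.  Every trajectory arises in this way
(\<open>trajectory_is_projected_flow\<close>, \<open>projected_flow_is_trajectory\<close>), so the whole argument takes place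
in the linear system.  A shorter travel time \<open>v (b - a)\<close> with \<open>v < 1\<close> is written on the fixed interval
\<open>[a, b]\<close> as the system \<open>P' = \<i>\<kappa> v Q\<close>, \<open>Q' = \<i>\<kappa> w P\<close>, where \<open>w / v\<close> is the reparametrized control.
The constraint \<open>m1 v \<le> w \<le> m2 v\<close> is convex in the pair \<open>(v, w)\<close>.

Comparing the optimal lift \<open>(p, q)\<close> with a faster competitor \<open>(P, Q)\<close> that has the same initial value,
the Wronskian \<open>p Q - q P\<close> at the final time equals, up to the factor \<open>\<i>\<kappa>\<close>, the integral of
\<open>(w - \<epsilon>) p P + (1 - v) q Q\<close> (\<open>wronskian_identity\<close>).  It vanishes exactly if the competitor reaches the
target.  Its first-order part, with \<open>p\<^sup>2\<close> and \<open>q\<^sup>2\<close> in place of \<open>p P\<close> and \<open>q Q\<close>, ranges over a convex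
subset of the complex plane.  If zero were an interior point of this set, then Brouwer's theorem would
produce a competitor with vanishing Wronskian, that is, a faster control
(\<open>zero_not_interior_variations\<close>).  Hence the set lies in a half plane.  Multiplying \<open>p\<close> by a suitable
constant to obtain \<open>y\<close> turns this half plane into \<open>Im \<le> 0\<close>, and says that \<open>\<epsilon>\<close> maximizes
\<open>Im (\<epsilon> y\<^sup>2)\<close> almost everywhere and that the Hamiltonian has a nonnegative integral.

Singular arcs and accumulating switches are excluded by the angular momentum \<open>Im (cnj y y')\<close> of the
curve \<open>y\<close>.  Since \<open>Im \<kappa>\<^sup>2 < 0\<close>, it is strictly increasing (\<open>momentum_strict_mono\<close>).
It therefore vanishes at most once, so the argument of \<open>y\<close> is strictly monotone on either side of every
time, locally, and \<open>y\<^sup>2\<close> is real at finitely many times only (\<open>finite_switching_times\<close>).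
So \<open>\<epsilon>\<close> is bang-bang.  The Hamiltonian is continuous and locally constant off the switching times, hence
constant (\<open>hamiltonian_constant\<close>).\<close>

section \<open>Calculus of primitives of bounded functions\<close>

text \<open>Boundedness of the integrand makes the primitive Lipschitz continuous.  Integral identities for products
and quotients then follow from elementary estimates, without differentiating almost everywhere.\<close>

definition lipschitz_primitive :: "real \<Rightarrow> real \<Rightarrow> (real \<Rightarrow> complex) \<Rightarrow> (real \<Rightarrow> complex) \<Rightarrow> bool" where
  "lipschitz_primitive a b z f \<longleftrightarrow> ae_primitive_on {a..b} z f \<and> bounded (f ` {a..b})"

text \<open>Such a function has derivative zero everywhere.  The lemma reduces an identity between primitives to
the comparison of their increments up to an error of second order in the step size.\<close>

lemma constant_if_quadratic_increments:
  fixes D :: "real \<Rightarrow> 'a::real_normed_vector"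
  assumes inc: "\<And>s t. s \<in> {a..b} \<Longrightarrow> t \<in> {a..b} \<Longrightarrow> s \<le> t \<Longrightarrow> norm (D t - D s) \<le> C * (t - s)\<^sup>2"
    and s: "s \<in> {a..b}" and t: "t \<in> {a..b}"
  shows "D s = D t"
proof -
  have C: "norm (D y - D x) \<le> \<bar>C\<bar> * (norm (y - x))\<^sup>2" if "x \<in> {a..b}" "y \<in> {a..b}" for x y
  proof -
    have "norm (D y - D x) \<le> C * (y - x)\<^sup>2"
      using inc[OF that] inc[OF that(2,1)]
      by (cases "x \<le> y") (auto simp: norm_minus_commute power2_commute)
    also have "\<dots> \<le> \<bar>C\<bar> * (y - x)\<^sup>2" by (intro mult_right_mono) auto
    finally show ?thesis by simp
  qed
  have "(D has_derivative (\<lambda>h. 0)) (at x within {a..b})" if x: "x \<in> {a..b}" for x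
    unfolding has_derivative_within_alt
  proof (intro conjI allI impI)
    show "bounded_linear (\<lambda>h. 0 :: 'a)" by simp
    fix e :: real assume e: "0 < e"
    show "\<exists>d>0. \<forall>y\<in>{a..b}. norm (y - x) < d \<longrightarrow> norm (D y - D x - 0) \<le> e * norm (y - x)"
    proof (intro exI[of _ "e / (\<bar>C\<bar> + 1)"] conjI ballI impI)
      show "0 < e / (\<bar>C\<bar> + 1)" using e by simp
      fix y assume y: "y \<in> {a..b}" and n: "norm (y - x) < e / (\<bar>C\<bar> + 1)"
      have "\<bar>C\<bar> * norm (y - x) \<le> (\<bar>C\<bar> + 1) * norm (y - x)" by (intro mult_right_mono) auto
      also have "\<dots> \<le> e" using n by (simp add: field_simps)
      finally have "\<bar>C\<bar> * norm (y - x) * norm (y - x) \<le> e * norm (y - x)" by (intro mult_right_mono) auto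
      then show "norm (D y - D x - 0) \<le> e * norm (y - x)"
        using C[OF x y] by (simp add: power2_eq_square)
    qed
  qed
  then have "\<exists>c. \<forall>x\<in>{a..b}. D x = c"
    by (intro has_derivative_zero_constant) auto
  with s t show ?thesis by metis
qed

lemma norm_integral_le:
  fixes f :: "real \<Rightarrow> 'a::euclidean_space"
  assumes "s \<le> t" "f integrable_on {s..t}" "\<And>r. r \<in> {s..t} \<Longrightarrow> norm (f r) \<le> M"
  shows "norm (integral {s..t} f) \<le> M * (t - s)"
proof -
  have "norm (integral {s..t} f) \<le> integral {s..t} (\<lambda>_. M)"
    using assms by (intro integral_norm_bound_integral) auto
  then show ?thesis using assms(1) by (simp add: mult.commute)
qed

lemma lipschitz_primitiveE:
  assumes "lipschitz_primitive a b z f"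
  obtains M where "0 \<le> M" "\<And>s. s \<in> {a..b} \<Longrightarrow> norm (f s) \<le> M"
    "\<And>s t. s \<in> {a..b} \<Longrightarrow> t \<in> {a..b} \<Longrightarrow> norm (z t - z s) \<le> M * \<bar>t - s\<bar>"
proof -
  have p: "ae_primitive_on {a..b} z f" and "bounded (f ` {a..b})"
    using assms by (auto simp: lipschitz_primitive_def)
  then obtain M where M: "M > 0" "\<And>s. s \<in> {a..b} \<Longrightarrow> norm (f s) \<le> M"
    unfolding bounded_pos by auto
  have le: "norm (z t - z s) \<le> M * (t - s)" if "s \<in> {a..b}" "t \<in> {a..b}" "s \<le> t" for s t
  proof -
    have "f absolutely_integrable_on {s..t}" and e: "integral {s..t} f = z t - z s"
      using p that by (auto simp: ae_primitive_on_def)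
    then have "norm (integral {s..t} f) \<le> M * (t - s)"
      using that M by (intro norm_integral_le) (auto simp: set_lebesgue_integral_eq_integral)
    with e show ?thesis by simp
  qed
  show thesis
  proof (rule that[of M])
    show "norm (z t - z s) \<le> M * \<bar>t - s\<bar>" if "s \<in> {a..b}" "t \<in> {a..b}" for s t
      using le[OF that] le[OF that(2,1)] by (cases "s \<le> t") (auto simp: norm_minus_commute)
  qed (use M in auto)
qed

lemma ae_primitive_on_continuous:
  assumes "ae_primitive_on {a..b} z f"
  shows "continuous_on {a..b} z"
proof (cases "a \<le> b")
  case True
  have "f integrable_on {a..b}"
    using assms True by (auto simp: ae_primitive_on_def set_lebesgue_integral_eq_integral)
  then have "continuous_on {a..b} (\<lambda>t. z a + integral {a..t} f)"
    by (intro continuous_intros indefinite_integral_continuous_1)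
  moreover have "z a + integral {a..t} f = z t" if "t \<in> {a..b}" for t
    using assms that by (auto simp: ae_primitive_on_def)
  ultimately show ?thesis by (rule continuous_on_eq) auto
qed auto

lemma lipschitz_primitive_continuous:
  "lipschitz_primitive a b z f \<Longrightarrow> continuous_on {a..b} z"
  by (auto simp: lipschitz_primitive_def intro: ae_primitive_on_continuous)

lemma absolutely_integrable_on_times_continuous:
  fixes f z :: "real \<Rightarrow> complex"
  assumes f: "f absolutely_integrable_on {a..b}" and z: "continuous_on {a..b} z"
  shows "(\<lambda>s. z s * f s) absolutely_integrable_on {a..b}"
proof (rule absolutely_integrable_bounded_measurable_product[of "(*)" z, OF _ _ _ _ f])
  show "bilinear ((*) :: complex \<Rightarrow> complex \<Rightarrow> complex)"
    by (simp add: bilinear_times)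
  show "z \<in> borel_measurable (lebesgue_on {a..b})"
    by (intro continuous_imp_measurable_on_sets_lebesgue z) auto
  show "bounded (z ` {a..b})" using z by (intro compact_imp_bounded compact_continuous_image) auto
qed auto

lemma bounded_mult_image:
  fixes f g :: "'a \<Rightarrow> complex"
  assumes "bounded (f ` A)" "bounded (g ` A)"
  shows "bounded ((\<lambda>s. f s * g s) ` A)"
proof -
  obtain F G where F: "\<And>s. s \<in> A \<Longrightarrow> norm (f s) \<le> F" and G: "\<And>s. s \<in> A \<Longrightarrow> norm (g s) \<le> G"
    using assms by (auto simp: bounded_iff)
  have "norm (f s * g s) \<le> F * G" if "s \<in> A" for s
    unfolding norm_mult using F[OF that] G[OF that] norm_ge_zero[of "f s"]
    by (intro mult_mono) (auto intro: order_trans[OF norm_ge_zero])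
  then show ?thesis by (auto simp: bounded_iff)
qed

lemma bounded_image_continuous:
  "continuous_on {a..b} f \<Longrightarrow> bounded (f ` {a..b::real})"
  by (intro compact_imp_bounded compact_continuous_image) auto

text \<open>Over a step from \<open>s\<close> to \<open>t\<close>, the increment of \<open>z w\<close> is the integral of \<open>f w s + z s g\<close> up to the
product of the two increments.  Both this product and the replacement of \<open>w s\<close>, \<open>z s\<close> by running
values are of second order.\<close>

lemma lipschitz_primitive_mult:
  assumes z: "lipschitz_primitive a b z f" and w: "lipschitz_primitive a b w g"
  shows "lipschitz_primitive a b (\<lambda>s. z s * w s) (\<lambda>s. f s * w s + z s * g s)"
proof -
  obtain M where M: "0 \<le> M" "\<And>s. s \<in> {a..b} \<Longrightarrow> norm (f s) \<le> M"
    "\<And>s t. s \<in> {a..b} \<Longrightarrow> t \<in> {a..b} \<Longrightarrow> norm (z t - z s) \<le> M * \<bar>t - s\<bar>"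
    using lipschitz_primitiveE[OF z] by blast
  obtain N where N: "0 \<le> N" "\<And>s. s \<in> {a..b} \<Longrightarrow> norm (g s) \<le> N"
    "\<And>s t. s \<in> {a..b} \<Longrightarrow> t \<in> {a..b} \<Longrightarrow> norm (w t - w s) \<le> N * \<bar>t - s\<bar>"
    using lipschitz_primitiveE[OF w] by blast
  note cz = lipschitz_primitive_continuous[OF z] and cw = lipschitz_primitive_continuous[OF w]
  define k where "k = (\<lambda>s. f s * w s + z s * g s)"
  have sub: "f absolutely_integrable_on {s..t}" "integral {s..t} f = z t - z s"
    "g absolutely_integrable_on {s..t}" "integral {s..t} g = w t - w s"
    if "s \<in> {a..b}" "t \<in> {a..b}" "s \<le> t" for s t
    using z w that by (auto simp: lipschitz_primitive_def ae_primitive_on_def)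
  have k: "k absolutely_integrable_on {s..t}" if "s \<in> {a..b}" "t \<in> {a..b}" "s \<le> t" for s t
  proof -
    have "continuous_on {s..t} z" "continuous_on {s..t} w"
      using that by (auto intro: continuous_on_subset[OF cz] continuous_on_subset[OF cw])
    then show ?thesis
      using absolutely_integrable_on_times_continuous[OF sub(1)[OF that], of w]
        absolutely_integrable_on_times_continuous[OF sub(3)[OF that], of z]
      unfolding k_def by (auto simp: mult.commute intro: set_integral_add)
  qed
  define D where "D = (\<lambda>t. z t * w t - integral {a..t} k)"
  have inc: "norm (D t - D s) \<le> 3 * (M * N) * (t - s)\<^sup>2"
    if st: "s \<in> {a..b}" "t \<in> {a..b}" "s \<le> t" for s t
  proof -
    have "integral {a..s} k + integral {s..t} k = integral {a..t} k"
      using st k[of a t] by (intro Henstock_Kurzweil_Integration.integral_combine)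
        (auto simp: set_lebesgue_integral_eq_integral)
    moreover have "z t * w t - z s * w s =
        integral {s..t} (\<lambda>r. f r * w s + z s * g r) + (z t - z s) * (w t - w s)"
    proof -
      have i: "f integrable_on {s..t}" "g integrable_on {s..t}"
        using sub[OF st] by (auto simp: set_lebesgue_integral_eq_integral)
      have "integral {s..t} (\<lambda>r. f r * w s + z s * g r) = (z t - z s) * w s + z s * (w t - w s)"
        using i sub(2,4)[OF st]
        by (subst Henstock_Kurzweil_Integration.integral_add)
          (auto intro: integrable_on_mult_left integrable_on_mult_right)
      then show ?thesis by (simp add: algebra_simps)
    qed
    ultimately have "D t - D s = integral {s..t} (\<lambda>r. f r * w s + z s * g r) - integral {s..t} k
        + (z t - z s) * (w t - w s)"
      by (simp add: D_def algebra_simps)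
    also have "integral {s..t} (\<lambda>r. f r * w s + z s * g r) - integral {s..t} k
       = integral {s..t} (\<lambda>r. f r * w s + z s * g r - k r)"
      using sub[OF st] k[OF st]
      by (intro Henstock_Kurzweil_Integration.integral_diff [symmetric])
        (auto simp: set_lebesgue_integral_eq_integral
          intro!: integrable_add integrable_on_mult_left integrable_on_mult_right)
    finally have D: "D t - D s = integral {s..t} (\<lambda>r. f r * w s + z s * g r - k r)
        + (z t - z s) * (w t - w s)" .
    have "norm (integral {s..t} (\<lambda>r. f r * w s + z s * g r - k r)) \<le> (2 * (M * N) * (t - s)) * (t - s)"
    proof (rule norm_integral_le)
      show "(\<lambda>r. f r * w s + z s * g r - k r) integrable_on {s..t}"
        using sub[OF st] k[OF st]
        by (auto simp: set_lebesgue_integral_eq_integral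
          intro!: integrable_diff integrable_add integrable_on_mult_left integrable_on_mult_right)
      fix r assume r: "r \<in> {s..t}"
      with st have r': "r \<in> {a..b}" by auto
      have "f r * w s + z s * g r - k r = - (f r * (w r - w s)) - (z r - z s) * g r"
        by (simp add: k_def algebra_simps)
      also have "norm \<dots> \<le> norm (f r) * norm (w r - w s) + norm (z r - z s) * norm (g r)"
        by (metis norm_minus_cancel norm_mult norm_triangle_ineq4)
      also have "\<dots> \<le> M * (N * \<bar>r - s\<bar>) + (M * \<bar>r - s\<bar>) * N"
        using M(1) N(1) M(2)[OF r'] N(2)[OF r'] M(3)[OF st(1) r'] N(3)[OF st(1) r']
        by (intro add_mono mult_mono) auto
      also have "\<dots> = 2 * (M * N) * \<bar>r - s\<bar>" by simp
      also have "\<dots> \<le> 2 * (M * N) * (t - s)"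
        using r M(1) N(1) by (intro mult_left_mono) auto
      finally show "norm (f r * w s + z s * g r - k r) \<le> 2 * (M * N) * (t - s)" .
    qed (use st in auto)
    moreover have "norm ((z t - z s) * (w t - w s)) \<le> (M * \<bar>t - s\<bar>) * (N * \<bar>t - s\<bar>)"
      unfolding norm_mult using M(1) N(1) M(3)[OF st(1,2)] N(3)[OF st(1,2)] by (intro mult_mono) auto
    ultimately have "norm (D t - D s) \<le> (2 * (M * N) * (t - s)) * (t - s) + (M * \<bar>t - s\<bar>) * (N * \<bar>t - s\<bar>)"
      unfolding D by (intro norm_triangle_le add_mono)
    then show ?thesis using st by (simp add: power2_eq_square algebra_simps)
  qed
  have "integral {u..v} k = z v * w v - z u * w u"
    if uv: "u \<in> {a..b}" "v \<in> {a..b}" "u \<le> v" for u v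
  proof -
    have Duv: "D u = D v"
      using inc by (rule constant_if_quadratic_increments) (use uv in auto)
    have "integral {a..u} k + integral {u..v} k = integral {a..v} k"
      using uv k[of a v] by (intro Henstock_Kurzweil_Integration.integral_combine)
        (auto simp: set_lebesgue_integral_eq_integral)
    then have e: "integral {u..v} k = integral {a..v} k - integral {a..u} k"
      by (metis add_diff_cancel_left')
    show ?thesis unfolding e using Duv by (simp add: D_def algebra_simps)
  qed
  moreover have "bounded (k ` {a..b})"
    unfolding k_def using z w bounded_image_continuous[OF cz] bounded_image_continuous[OF cw]
    by (intro bounded_plus_comp bounded_mult_image) (auto simp: lipschitz_primitive_def)
  ultimately show ?thesis
    using k unfolding lipschitz_primitive_def ae_primitive_on_def k_def by auto
qed

lemma lipschitz_primitive_diff: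
  assumes z: "lipschitz_primitive a b z f" and w: "lipschitz_primitive a b w g"
  shows "lipschitz_primitive a b (\<lambda>s. z s - w s) (\<lambda>s. f s - g s)"
  using assms unfolding lipschitz_primitive_def ae_primitive_on_def
  by (auto intro!: set_integral_diff bounded_minus_comp
      simp: Henstock_Kurzweil_Integration.integral_diff set_lebesgue_integral_eq_integral)

lemma lipschitz_primitive_cmult:
  assumes z: "lipschitz_primitive a b z f"
  shows "lipschitz_primitive a b (\<lambda>s. c * z s) (\<lambda>s. c * f s)"
proof -
  have "lipschitz_primitive a b (\<lambda>s. c) (\<lambda>s. 0)"
    by (auto simp: lipschitz_primitive_def ae_primitive_on_def image_constant_conv)
  from lipschitz_primitive_mult[OF this z] show ?thesis by simp
qed

lemma lipschitz_primitive_cnj: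
  assumes z: "lipschitz_primitive a b z f"
  shows "lipschitz_primitive a b (\<lambda>s. cnj (z s)) (\<lambda>s. cnj (f s))"
proof -
  have "(\<lambda>s. cnj (f s)) absolutely_integrable_on {u..v}"
    "integral {u..v} (\<lambda>s. cnj (f s)) = cnj (z v - z u)"
    if "u \<in> {a..b}" "v \<in> {a..b}" "u \<le> v" for u v
  proof -
    have f: "f absolutely_integrable_on {u..v}" and e: "integral {u..v} f = z v - z u"
      using z that by (auto simp: lipschitz_primitive_def ae_primitive_on_def)
    have "(cnj \<circ> f) absolutely_integrable_on {u..v}"
      by (rule absolutely_integrable_linear[OF f bounded_linear_cnj])
    then show "(\<lambda>s. cnj (f s)) absolutely_integrable_on {u..v}" by (simp add: o_def)
    show "integral {u..v} (\<lambda>s. cnj (f s)) = cnj (z v - z u)"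
      using integral_linear[OF _ bounded_linear_cnj, of f "{u..v}"] f e
      by (simp add: o_def set_lebesgue_integral_eq_integral)
  qed
  moreover have "bounded ((\<lambda>s. cnj (f s)) ` {a..b})"
    using z by (auto simp: lipschitz_primitive_def bounded_iff)
  ultimately show ?thesis by (auto simp: lipschitz_primitive_def ae_primitive_on_def)
qed

lemma lipschitz_primitive_subinterval:
  assumes "lipschitz_primitive a b z f" "a \<le> c" "d \<le> b"
  shows "lipschitz_primitive c d z f"
  using assms unfolding lipschitz_primitive_def ae_primitive_on_def
  by (auto intro: bounded_subset)

lemma lipschitz_primitive_cong:
  assumes "lipschitz_primitive a b z f" "\<And>s. s \<in> {a..b} \<Longrightarrow> z s = z' s" "\<And>s. s \<in> {a..b} \<Longrightarrow> f s = f' s"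
  shows "lipschitz_primitive a b z' f'"
proof -
  have "f' absolutely_integrable_on {u..v}" "integral {u..v} f' = integral {u..v} f"
    if "u \<in> {a..b}" "v \<in> {a..b}" "u \<le> v" for u v
  proof -
    have f: "f absolutely_integrable_on {u..v}"
      using assms that by (auto simp: lipschitz_primitive_def ae_primitive_on_def)
    show "f' absolutely_integrable_on {u..v}"
      using that by (intro absolutely_integrable_spike[OF f negligible_empty]) (auto simp: assms(3))
    show "integral {u..v} f' = integral {u..v} f"
      using that by (intro integral_cong) (auto simp: assms(3))
  qed
  moreover have "f' ` {a..b} = f ` {a..b}" using assms(3) by (auto simp: image_def)
  ultimately show ?thesis
    using assms unfolding lipschitz_primitive_def ae_primitive_on_def by auto
qed

text \<open>The increment of \<open>1 / z\<close> over a step is exactly the integral of \<open>- f\<close> divided by \<open>z s z t\<close>; replacing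
this constant denominator by \<open>(z r)\<^sup>2\<close> is an error of second order.\<close>

lemma lipschitz_primitive_inverse:
  assumes z: "lipschitz_primitive a b z f" and nz: "\<And>s. s \<in> {a..b} \<Longrightarrow> z s \<noteq> 0"
  shows "lipschitz_primitive a b (\<lambda>s. inverse (z s)) (\<lambda>s. - f s * (inverse (z s))\<^sup>2)"
proof -
  note cz = lipschitz_primitive_continuous[OF z]
  have ci: "continuous_on {a..b} (\<lambda>s. inverse (z s))"
    using cz nz by (intro continuous_intros) auto
  then obtain B where B: "\<And>s. s \<in> {a..b} \<Longrightarrow> norm (inverse (z s)) \<le> B"
    using bounded_image_continuous[OF ci] unfolding bounded_iff by blast
  obtain M where M: "0 \<le> M" "\<And>s. s \<in> {a..b} \<Longrightarrow> norm (f s) \<le> M"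
    "\<And>s t. s \<in> {a..b} \<Longrightarrow> t \<in> {a..b} \<Longrightarrow> norm (z t - z s) \<le> M * \<bar>t - s\<bar>"
    using lipschitz_primitiveE[OF z] by blast
  define k where "k = (\<lambda>s. - f s * (inverse (z s))\<^sup>2)"
  have sub: "f absolutely_integrable_on {s..t}" "integral {s..t} f = z t - z s"
    if "s \<in> {a..b}" "t \<in> {a..b}" "s \<le> t" for s t
    using z that by (auto simp: lipschitz_primitive_def ae_primitive_on_def)
  have k: "k absolutely_integrable_on {s..t}" if "s \<in> {a..b}" "t \<in> {a..b}" "s \<le> t" for s t
  proof -
    have "continuous_on {s..t} (\<lambda>s. - (inverse (z s))\<^sup>2)"
      using that by (intro continuous_intros continuous_on_subset[OF cz]) (auto simp: nz)
    from absolutely_integrable_on_times_continuous[OF sub(1)[OF that] this]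
    show ?thesis by (simp add: k_def mult.commute)
  qed
  define D where "D = (\<lambda>t. inverse (z t) - integral {a..t} k)"
  have inc: "norm (D t - D s) \<le> (2 * M * M * B * B * B) * (t - s)\<^sup>2"
    if st: "s \<in> {a..b}" "t \<in> {a..b}" "s \<le> t" for s t
  proof -
    have B0: "0 \<le> B" using B[OF st(1)] norm_ge_zero order_trans by blast
    have "integral {a..s} k + integral {s..t} k = integral {a..t} k"
      using st k[of a t] by (intro Henstock_Kurzweil_Integration.integral_combine)
        (auto simp: set_lebesgue_integral_eq_integral)
    then have e0: "integral {a..t} k - integral {a..s} k = integral {s..t} k"
      by (metis add_diff_cancel_left')
    define c where "c = inverse (z s) * inverse (z t)"
    have "inverse (z t) - inverse (z s) = - c * (z t - z s)"
      using nz st by (simp add: c_def field_simps)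
    also have "\<dots> = integral {s..t} (\<lambda>r. - c * f r)"
      by (subst integral_mult_right) (use sub[OF st] in auto)
    finally have "D t - D s = integral {s..t} (\<lambda>r. - c * f r) - integral {s..t} k"
      using e0 by (simp add: D_def algebra_simps)
    also have "\<dots> = integral {s..t} (\<lambda>r. - c * f r - k r)"
      using sub[OF st] k[OF st]
      by (intro Henstock_Kurzweil_Integration.integral_diff [symmetric] integrable_on_mult_right)
        (auto simp: set_lebesgue_integral_eq_integral)
    finally have D: "D t - D s = integral {s..t} (\<lambda>r. - c * f r - k r)" .
    have "norm (integral {s..t} (\<lambda>r. - c * f r - k r)) \<le> ((2 * M * M * B * B * B) * (t - s)) * (t - s)"
    proof (rule norm_integral_le)
      show "(\<lambda>r. - c * f r - k r) integrable_on {s..t}"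
        using sub[OF st] k[OF st]
        by (intro integrable_diff integrable_on_mult_right) (auto simp: set_lebesgue_integral_eq_integral)
      fix r assume r: "r \<in> {s..t}"
      with st have r': "r \<in> {a..b}" by auto
      define i where "i = (\<lambda>r. inverse (z r))"
      have id: "norm (i r - i x) \<le> B * B * (M * (t - s))" if x: "x \<in> {s..t}" for x
      proof -
        have x': "x \<in> {a..b}" using x st by auto
        have "i r - i x = i r * i x * (z x - z r)"
          using nz[OF r'] nz[OF x'] by (simp add: i_def field_simps)
        also have "norm \<dots> \<le> B * B * (M * \<bar>x - r\<bar>)"
          unfolding norm_mult using B[OF r'] B[OF x'] B0 M(3)[OF r' x']
          by (intro mult_mono) (auto simp: i_def)
        also have "\<dots> \<le> B * B * (M * (t - s))"
          using B0 M(1) x r by (intro mult_left_mono) auto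
        finally show ?thesis .
      qed
      have "- c * f r - k r = f r * (i r * (i r - i t) + i t * (i r - i s))"
        by (simp add: k_def c_def i_def power2_eq_square algebra_simps)
      also have "norm \<dots> \<le> M * (B * (B * B * (M * (t - s))) + B * (B * B * (M * (t - s))))"
        unfolding norm_mult
      proof (rule mult_mono)
        have "norm (i r * (i r - i t)) + norm (i t * (i r - i s))
          \<le> B * (B * B * (M * (t - s))) + B * (B * B * (M * (t - s)))"
          unfolding norm_mult using B[OF r'] B[OF st(2)] id[of t] id[of s] st B0
          by (intro add_mono mult_mono) (auto simp: i_def)
        then show "norm (i r * (i r - i t) + i t * (i r - i s))
          \<le> B * (B * B * (M * (t - s))) + B * (B * B * (M * (t - s)))"
          by (rule norm_triangle_le)
      qed (use M(1) M(2)[OF r'] in auto)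
      also have "\<dots> = (2 * M * M * B * B * B) * (t - s)" by (simp add: algebra_simps)
      finally show "norm (- c * f r - k r) \<le> (2 * M * M * B * B * B) * (t - s)" .
    qed (use st in auto)
    then show ?thesis unfolding D by (simp add: power2_eq_square algebra_simps)
  qed
  have "integral {u..v} k = inverse (z v) - inverse (z u)"
    if uv: "u \<in> {a..b}" "v \<in> {a..b}" "u \<le> v" for u v
  proof -
    have Duv: "D u = D v"
      using inc by (rule constant_if_quadratic_increments) (use uv in auto)
    have "integral {a..u} k + integral {u..v} k = integral {a..v} k"
      using uv k[of a v] by (intro Henstock_Kurzweil_Integration.integral_combine)
        (auto simp: set_lebesgue_integral_eq_integral)
    then have e: "integral {u..v} k = integral {a..v} k - integral {a..u} k"
      by (metis add_diff_cancel_left')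
    show ?thesis unfolding e using Duv by (simp add: D_def algebra_simps)
  qed
  moreover have "bounded ((\<lambda>s. - (inverse (z s))\<^sup>2) ` {a..b})"
    by (intro bounded_image_continuous continuous_intros cz) (use nz in auto)
  then have "bounded ((\<lambda>s. f s * (- (inverse (z s))\<^sup>2)) ` {a..b})"
    using z by (intro bounded_mult_image) (auto simp: lipschitz_primitive_def)
  ultimately show ?thesis
    using k unfolding lipschitz_primitive_def ae_primitive_on_def k_def by simp
qed

lemma lipschitz_primitiveI:
  assumes f: "f absolutely_integrable_on {a..b}" and bd: "bounded (f ` {a..b})"
    and z: "\<And>t. t \<in> {a..b} \<Longrightarrow> z t = z0 + integral {a..t} f"
  shows "lipschitz_primitive a b z f"
  unfolding lipschitz_primitive_def ae_primitive_on_def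
proof (intro conjI ballI impI bd)
  fix u v assume uv: "u \<in> {a..b}" "v \<in> {a..b}" "u \<le> v"
  show "f absolutely_integrable_on {u..v}"
    by (rule absolutely_integrable_on_subinterval[OF f]) (use uv in auto)
  have "f absolutely_integrable_on {a..v}"
    by (rule absolutely_integrable_on_subinterval[OF f]) (use uv in auto)
  then have "integral {a..u} f + integral {u..v} f = integral {a..v} f"
    using uv by (intro Henstock_Kurzweil_Integration.integral_combine)
        (auto simp: set_lebesgue_integral_eq_integral)
  then show "integral {u..v} f = z v - z u"
    using z[OF uv(1)] z[OF uv(2)] by (metis add_diff_cancel_left add_diff_cancel_left')
qed

lemma lipschitz_primitive_norm_le:
  assumes z: "lipschitz_primitive a b z f" and h: "continuous_on {a..b} h"
    and le: "\<And>s. s \<in> {a..b} \<Longrightarrow> norm (f s) \<le> h s" and t: "t \<in> {a..b}"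
  shows "norm (z t - z a) \<le> integral {a..t} h"
proof -
  have f: "f absolutely_integrable_on {a..t}" "integral {a..t} f = z t - z a"
    using z t by (auto simp: lipschitz_primitive_def ae_primitive_on_def)
  have "norm (integral {a..t} f) \<le> integral {a..t} h"
  proof (rule integral_norm_bound_integral)
    show "f integrable_on {a..t}" using f by (simp add: set_lebesgue_integral_eq_integral)
    show "h integrable_on {a..t}"
      by (intro integrable_continuous_interval continuous_on_subset[OF h]) (use t in auto)
  qed (use le t in auto)
  with f show ?thesis by simp
qed

lemma lipschitz_primitive_norm_increment_le:
  assumes z: "lipschitz_primitive a b z f"
    and st: "s \<in> {a..b}" "t \<in> {a..b}" "s \<le> t"
    and le: "\<And>r. r \<in> {s..t} \<Longrightarrow> norm (f r) \<le> M"
  shows "norm (z t - z s) \<le> M * (t - s)"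
proof -
  have f: "f absolutely_integrable_on {s..t}" "integral {s..t} f = z t - z s"
    using z st by (auto simp: lipschitz_primitive_def ae_primitive_on_def)
  then show ?thesis
    using norm_integral_le[of s t f M] le st(3) by (simp add: set_lebesgue_integral_eq_integral)
qed

lemma lipschitz_primitive_has_vector_derivative:
  assumes z: "lipschitz_primitive a b z f" and f: "continuous_on {a..b} f" and s: "s \<in> {a..b}"
  shows "(z has_vector_derivative f s) (at s within {a..b})"
proof -
  have "((\<lambda>t. z a + integral {a..t} f) has_vector_derivative 0 + f s) (at s within {a..b})"
    by (intro has_vector_derivative_add has_vector_derivative_const integral_has_vector_derivative f s)
  moreover have "z a + integral {a..t} f = z t" if "t \<in> {a..b}" for t
    using z that by (auto simp: lipschitz_primitive_def ae_primitive_on_def)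
  ultimately show ?thesis
    by (metis (no_types, lifting) add_0 has_vector_derivative_transform s)
qed

text \<open>Controls are determined up to null sets only; primitives do not see the difference.\<close>

lemma ae_primitive_on_spike:
  assumes z: "ae_primitive_on J z f" and J: "J \<subseteq> {a..b}" and S: "negligible S"
    and eq: "\<And>s. s \<in> {a..b} - S \<Longrightarrow> f s = g s"
  shows "ae_primitive_on J z g"
  unfolding ae_primitive_on_def
proof (intro ballI impI conjI)
  fix u v assume uv: "u \<in> J" "v \<in> J" "u \<le> v"
  then have f: "f absolutely_integrable_on {u..v}" "integral {u..v} f = z v - z u"
    using z by (auto simp: ae_primitive_on_def)
  have eq': "g s = f s" if "s \<in> {u..v} - S" for s using eq[of s] that subsetD[OF J uv(1)] subsetD[OF J uv(2)] by auto
  show "g absolutely_integrable_on {u..v}"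
    by (rule absolutely_integrable_spike[OF f(1) S]) (use eq' in auto)
  show "integral {u..v} g = z v - z u"
    using integral_spike[OF S, of "{u..v}" g f] f(2) eq' by auto
qed

lemma lipschitz_primitive_rescale:
  assumes z: "lipschitz_primitive a b z f" and v: "0 < v"
  shows "lipschitz_primitive a (a + v * (b - a)) (\<lambda>\<tau>. z (a + (\<tau> - a) / v)) (\<lambda>\<tau>. f (a + (\<tau> - a) / v) / of_real v)"
proof -
  define \<theta> where "\<theta> = (\<lambda>\<tau>. a + (\<tau> - a) / v)"
  have \<theta>: "\<theta> \<tau> = (1 / v) *\<^sub>R \<tau> + (a - a / v)" for \<tau> by (simp add: \<theta>_def diff_divide_distrib)
  have in_ab: "\<theta> \<tau> \<in> {a..b}" if "\<tau> \<in> {a..a + v * (b - a)}" for \<tau>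
    using that v by (auto simp: \<theta>_def field_simps)
  have sub: "((\<lambda>\<tau>. g (\<theta> \<tau>)) has_integral v *\<^sub>R i) {u..w}" if "(g has_integral i) {\<theta> u..\<theta> w}"
    for g :: "real \<Rightarrow> 'x::euclidean_space" and i u w
  proof -
    have "((\<lambda>\<tau>. g ((1 / v) *\<^sub>R \<tau> + (a - a / v))) has_integral (i /\<^sub>R (1 / v) ^ DIM(real)))
       (cbox ((\<theta> u - (a - a / v)) /\<^sub>R (1 / v)) ((\<theta> w - (a - a / v)) /\<^sub>R (1 / v)))"
      by (rule has_integral_affinity') (use that v in auto)
    moreover have "(\<theta> u - (a - a / v)) /\<^sub>R (1 / v) = u" "(\<theta> w - (a - a / v)) /\<^sub>R (1 / v) = w"
      using v by (auto simp: \<theta>)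
    ultimately show ?thesis by (simp add: \<theta> )
  qed
  have "(\<lambda>\<tau>. f (\<theta> \<tau>) / of_real v) absolutely_integrable_on {u..w}"
    "integral {u..w} (\<lambda>\<tau>. f (\<theta> \<tau>) / of_real v) = z (\<theta> w) - z (\<theta> u)"
    if "u \<in> {a..a + v * (b - a)}" "w \<in> {a..a + v * (b - a)}" "u \<le> w" for u w
  proof -
    have le: "\<theta> u \<le> \<theta> w" using that v by (simp add: \<theta>_def divide_right_mono)
    have f: "f absolutely_integrable_on {\<theta> u..\<theta> w}" "integral {\<theta> u..\<theta> w} f = z (\<theta> w) - z (\<theta> u)"
      using z in_ab[OF that(1)] in_ab[OF that(2)] le by (auto simp: lipschitz_primitive_def ae_primitive_on_def)
    then have fi: "f integrable_on {\<theta> u..\<theta> w}" "(\<lambda>s. norm (f s)) integrable_on {\<theta> u..\<theta> w}"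
      by (auto simp: absolutely_integrable_on_def)
    have I: "((\<lambda>\<tau>. f (\<theta> \<tau>)) has_integral v *\<^sub>R (z (\<theta> w) - z (\<theta> u))) {u..w}"
      using sub[OF integrable_integral[OF fi(1)]] f(2) by simp
    have "(\<lambda>\<tau>. norm (f (\<theta> \<tau>))) integrable_on {u..w}"
      using sub[OF integrable_integral[OF fi(2)]] by (rule has_integral_integrable)
    then have "(\<lambda>\<tau>. f (\<theta> \<tau>)) absolutely_integrable_on {u..w}"
      using I by (auto simp: absolutely_integrable_on_def)
    then show "(\<lambda>\<tau>. f (\<theta> \<tau>) / of_real v) absolutely_integrable_on {u..w}" by simp
    show "integral {u..w} (\<lambda>\<tau>. f (\<theta> \<tau>) / of_real v) = z (\<theta> w) - z (\<theta> u)"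
      using has_integral_divide[OF I, of "of_real v"] v
      by (intro integral_unique) (simp add: scaleR_conv_of_real)
  qed
  moreover have "bounded ((\<lambda>\<tau>. f (\<theta> \<tau>) / of_real v) ` {a..a + v * (b - a)})"
  proof -
    obtain M where M: "\<And>s. s \<in> {a..b} \<Longrightarrow> norm (f s) \<le> M"
      using z unfolding lipschitz_primitive_def bounded_iff by blast
    have "norm (f (\<theta> \<tau>) / of_real v) \<le> M / v" if "\<tau> \<in> {a..a + v * (b - a)}" for \<tau>
      using M[OF in_ab[OF that]] v by (simp add: norm_divide divide_right_mono)
    then show ?thesis unfolding bounded_iff by blast
  qed
  ultimately show ?thesis
    unfolding lipschitz_primitive_def ae_primitive_on_def \<theta>_def by auto
qed

lemma bounded_borel_absolutely_integrable:
  fixes a b :: real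
  assumes w: "w \<in> borel_measurable borel" and M: "\<And>s. \<bar>w s\<bar> \<le> M"
  shows "(\<lambda>s. complex_of_real (w s)) absolutely_integrable_on {a..b}"
proof (rule measurable_bounded_by_integrable_imp_absolutely_integrable)
  have "(\<lambda>s. complex_of_real (w s)) \<in> borel_measurable lborel" using w by simp
  then show "(\<lambda>s. complex_of_real (w s)) \<in> borel_measurable (lebesgue_on {a..b})"
    by (intro measurable_restrict_space1 measurable_completion)
  show "(\<lambda>_. M) integrable_on {a..b}" by auto
  show "norm (complex_of_real (w s)) \<le> M" for s using M by simp
qed auto

lemma bounded_borel_times_continuous:
  fixes a b :: real and z :: "real \<Rightarrow> complex"
  assumes w: "w \<in> borel_measurable borel" and M: "\<And>s. \<bar>w s\<bar> \<le> M" and z: "continuous_on {a..b} z"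
  shows "(\<lambda>s. of_real (w s) * z s) absolutely_integrable_on {a..b}"
  using absolutely_integrable_on_times_continuous[OF bounded_borel_absolutely_integrable[OF w M] z]
  by (simp add: mult.commute)

lemma bounded_of_real_image:
  assumes "\<And>s. \<bar>w s\<bar> \<le> N"
  shows "bounded ((\<lambda>s. complex_of_real (w s)) ` A)"
  using assms by (auto simp: bounded_iff)

lemma nonneg_integral_zero_AE:
  fixes h :: "real \<Rightarrow> real"
  assumes h: "h absolutely_integrable_on {a..b}" and nn: "\<And>s. s \<in> {a..b} \<Longrightarrow> 0 \<le> h s"
    and i: "integral {a..b} h = 0"
  shows "AE s in lebesgue_on {a..b}. h s = 0"
proof -
  have int: "integrable (lebesgue_on {a..b}) h"
    using h by (simp add: absolutely_integrable_imp_integrable)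
  have "integral\<^sup>L (lebesgue_on {a..b}) h = 0"
    using lebesgue_integral_eq_integral[OF int] i by simp
  moreover have "AE s in lebesgue_on {a..b}. 0 \<le> h s"
    using nn by (intro AE_I2) (auto simp: space_restrict_space)
  ultimately show ?thesis using integral_nonneg_eq_0_iff_AE[OF int] by simp
qed

lemma AE_lebesgue_on_negligible:
  fixes a b :: real
  shows "(AE s in lebesgue_on {a..b}. P s) \<longleftrightarrow> negligible {s \<in> {a..b}. \<not> P s}"
proof -
  have "(AE s in lebesgue_on {a..b}. P s) \<longleftrightarrow> (AE s in lebesgue. s \<in> {a..b} \<longrightarrow> P s)"
    by (subst AE_restrict_space_iff) auto
  also have "\<dots> \<longleftrightarrow> (\<exists>N. negligible N \<and> {s \<in> {a..b}. \<not> P s} \<subseteq> N)"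
    unfolding eventually_ae_filter by (simp add: negligible_iff_null_sets Bex_def)
  also have "\<dots> \<longleftrightarrow> negligible {s \<in> {a..b}. \<not> P s}"
    using negligible_subset by blast
  finally show ?thesis .
qed

text \<open>Passing to a Borel representative with bounds at every time removes all null sets from the
measurability and boundedness conditions of later arguments.\<close>

lemma bounded_borel_representative:
  fixes a m1 m2 :: real and \<epsilon> :: "real \<Rightarrow> real"
  assumes \<epsilon>: "\<epsilon> \<in> borel_measurable (lebesgue_on {a<..})"
    and bd: "AE s in lebesgue_on {a<..}. m1 \<le> \<epsilon> s \<and> \<epsilon> s \<le> m2" and m: "m1 \<le> m2"
  obtains \<epsilon>' S where "\<epsilon>' \<in> borel_measurable borel" "\<And>s. m1 \<le> \<epsilon>' s" "\<And>s. \<epsilon>' s \<le> m2"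
    "negligible S" "\<And>s. a \<le> s \<Longrightarrow> s \<notin> S \<Longrightarrow> \<epsilon> s = \<epsilon>' s"
proof -
  have "(\<lambda>s. if s \<in> {a<..} then \<epsilon> s else 0) \<in> borel_measurable lebesgue"
    by (rule borel_measurable_if_I[OF \<epsilon>]) auto
  from completion_ex_borel_measurable_real[OF this]
  obtain g where g: "g \<in> borel_measurable lborel" "AE s in lborel. (if s \<in> {a<..} then \<epsilon> s else 0) = g s"
    by blast
  from g(2) have "AE s in lebesgue. (if s \<in> {a<..} then \<epsilon> s else 0) = g s"
    by (rule AE_completion)
  moreover have "AE s in lebesgue. s \<in> {a<..} \<longrightarrow> m1 \<le> \<epsilon> s \<and> \<epsilon> s \<le> m2"
    using bd by (subst (asm) AE_restrict_space_iff) auto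
  ultimately have "AE s in lebesgue. a < s \<longrightarrow> \<epsilon> s = max m1 (min m2 (g s))"
    by eventually_elim auto
  then obtain N where N: "negligible N" "{s. \<not> (a < s \<longrightarrow> \<epsilon> s = max m1 (min m2 (g s)))} \<subseteq> N"
    unfolding eventually_ae_filter by (auto simp: negligible_iff_null_sets)
  show thesis
  proof (rule that[of "\<lambda>s. max m1 (min m2 (g s))" "insert a N"])
    show "(\<lambda>s. max m1 (min m2 (g s))) \<in> borel_measurable borel" using g(1) by simp
    show "negligible (insert a N)" using N(1) by simp
    show "\<epsilon> s = max m1 (min m2 (g s))" if "a \<le> s" "s \<notin> insert a N" for s
      using that N(2) by force
  qed (use m in auto)
qed

section \<open>Linear differential equations with measurable coefficients\<close>

text \<open>Multiplication by \<open>exp (- 2 L (t - a))\<close> makes the integral operator contract by the factor one half, so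
the maximum of the weighted function is at most \<open>2 K\<close>.\<close>

lemma gronwall_bound:
  fixes D :: "real \<Rightarrow> real"
  assumes cont: "continuous_on {a..b} D" and L: "0 < L" and K: "0 \<le> K"
    and D: "\<And>t. t \<in> {a..b} \<Longrightarrow> D t \<le> K + L * integral {a..t} D"
    and t: "t \<in> {a..b}"
  shows "D t \<le> 2 * K * exp (2 * L * (t - a))"
proof -
  define E where "E = (\<lambda>t. exp (- 2 * L * (t - a)) * D t)"
  have "continuous_on {a..b} E" unfolding E_def by (intro continuous_intros cont)
  then obtain m where m: "m \<in> {a..b}" "\<And>r. r \<in> {a..b} \<Longrightarrow> E r \<le> E m"
    using continuous_attains_sup[of "{a..b}" E] t by auto
  have De: "D r = exp (2 * L * (r - a)) * E r" for r by (simp add: E_def flip: mult.assoc exp_add)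
  have "E m \<le> 2 * K"
  proof (cases "E m \<le> 0")
    case True then show ?thesis using K by linarith
  next
    case False
    have *: "((\<lambda>r. exp (2 * L * (r - a))) has_integral
      exp (2 * L * (m - a)) / (2 * L) - exp (2 * L * (a - a)) / (2 * L)) {a..m}"
      using m(1) L by (intro fundamental_theorem_of_calculus)
        (auto intro!: derivative_eq_intros simp flip: has_real_derivative_iff_has_vector_derivative)
    have "integral {a..m} D \<le> integral {a..m} (\<lambda>r. E m * exp (2 * L * (r - a)))"
    proof (rule integral_le)
      show "D integrable_on {a..m}"
        by (rule integrable_continuous_interval, rule continuous_on_subset[OF cont]) (use m in auto)
      show "(\<lambda>r. E m * exp (2 * L * (r - a))) integrable_on {a..m}"
        by (intro integrable_continuous_interval continuous_intros)
      show "D r \<le> E m * exp (2 * L * (r - a))" if "r \<in> {a..m}" for r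
        unfolding De[of r] using m that by (simp add: mult.commute)
    qed
    also have "\<dots> = E m * ((exp (2 * L * (m - a)) - 1) / (2 * L))"
      using * by (subst integral_mult_right) (simp add: integral_unique diff_divide_distrib)
    also have "\<dots> \<le> E m * (exp (2 * L * (m - a)) / (2 * L))"
      using False L by (intro mult_left_mono divide_right_mono) auto
    finally have "L * integral {a..m} D \<le> L * (E m * (exp (2 * L * (m - a)) / (2 * L)))"
      using L by (intro mult_left_mono) auto
    with D[OF m(1)] have "D m \<le> K + E m * exp (2 * L * (m - a)) / 2"
      using L by simp
    then have "E m * exp (2 * L * (m - a)) \<le> 2 * K"
      unfolding De[of m] by (simp add: mult.commute)
    moreover have "E m * 1 \<le> E m * exp (2 * L * (m - a))"
      using False L m(1) by (intro mult_left_mono) auto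
    ultimately show ?thesis by simp
  qed
  then have "E t \<le> 2 * K" using m(2)[OF t] by simp
  then have "exp (2 * L * (t - a)) * E t \<le> exp (2 * L * (t - a)) * (2 * K)" by simp
  then show ?thesis unfolding De[of t] by (simp add: mult_ac)
qed

text \<open>On an interval of radius \<open>1 / (2 (\<bar>L\<bar> + 1))\<close> about a zero, the maximum of the norm is at most half of
itself.  So the zeros form an open and closed set.  The hypothesis is symmetric in time, unlike
Gronwall's.\<close>

lemma zero_propagates:
  fixes d :: "real \<Rightarrow> 'a::real_normed_vector"
  assumes cont: "continuous_on {a..b} d"
    and inc: "\<And>s t m. s \<in> {a..b} \<Longrightarrow> t \<in> {a..b} \<Longrightarrow> s \<le> t \<Longrightarrow>
        (\<And>r. r \<in> {s..t} \<Longrightarrow> norm (d r) \<le> m) \<Longrightarrow> norm (d t - d s) \<le> L * m * (t - s)"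
    and s0: "s0 \<in> {a..b}" "d s0 = 0" and s: "s \<in> {a..b}"
  shows "d s = 0"
proof -
  define \<delta> where "\<delta> = 1 / (2 * (\<bar>L\<bar> + 1))"
  have \<delta>: "\<delta> > 0" by (simp add: \<delta>_def)
  have near: "d y = 0" if x: "x \<in> {a..b}" "d x = 0" and y: "y \<in> {a..b}" "\<bar>y - x\<bar> \<le> \<delta>" for x y
  proof -
    define I where "I = {a..b} \<inter> {x - \<delta>..x + \<delta>}"
    have "continuous_on I (\<lambda>r. norm (d r))"
      unfolding I_def by (intro continuous_on_norm continuous_on_subset[OF cont]) auto
    moreover have "compact I" "I \<noteq> {}" unfolding I_def using x \<delta> by (auto intro: compact_Int_closed)
    ultimately obtain m where m: "m \<in> I" "\<And>r. r \<in> I \<Longrightarrow> norm (d r) \<le> norm (d m)"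
      using continuous_attains_sup[of I "\<lambda>r. norm (d r)"] by auto
    have "norm (d m - d x) \<le> L * norm (d m) * \<bar>m - x\<bar>"
    proof (cases "x \<le> m")
      case True
      then show ?thesis using inc[of x m "norm (d m)"] m x \<delta> by (auto simp: I_def)
    next
      case False
      then show ?thesis using inc[of m x "norm (d m)"] m x \<delta> by (auto simp: I_def norm_minus_commute)
    qed
    also have "\<dots> \<le> (\<bar>L\<bar> + 1) * norm (d m) * \<delta>"
      using m(1) by (intro mult_mono mult_right_mono) (auto simp: I_def)
    also have "\<dots> = norm (d m) / 2" by (simp add: \<delta>_def field_simps)
    finally have "norm (d m) \<le> 0" using x by simp
    moreover have "norm (d y) \<le> norm (d m)" using y by (intro m) (auto simp: I_def)
    ultimately show ?thesis by simp
  qed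
  show ?thesis
  proof (rule connected_induction_simple[where S = "{a..b}" and P = "\<lambda>r. d r = 0" and a = s0 and b = s])
    fix x assume x: "x \<in> {a..b}"
    show "\<exists>T. openin (top_of_set {a..b}) T \<and> x \<in> T \<and> (\<forall>u\<in>T. \<forall>v\<in>T. d u = 0 \<longrightarrow> d v = 0)"
    proof (intro exI conjI ballI impI)
      show "openin (top_of_set {a..b}) ({a..b} \<inter> ball x (\<delta>/2))" by auto
      show "x \<in> {a..b} \<inter> ball x (\<delta>/2)" using x \<delta> by simp
      fix u v assume u: "u \<in> {a..b} \<inter> ball x (\<delta>/2)" and v: "v \<in> {a..b} \<inter> ball x (\<delta>/2)" and du: "d u = 0"
      from u v have "\<bar>x - u\<bar> < \<delta> / 2" "\<bar>x - v\<bar> < \<delta> / 2" by (auto simp: dist_real_def)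
      then have "\<bar>v - u\<bar> \<le> \<delta>" by linarith
      with u v show "d v = 0" by (intro near[OF _ du]) auto
    qed
  qed (use s0 s in auto)
qed

text \<open>The right-hand side is only required to be integrable along continuous curves, as is appropriate for
measurable controls.  In the weight \<open>exp (2 L (t - a))\<close> consecutive Picard iterates approach each other
by the factor one half, so they converge uniformly on the whole interval.\<close>

lemma picard_caratheodory_existence:
  fixes F :: "real \<Rightarrow> 'a::euclidean_space \<Rightarrow> 'a"
  assumes L: "0 < L"
    and lip: "\<And>s u v. s \<in> {a..b} \<Longrightarrow> norm (F s u - F s v) \<le> L * norm (u - v)"
    and int: "\<And>u. continuous_on {a..b} u \<Longrightarrow> (\<lambda>s. F s (u s)) integrable_on {a..b}"
  obtains u where "continuous_on {a..b} u"
    "\<And>t. t \<in> {a..b} \<Longrightarrow> u t = u0 + integral {a..t} (\<lambda>s. F s (u s))"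
proof (cases "a \<le> b")
  case False
  then show ?thesis using that[of "\<lambda>_. 0"] by auto
next
  case ab: True
  define \<Phi> where "\<Phi> = (\<lambda>u t. u0 + integral {a..t} (\<lambda>s. F s (u s)))"
  define X where "X = (\<lambda>n. (\<Phi> ^^ n) (\<lambda>_. u0))"
  have XS: "X (Suc n) t = u0 + integral {a..t} (\<lambda>s. F s (X n s))" for n t
    by (simp add: X_def \<Phi>_def)
  have cont: "continuous_on {a..b} (X n)" for n
  proof (induction n)
    case (Suc n)
    show ?case unfolding XS[abs_def]
      by (intro continuous_intros indefinite_integral_continuous_1 int Suc)
  qed (simp add: X_def)
  have int': "(\<lambda>s. F s (u s)) integrable_on {a..t}" if "continuous_on {a..b} u" "t \<in> {a..b}" for u t
    by (rule integrable_on_subinterval[OF int]) (use that in auto)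
  have diff: "norm (integral {a..t} (\<lambda>s. F s (u s)) - integral {a..t} (\<lambda>s. F s (v s)))
      \<le> integral {a..t} g"
    if u: "continuous_on {a..b} u" and v: "continuous_on {a..b} v" and t: "t \<in> {a..b}"
      and g: "continuous_on {a..t} g" and le: "\<And>s. s \<in> {a..t} \<Longrightarrow> L * norm (u s - v s) \<le> g s" for u v t g
  proof -
    have "norm (integral {a..t} (\<lambda>s. F s (u s) - F s (v s))) \<le> integral {a..t} g"
    proof (rule integral_norm_bound_integral)
      show "(\<lambda>s. F s (u s) - F s (v s)) integrable_on {a..t}"
        by (intro integrable_diff int' u v t)
      show "g integrable_on {a..t}" by (intro integrable_continuous_interval g)
      show "norm (F s (u s) - F s (v s)) \<le> g s" if "s \<in> {a..t}" for s
        using lip[of s "u s" "v s"] le[OF that] that t by auto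
    qed
    then show ?thesis
      using int'[OF u t] int'[OF v t] by (simp add: Henstock_Kurzweil_Integration.integral_diff)
  qed
  have "continuous_on {a..b} (\<lambda>t. X 1 t - X 0 t)" by (intro continuous_intros cont)
  from bounded_image_continuous[OF this]
  obtain C where "\<And>t. t \<in> {a..b} \<Longrightarrow> norm (X 1 t - X 0 t) \<le> C"
    unfolding bounded_iff by blast
  then have C: "norm (X 1 t - X 0 t) \<le> \<bar>C\<bar>" if "t \<in> {a..b}" for t using that by force
  have step: "norm (X (Suc n) t - X n t) \<le> \<bar>C\<bar> * (1/2)^n * exp (2 * L * (t - a))"
    if "t \<in> {a..b}" for n t
    using that
  proof (induction n arbitrary: t)
    case 0
    have "\<bar>C\<bar> * 1 \<le> \<bar>C\<bar> * exp (2 * L * (t - a))" using 0 L by (intro mult_left_mono) auto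
    then show ?case using C[OF 0] by simp
  next
    case (Suc n)
    have *: "((\<lambda>r. exp (2 * L * (r - a))) has_integral
      exp (2 * L * (t - a)) / (2 * L) - exp (2 * L * (a - a)) / (2 * L)) {a..t}"
      using Suc(2) L by (intro fundamental_theorem_of_calculus)
        (auto intro!: derivative_eq_intros simp flip: has_real_derivative_iff_has_vector_derivative)
    have "norm (X (Suc (Suc n)) t - X (Suc n) t)
       = norm (integral {a..t} (\<lambda>s. F s (X (Suc n) s)) - integral {a..t} (\<lambda>s. F s (X n s)))"
      unfolding XS[of "Suc n"] XS[of n] by simp
    also have "\<dots> \<le> integral {a..t} (\<lambda>r. L * (\<bar>C\<bar> * (1/2)^n) * exp (2 * L * (r - a)))"
    proof (rule diff[OF cont cont Suc(2)])
      show "continuous_on {a..t} (\<lambda>r. L * (\<bar>C\<bar> * (1/2)^n) * exp (2 * L * (r - a)))"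
        by (intro continuous_intros)
      show "L * norm (X (Suc n) s - X n s) \<le> L * (\<bar>C\<bar> * (1/2)^n) * exp (2 * L * (s - a))"
        if "s \<in> {a..t}" for s
        using Suc(1)[of s] that Suc(2) L by (auto simp: mult.assoc)
    qed
    also have "\<dots> = L * (\<bar>C\<bar> * (1/2)^n) * ((exp (2 * L * (t - a)) - 1) / (2 * L))"
      using * by (subst integral_mult_right) (simp add: integral_unique diff_divide_distrib)
    also have "\<dots> \<le> L * (\<bar>C\<bar> * (1/2)^n) * (exp (2 * L * (t - a)) / (2 * L))"
      using L by (intro mult_left_mono divide_right_mono) auto
    also have "\<dots> = \<bar>C\<bar> * (1/2)^(Suc n) * exp (2 * L * (t - a))" using L by simp
    finally show ?case .
  qed
  define f where "f = (\<lambda>n t. X (Suc n) t - X n t)"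
  define u where "u = (\<lambda>t. u0 + (\<Sum>n. f n t))"
  have "uniform_limit {a..b} (\<lambda>n t. \<Sum>i<n. f i t) (\<lambda>t. \<Sum>i. f i t) sequentially"
  proof (rule Weierstrass_m_test)
    show "norm (f n t) \<le> \<bar>C\<bar> * exp (2 * L * (b - a)) * (1/2)^n" if "t \<in> {a..b}" for n t
    proof -
      have "\<bar>C\<bar> * (1/2)^n * exp (2 * L * (t - a)) \<le> \<bar>C\<bar> * (1/2)^n * exp (2 * L * (b - a))"
        using that L by (intro mult_left_mono) auto
      with step[OF that, of n] show ?thesis by (simp add: f_def mult_ac)
    qed
    show "summable (\<lambda>n. \<bar>C\<bar> * exp (2 * L * (b - a)) * (1/2)^n)"
      by (intro summable_mult summable_geometric) auto
  qed
  then have "uniform_limit {a..b} (\<lambda>n t. u0 + (\<Sum>i<n. f i t)) u sequentially"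
    unfolding u_def by (intro uniform_limit_add uniform_limit_const)
  moreover have "u0 + (\<Sum>i<n. f i t) = X n t" for n t
    using sum_lessThan_telescope[of "\<lambda>i. X i t" n] by (simp add: f_def) (simp add: X_def)
  ultimately have lim: "uniform_limit {a..b} X u sequentially" by simp
  have cu: "continuous_on {a..b} u"
    by (rule uniform_limit_theorem[OF _ lim]) (intro always_eventually allI cont, simp)
  have "u t = u0 + integral {a..t} (\<lambda>s. F s (u s))" if t: "t \<in> {a..b}" for t
  proof (rule LIMSEQ_unique)
    have "(\<lambda>n. X n t) \<longlonglongrightarrow> u t" using tendsto_uniform_limitI[OF lim t] .
    then show "(\<lambda>n. X (Suc n) t) \<longlonglongrightarrow> u t" by (rule LIMSEQ_Suc)
    show "(\<lambda>n. X (Suc n) t) \<longlonglongrightarrow> u0 + integral {a..t} (\<lambda>s. F s (u s))"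
      unfolding tendsto_iff
    proof (intro allI impI)
      fix e :: real assume e: "0 < e"
      define K where "K = b - a + 1"
      have K: "0 < K" "t - a \<le> K" using t by (auto simp: K_def)
      define e' where "e' = e / (2 * L * K)"
      have e': "e' > 0" using e L K by (simp add: e'_def)
      have "\<forall>\<^sub>F n in sequentially. \<forall>s\<in>{a..b}. dist (X n s) (u s) < e'"
        using uniform_limitD[OF lim e'] .
      then show "\<forall>\<^sub>F n in sequentially. dist (X (Suc n) t) (u0 + integral {a..t} (\<lambda>s. F s (u s))) < e"
      proof eventually_elim
        case (elim n)
        have "norm (integral {a..t} (\<lambda>s. F s (X n s)) - integral {a..t} (\<lambda>s. F s (u s)))
            \<le> integral {a..t} (\<lambda>_. L * e')"
        proof (rule diff[OF cont cu t])
          show "L * norm (X n s - u s) \<le> L * e'" if "s \<in> {a..t}" for s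
          proof -
            have "dist (X n s) (u s) < e'" using elim t that by auto
            then show ?thesis using L by (simp add: dist_norm)
          qed
        qed simp
        also have "\<dots> = (t - a) * (L * e')" using t by simp
        also have "\<dots> \<le> K * (L * e')" using K L e' by (intro mult_right_mono) auto
        also have "\<dots> = e / 2" using L K by (simp add: e'_def)
        also have "\<dots> < e" using e by simp
        finally show ?case by (simp add: XS dist_norm)
      qed
    qed
  qed
  with cu show ?thesis by (rule that)
qed

section \<open>The linear lift of the control system\<close>

text \<open>For \<open>v = 1\<close> this is the lift of the control system with control \<open>w\<close>.  A constant \<open>v > 0\<close> encodes the
control \<open>w / v\<close> acting for the time \<open>v (b - a)\<close>, rescaled to the interval \<open>[a, b]\<close>.\<close>

definition linear_flow ::
  "complex \<Rightarrow> real \<Rightarrow> (real \<Rightarrow> real) \<Rightarrow> real \<Rightarrow> real \<Rightarrow> (real \<Rightarrow> complex) \<Rightarrow> (real \<Rightarrow> complex) \<Rightarrow> bool" where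
  "linear_flow \<kappa> v w a b p q \<longleftrightarrow>
     lipschitz_primitive a b p (\<lambda>s. \<i> * \<kappa> * of_real v * q s) \<and>
     lipschitz_primitive a b q (\<lambda>s. \<i> * \<kappa> * of_real (w s) * p s)"

lemma linear_flow_exists:
  assumes \<kappa>: "\<kappa> \<noteq> 0" and w: "w \<in> borel_measurable borel" and M: "\<And>s. \<bar>w s\<bar> \<le> M"
    and ab: "a \<le> b"
  obtains p q where "linear_flow \<kappa> v w a b p q" "p a = p0" "q a = q0"
proof -
  define F where "F = (\<lambda>s u. (\<i> * \<kappa> * of_real v * snd u, \<i> * \<kappa> * of_real (w s) * fst u))"
  define L where "L = norm \<kappa> * (\<bar>v\<bar> + \<bar>M\<bar>) + 1"
  have L: "0 < L" by (simp add: L_def add_nonneg_pos)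
  have 1: "(\<lambda>s. \<i> * \<kappa> * of_real v * z s) absolutely_integrable_on {a..b}"
    "(\<lambda>s. \<i> * \<kappa> * of_real (w s) * z s) absolutely_integrable_on {a..b}"
    if "continuous_on {a..b} z" for z :: "real \<Rightarrow> complex"
  proof -
    show "(\<lambda>s. \<i> * \<kappa> * of_real v * z s) absolutely_integrable_on {a..b}"
      by (intro absolutely_integrable_continuous_real continuous_intros that)
    have "continuous_on {a..b} (\<lambda>s. \<i> * \<kappa> * z s)" by (intro continuous_intros that)
    from bounded_borel_times_continuous[OF w M this]
    show "(\<lambda>s. \<i> * \<kappa> * of_real (w s) * z s) absolutely_integrable_on {a..b}"
      by (simp add: mult_ac)
  qed
  have "norm (F s x - F s y) \<le> L * norm (x - y)" for s x y
  proof -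
    have "norm (F s x - F s y) \<le> norm (\<i> * \<kappa> * of_real v * (snd x - snd y))
        + norm (\<i> * \<kappa> * of_real (w s) * (fst x - fst y))"
      unfolding F_def by (simp add: algebra_simps norm_Pair_le del: norm_mult)
    also have "\<dots> = norm \<kappa> * \<bar>v\<bar> * norm (snd (x - y)) + norm \<kappa> * \<bar>w s\<bar> * norm (fst (x - y))"
      by (simp add: norm_mult)
    also have "\<dots> \<le> norm \<kappa> * \<bar>v\<bar> * norm (x - y) + norm \<kappa> * \<bar>M\<bar> * norm (x - y)"
    proof -
      have "norm (fst (x - y)) \<le> norm (x - y)" "norm (snd (x - y)) \<le> norm (x - y)"
        by (metis norm_fst_le norm_snd_le prod.collapse)+
      then show ?thesis using M[of s] by (intro add_mono mult_mono) auto
    qed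
    also have "\<dots> \<le> L * norm (x - y)"
      by (simp add: L_def algebra_simps)
    finally show ?thesis .
  qed
  moreover have Fint: "(\<lambda>s. F s (u s)) integrable_on {a..b}" if "continuous_on {a..b} u" for u
  proof -
    have "continuous_on {a..b} (\<lambda>s. fst (u s))" "continuous_on {a..b} (\<lambda>s. snd (u s))"
      by (intro continuous_intros that)+
    from 1(2)[OF this(1)] 1(1)[OF this(2)]
    have "(\<lambda>s. \<i> * \<kappa> * of_real v * snd (u s)) integrable_on {a..b}"
      "(\<lambda>s. \<i> * \<kappa> * of_real (w s) * fst (u s)) integrable_on {a..b}"
      by (simp_all add: set_lebesgue_integral_eq_integral)
    then have "(\<lambda>s. (\<i> * \<kappa> * of_real v * snd (u s), 0) + (0, \<i> * \<kappa> * of_real (w s) * fst (u s))) integrable_on {a..b}"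
      by (intro integrable_add integrable_linear[where h = "\<lambda>x. (x, 0)", unfolded o_def]
          integrable_linear[where h = "\<lambda>x. (0, x)", unfolded o_def])
        (auto intro!: bounded_linear_Pair bounded_linear_ident bounded_linear_zero)
    then show ?thesis unfolding F_def by simp
  qed
  ultimately obtain u where cu: "continuous_on {a..b} u" and
    u: "\<And>t. t \<in> {a..b} \<Longrightarrow> u t = (p0, q0) + integral {a..t} (\<lambda>s. F s (u s))"
    using picard_caratheodory_existence[OF L, of a b F "(p0, q0)"] by blast
  define p q where "p = (\<lambda>s. fst (u s))" and "q = (\<lambda>s. snd (u s))"
  have cp: "continuous_on {a..b} p" and cq: "continuous_on {a..b} q"
    unfolding p_def q_def by (intro continuous_intros cu)+
  have Fpq: "F s (u s) = (\<i> * \<kappa> * of_real v * q s, \<i> * \<kappa> * of_real (w s) * p s)" for s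
    by (simp add: F_def p_def q_def)
  have eq: "p t = p0 + integral {a..t} (\<lambda>s. \<i> * \<kappa> * of_real v * q s)"
    "q t = q0 + integral {a..t} (\<lambda>s. \<i> * \<kappa> * of_real (w s) * p s)" if t: "t \<in> {a..b}" for t
  proof -
    have i: "(\<lambda>s. F s (u s)) integrable_on {a..t}"
      by (rule integrable_on_subinterval[OF Fint[OF cu]]) (use t in auto)
    have "fst (integral {a..t} (\<lambda>s. F s (u s))) = integral {a..t} (\<lambda>s. \<i> * \<kappa> * of_real v * q s)"
      "snd (integral {a..t} (\<lambda>s. F s (u s))) = integral {a..t} (\<lambda>s. \<i> * \<kappa> * of_real (w s) * p s)"
      using integral_linear[OF i bounded_linear_fst] integral_linear[OF i bounded_linear_snd]
      by (simp_all add: o_def Fpq)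
    with u[OF t] show "p t = p0 + integral {a..t} (\<lambda>s. \<i> * \<kappa> * of_real v * q s)"
      "q t = q0 + integral {a..t} (\<lambda>s. \<i> * \<kappa> * of_real (w s) * p s)"
      by (simp_all add: p_def q_def)
  qed
  have bw: "bounded ((\<lambda>s. \<i> * \<kappa> * of_real (w s)) ` {a..b})"
    using M by (auto simp: bounded_iff norm_mult intro!: exI[of _ "norm \<kappa> * M"] mult_left_mono)
  have bq: "bounded ((\<lambda>s. \<i> * \<kappa> * of_real v * q s) ` {a..b})"
    by (intro bounded_image_continuous continuous_intros cq)
  have bp: "bounded ((\<lambda>s. \<i> * \<kappa> * of_real (w s) * p s) ` {a..b})"
    by (intro bounded_mult_image bw bounded_image_continuous cp)
  have "linear_flow \<kappa> v w a b p q"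
    unfolding linear_flow_def
    using lipschitz_primitiveI[OF 1(1)[OF cq] bq eq(1)] lipschitz_primitiveI[OF 1(2)[OF cp] bp eq(2)]
    by blast
  moreover have "p a = p0" "q a = q0" using eq[of a] ab by auto
  ultimately show thesis by (rule that)
qed

lemma linear_flow_continuous:
  assumes "linear_flow \<kappa> v w a b p q"
  shows "continuous_on {a..b} p" "continuous_on {a..b} q"
  using assms by (auto simp: linear_flow_def intro: lipschitz_primitive_continuous)

lemma linear_flow_bound:
  assumes fl: "linear_flow \<kappa> v w a b p q" and N: "0 < N" "\<bar>v\<bar> \<le> N" "\<And>s. \<bar>w s\<bar> \<le> N"
    and \<kappa>: "\<kappa> \<noteq> 0" and t: "t \<in> {a..b}"
  shows "norm (p t) + norm (q t) \<le> 2 * (norm (p a) + norm (q a)) * exp (2 * (norm \<kappa> * N) * (b - a))"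
proof -
  note c = linear_flow_continuous[OF fl]
  have "norm (p t) + norm (q t) \<le> 2 * (norm (p a) + norm (q a)) * exp (2 * (norm \<kappa> * N) * (t - a))"
  proof (rule gronwall_bound[OF _ _ _ _ t])
    fix t assume t: "t \<in> {a..b}"
    have "norm (p t - p a) \<le> integral {a..t} (\<lambda>s. norm \<kappa> * N * norm (q s))"
      using fl N unfolding linear_flow_def
      by (intro lipschitz_primitive_norm_le[OF _ _ _ t] continuous_intros c)
        (auto simp: norm_mult intro!: mult_right_mono mult_left_mono)
    moreover have "norm (q t - q a) \<le> integral {a..t} (\<lambda>s. norm \<kappa> * N * norm (p s))"
      using fl N unfolding linear_flow_def
      by (intro lipschitz_primitive_norm_le[OF _ _ _ t] continuous_intros c)
        (auto simp: norm_mult intro!: mult_right_mono mult_left_mono)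
    moreover have "integral {a..t} (\<lambda>s. norm \<kappa> * N * norm (q s)) + integral {a..t} (\<lambda>s. norm \<kappa> * N * norm (p s))
       = integral {a..t} (\<lambda>s. norm \<kappa> * N * norm (q s) + norm \<kappa> * N * norm (p s))"
      by (intro Henstock_Kurzweil_Integration.integral_add[symmetric] integrable_continuous_interval
          continuous_intros continuous_on_subset[OF c(1)] continuous_on_subset[OF c(2)])
        (use t in auto)
    moreover have "\<dots> = norm \<kappa> * N * integral {a..t} (\<lambda>s. norm (p s) + norm (q s))"
      by (simp flip: integral_mult_right add: algebra_simps)
    moreover have "norm (p t) \<le> norm (p a) + norm (p t - p a)" "norm (q t) \<le> norm (q a) + norm (q t - q a)"
      by (metis add.commute diff_add_cancel norm_triangle_ineq)+
    ultimately show "norm (p t) + norm (q t) \<le> norm (p a) + norm (q a)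
        + norm \<kappa> * N * integral {a..t} (\<lambda>s. norm (p s) + norm (q s))"
      by linarith
  qed (use N \<kappa> in \<open>auto intro!: continuous_intros c\<close>)
  also have "\<dots> \<le> 2 * (norm (p a) + norm (q a)) * exp (2 * (norm \<kappa> * N) * (b - a))"
    using t N by (intro mult_left_mono) (auto intro!: mult_left_mono)
  finally show ?thesis .
qed

text \<open>Gronwall applied to the difference of two flows.  It yields both the first-order approximation of a
perturbed flow and the continuity of the perturbed flow in its parameters.\<close>

lemma linear_flow_dependence:
  assumes f1: "linear_flow \<kappa> v1 w1 a b p1 q1" and f2: "linear_flow \<kappa> v2 w2 a b p2 q2"
    and N: "0 < N" "\<bar>v1\<bar> \<le> N" "\<And>s. \<bar>w1 s\<bar> \<le> N"
    and d: "\<bar>v1 - v2\<bar> \<le> \<eta>" "\<And>s. \<bar>w1 s - w2 s\<bar> \<le> \<eta>"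
    and i: "p1 a = p2 a" "q1 a = q2 a"
    and B: "\<And>s. s \<in> {a..b} \<Longrightarrow> norm (p2 s) + norm (q2 s) \<le> B"
    and \<kappa>: "\<kappa> \<noteq> 0" and t: "t \<in> {a..b}"
  shows "norm (p1 t - p2 t) + norm (q1 t - q2 t)
     \<le> 2 * (norm \<kappa> * \<eta> * B * (b - a)) * exp (2 * (norm \<kappa> * N) * (b - a))"
proof -
  note c = linear_flow_continuous[OF f1] linear_flow_continuous[OF f2]
  have \<eta>: "0 \<le> \<eta>" using d(1) by linarith
  have B0: "0 \<le> B" using B[OF t] by (meson add_nonneg_nonneg norm_ge_zero order_trans)
  have "norm (p1 t - p2 t) + norm (q1 t - q2 t)
     \<le> 2 * (norm \<kappa> * \<eta> * B * (b - a)) * exp (2 * (norm \<kappa> * N) * (t - a))"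
  proof (rule gronwall_bound[OF _ _ _ _ t])
    fix t assume t: "t \<in> {a..b}"
    have est: "norm (\<i> * \<kappa> * of_real x1 * z1 - \<i> * \<kappa> * of_real x2 * z2)
        \<le> norm \<kappa> * N * norm (z1 - z2) + norm \<kappa> * \<eta> * norm z2"
      if "\<bar>x1\<bar> \<le> N" "\<bar>x1 - x2\<bar> \<le> \<eta>" for x1 x2 :: real and z1 z2 :: complex
    proof -
      have "\<i> * \<kappa> * of_real x1 * z1 - \<i> * \<kappa> * of_real x2 * z2
          = \<i> * \<kappa> * of_real x1 * (z1 - z2) + \<i> * \<kappa> * of_real (x1 - x2) * z2"
        by (simp add: algebra_simps)
      also have "norm \<dots> \<le> norm \<kappa> * \<bar>x1\<bar> * norm (z1 - z2) + norm \<kappa> * \<bar>x1 - x2\<bar> * norm z2"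
        by (rule norm_triangle_le) (simp add: norm_mult del: of_real_diff)
      also have "\<dots> \<le> norm \<kappa> * N * norm (z1 - z2) + norm \<kappa> * \<eta> * norm z2"
        using that N \<eta> by (intro add_mono mult_mono) auto
      finally show ?thesis .
    qed
    have "norm ((p1 t - p2 t) - (p1 a - p2 a))
        \<le> integral {a..t} (\<lambda>s. norm \<kappa> * N * norm (q1 s - q2 s) + norm \<kappa> * \<eta> * norm (q2 s))"
      using f1 f2 N d unfolding linear_flow_def
      by (intro lipschitz_primitive_norm_le[OF lipschitz_primitive_diff _ _ t] continuous_intros c)
        (auto intro!: est)
    moreover have "norm ((q1 t - q2 t) - (q1 a - q2 a))
        \<le> integral {a..t} (\<lambda>s. norm \<kappa> * N * norm (p1 s - p2 s) + norm \<kappa> * \<eta> * norm (p2 s))"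
      using f1 f2 N d unfolding linear_flow_def
      by (intro lipschitz_primitive_norm_le[OF lipschitz_primitive_diff _ _ t] continuous_intros c)
        (auto intro!: est)
    moreover have "integral {a..t} (\<lambda>s. norm \<kappa> * N * norm (q1 s - q2 s) + norm \<kappa> * \<eta> * norm (q2 s))
        + integral {a..t} (\<lambda>s. norm \<kappa> * N * norm (p1 s - p2 s) + norm \<kappa> * \<eta> * norm (p2 s))
       \<le> norm \<kappa> * \<eta> * B * (b - a) + norm \<kappa> * N * integral {a..t} (\<lambda>s. norm (p1 s - p2 s) + norm (q1 s - q2 s))"
    proof -
      have int: "(\<lambda>s. norm \<kappa> * N * norm (q1 s - q2 s) + norm \<kappa> * \<eta> * norm (q2 s)) integrable_on {a..t}"
        "(\<lambda>s. norm \<kappa> * N * norm (p1 s - p2 s) + norm \<kappa> * \<eta> * norm (p2 s)) integrable_on {a..t}"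
        "(\<lambda>s. norm \<kappa> * N * (norm (p1 s - p2 s) + norm (q1 s - q2 s))) integrable_on {a..t}"
        by (intro integrable_continuous_interval continuous_intros
            continuous_on_subset[OF c(1)] continuous_on_subset[OF c(2)]
            continuous_on_subset[OF c(3)] continuous_on_subset[OF c(4)]; use t in force)+
      have "integral {a..t} (\<lambda>s. norm \<kappa> * N * norm (q1 s - q2 s) + norm \<kappa> * \<eta> * norm (q2 s))
        + integral {a..t} (\<lambda>s. norm \<kappa> * N * norm (p1 s - p2 s) + norm \<kappa> * \<eta> * norm (p2 s))
        = integral {a..t} (\<lambda>s. (norm \<kappa> * N * norm (q1 s - q2 s) + norm \<kappa> * \<eta> * norm (q2 s))
          + (norm \<kappa> * N * norm (p1 s - p2 s) + norm \<kappa> * \<eta> * norm (p2 s)))"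
        by (intro Henstock_Kurzweil_Integration.integral_add[symmetric] int)
      also have "\<dots> \<le> integral {a..t} (\<lambda>s. norm \<kappa> * N * (norm (p1 s - p2 s) + norm (q1 s - q2 s))
          + norm \<kappa> * \<eta> * B)"
      proof (rule integral_le)
        fix s assume s: "s \<in> {a..t}"
        have "norm \<kappa> * \<eta> * (norm (p2 s) + norm (q2 s)) \<le> norm \<kappa> * \<eta> * B"
          using B[of s] s t \<eta> by (intro mult_left_mono) auto
        then show "norm \<kappa> * N * norm (q1 s - q2 s) + norm \<kappa> * \<eta> * norm (q2 s)
          + (norm \<kappa> * N * norm (p1 s - p2 s) + norm \<kappa> * \<eta> * norm (p2 s))
          \<le> norm \<kappa> * N * (norm (p1 s - p2 s) + norm (q1 s - q2 s)) + norm \<kappa> * \<eta> * B"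
          by (simp add: algebra_simps)
      qed (intro integrable_add int integrable_const_ivl)+
      also have "\<dots> = norm \<kappa> * N * integral {a..t} (\<lambda>s. norm (p1 s - p2 s) + norm (q1 s - q2 s))
          + norm \<kappa> * \<eta> * B * (t - a)"
        using t by (subst Henstock_Kurzweil_Integration.integral_add[OF int(3)]) auto
      also have "\<dots> \<le> norm \<kappa> * N * integral {a..t} (\<lambda>s. norm (p1 s - p2 s) + norm (q1 s - q2 s))
          + norm \<kappa> * \<eta> * B * (b - a)"
        using t \<eta> B0 by (intro add_left_mono mult_left_mono) auto
      finally show ?thesis by simp
    qed
    ultimately show "norm (p1 t - p2 t) + norm (q1 t - q2 t) \<le> norm \<kappa> * \<eta> * B * (b - a)
        + norm \<kappa> * N * integral {a..t} (\<lambda>s. norm (p1 s - p2 s) + norm (q1 s - q2 s))"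
      using i by simp
  next
    show "0 \<le> norm \<kappa> * \<eta> * B * (b - a)" using \<eta> B0 t by simp
  qed (use N \<kappa> in \<open>auto intro!: continuous_intros c\<close>)
  also have "\<dots> \<le> 2 * (norm \<kappa> * \<eta> * B * (b - a)) * exp (2 * (norm \<kappa> * N) * (b - a))"
    using t N \<eta> B0 by (intro mult_left_mono) (auto intro!: mult_left_mono)
  finally show ?thesis .
qed

lemma linear_flow_zero_propagates:
  assumes fl: "linear_flow \<kappa> v w a b p q" and N: "\<bar>v\<bar> \<le> N" "\<And>s. \<bar>w s\<bar> \<le> N"
    and s: "s \<in> {a..b}" "t \<in> {a..b}" and z: "p s = 0" "q s = 0"
  shows "p t = 0 \<and> q t = 0"
proof -
  have N0: "0 \<le> N" using N(1) by linarith
  define d where "d = (\<lambda>s. (p s, q s))"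
  have cd: "continuous_on {a..b} d"
    unfolding d_def by (intro continuous_intros linear_flow_continuous[OF fl])
  have inc: "norm (d t - d s) \<le> 2 * (norm \<kappa> * N) * m * (t - s)"
    if st: "s \<in> {a..b}" "t \<in> {a..b}" "s \<le> t" and m: "\<And>r. r \<in> {s..t} \<Longrightarrow> norm (d r) \<le> m" for s t m
  proof -
    have m': "norm (p r) \<le> m" "norm (q r) \<le> m" if "r \<in> {s..t}" for r
      using m[OF that] norm_fst_le[of "p r" "q r"] norm_snd_le[of "q r" "p r"] by (auto simp: d_def)
    have "norm (p t - p s) \<le> (norm \<kappa> * N * m) * (t - s)"
      using fl m' N N0 unfolding linear_flow_def
      by (intro lipschitz_primitive_norm_increment_le[OF _ st])
        (auto simp: norm_mult intro!: mult_mono)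
    moreover have "norm (q t - q s) \<le> (norm \<kappa> * N * m) * (t - s)"
      using fl m' N N0 unfolding linear_flow_def
      by (intro lipschitz_primitive_norm_increment_le[OF _ st])
        (auto simp: norm_mult intro!: mult_mono)
    ultimately show ?thesis
      using norm_Pair_le[of "p t - p s" "q t - q s"] by (simp add: d_def algebra_simps)
  qed
  have "d s = 0" using z by (simp add: d_def zero_prod_def)
  from zero_propagates[OF cd inc s(1) this s(2)] show ?thesis by (simp add: d_def zero_prod_def)
qed

lemma linear_flow_scale:
  assumes "linear_flow \<kappa> v w a b p q"
  shows "linear_flow \<kappa> v w a b (\<lambda>s. c * p s) (\<lambda>s. c * q s)"
  unfolding linear_flow_def
proof
  have pq: "lipschitz_primitive a b p (\<lambda>s. \<i> * \<kappa> * of_real v * q s)"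
    "lipschitz_primitive a b q (\<lambda>s. \<i> * \<kappa> * of_real (w s) * p s)"
    using assms by (auto simp: linear_flow_def)
  show "lipschitz_primitive a b (\<lambda>s. c * p s) (\<lambda>s. \<i> * \<kappa> * of_real v * (c * q s))"
    by (rule lipschitz_primitive_cong[OF lipschitz_primitive_cmult[OF pq(1), of c]]) auto
  show "lipschitz_primitive a b (\<lambda>s. c * q s) (\<lambda>s. \<i> * \<kappa> * of_real (w s) * (c * p s))"
    by (rule lipschitz_primitive_cong[OF lipschitz_primitive_cmult[OF pq(2), of c]]) auto
qed

lemma linear_flow_spike:
  assumes fl: "linear_flow \<kappa> v w a b p q" and S: "negligible S"
    and eq: "\<And>s. s \<in> {a..b} - S \<Longrightarrow> w s = w' s" and N: "\<And>s. \<bar>w' s\<bar> \<le> N"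
  shows "linear_flow \<kappa> v w' a b p q"
proof -
  have "ae_primitive_on {a..b} q (\<lambda>s. \<i> * \<kappa> * of_real (w s) * p s)"
    using fl by (auto simp: linear_flow_def lipschitz_primitive_def)
  then have "ae_primitive_on {a..b} q (\<lambda>s. \<i> * \<kappa> * of_real (w' s) * p s)"
    by (rule ae_primitive_on_spike[OF _ order_refl S]) (simp add: eq)
  moreover have "bounded ((\<lambda>s. of_real (w' s) * (\<i> * \<kappa> * p s)) ` {a..b})"
    by (intro bounded_mult_image[OF bounded_of_real_image[OF N]] bounded_image_continuous continuous_intros
        linear_flow_continuous(1)[OF fl])
  then have "bounded ((\<lambda>s. \<i> * \<kappa> * of_real (w' s) * p s) ` {a..b})"
    by (simp add: mult_ac)
  ultimately show ?thesis using fl by (auto simp: linear_flow_def lipschitz_primitive_def)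
qed

lemma linear_flow_rescale:
  assumes "linear_flow \<kappa> v w a b p q" and v: "0 < v"
  shows "linear_flow \<kappa> 1 (\<lambda>\<tau>. w (a + (\<tau> - a) / v) / v) a (a + v * (b - a))
     (\<lambda>\<tau>. p (a + (\<tau> - a) / v)) (\<lambda>\<tau>. q (a + (\<tau> - a) / v))"
  unfolding linear_flow_def
proof
  have pq: "lipschitz_primitive a b p (\<lambda>s. \<i> * \<kappa> * of_real v * q s)"
    "lipschitz_primitive a b q (\<lambda>s. \<i> * \<kappa> * of_real (w s) * p s)"
    using assms by (auto simp: linear_flow_def)
  show "lipschitz_primitive a (a + v * (b - a)) (\<lambda>\<tau>. p (a + (\<tau> - a) / v))
      (\<lambda>\<tau>. \<i> * \<kappa> * of_real 1 * q (a + (\<tau> - a) / v))"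
    by (rule lipschitz_primitive_cong[OF lipschitz_primitive_rescale[OF pq(1) v]]) (use v in auto)
  show "lipschitz_primitive a (a + v * (b - a)) (\<lambda>\<tau>. q (a + (\<tau> - a) / v))
      (\<lambda>\<tau>. \<i> * \<kappa> * of_real (w (a + (\<tau> - a) / v) / v) * p (a + (\<tau> - a) / v))"
    by (rule lipschitz_primitive_cong[OF lipschitz_primitive_rescale[OF pq(2) v]]) (use v in auto)
qed

section \<open>Trajectories on the Riemann sphere as projected flows\<close>

text \<open>The point with homogeneous coordinates \<open>(p, q)\<close>.  The pair \<open>(0, 0)\<close> is mapped to \<open>Infty\<close> as well, which
is why the lemmas below require nonvanishing pairs.\<close>

definition projective_ratio :: "complex \<Rightarrow> complex \<Rightarrow> riemann_sphere" where
  "projective_ratio p q = (if p = 0 then Infty else Fin (q / p))"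

lemma trajectory_spike:
  assumes x: "trajectory \<kappa> \<epsilon> a b x" and S: "negligible S"
    and eq: "\<And>s. s \<in> {a..b} - S \<Longrightarrow> \<epsilon> s = \<epsilon>' s"
  shows "trajectory \<kappa> \<epsilon>' a b x"
  unfolding trajectory_def
proof (intro ballI)
  fix s assume "s \<in> {a..b}"
  with x obtain \<delta> J where d: "\<delta> > 0" "J = {a..b} \<inter> {s - \<delta>..s + \<delta>}" and
    *: "((\<forall>r\<in>J. x r \<noteq> Infty) \<and>
           ae_primitive_on J (\<lambda>r. chart_fin (x r))
             (\<lambda>r. \<i> * \<kappa> * (- (chart_fin (x r))\<^sup>2 + of_real (\<epsilon> r)))
         \<or>
         (\<forall>r\<in>J. x r \<noteq> Fin 0) \<and>
           ae_primitive_on J (\<lambda>r. chart_inf (x r))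
             (\<lambda>r. \<i> * \<kappa> * (- 1 + of_real (\<epsilon> r) * (chart_inf (x r))\<^sup>2)))"
    unfolding trajectory_def by blast
  have J: "J \<subseteq> {a..b}" using d by auto
  show "\<exists>\<delta>>0. \<exists>J. J = {a..b} \<inter> {s - \<delta>..s + \<delta>} \<and>
        ((\<forall>r\<in>J. x r \<noteq> Infty) \<and>
           ae_primitive_on J (\<lambda>r. chart_fin (x r))
             (\<lambda>r. \<i> * \<kappa> * (- (chart_fin (x r))\<^sup>2 + of_real (\<epsilon>' r)))
         \<or>
         (\<forall>r\<in>J. x r \<noteq> Fin 0) \<and>
           ae_primitive_on J (\<lambda>r. chart_inf (x r))
             (\<lambda>r. \<i> * \<kappa> * (- 1 + of_real (\<epsilon>' r) * (chart_inf (x r))\<^sup>2)))"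
  proof (intro exI conjI)
    have fin: "ae_primitive_on J (\<lambda>r. chart_fin (x r)) (\<lambda>r. \<i> * \<kappa> * (- (chart_fin (x r))\<^sup>2 + of_real (\<epsilon>' r)))"
      if "ae_primitive_on J (\<lambda>r. chart_fin (x r)) (\<lambda>r. \<i> * \<kappa> * (- (chart_fin (x r))\<^sup>2 + of_real (\<epsilon> r)))"
      by (rule ae_primitive_on_spike[OF that J S]) (simp add: eq)
    have inf: "ae_primitive_on J (\<lambda>r. chart_inf (x r)) (\<lambda>r. \<i> * \<kappa> * (- 1 + of_real (\<epsilon>' r) * (chart_inf (x r))\<^sup>2))"
      if "ae_primitive_on J (\<lambda>r. chart_inf (x r)) (\<lambda>r. \<i> * \<kappa> * (- 1 + of_real (\<epsilon> r) * (chart_inf (x r))\<^sup>2))"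
      by (rule ae_primitive_on_spike[OF that J S]) (simp add: eq)
    show "((\<forall>r\<in>J. x r \<noteq> Infty) \<and>
           ae_primitive_on J (\<lambda>r. chart_fin (x r))
             (\<lambda>r. \<i> * \<kappa> * (- (chart_fin (x r))\<^sup>2 + of_real (\<epsilon>' r)))
         \<or>
         (\<forall>r\<in>J. x r \<noteq> Fin 0) \<and>
           ae_primitive_on J (\<lambda>r. chart_inf (x r))
             (\<lambda>r. \<i> * \<kappa> * (- 1 + of_real (\<epsilon>' r) * (chart_inf (x r))\<^sup>2)))"
      using * fin inf by blast
  qed (use d in auto)
qed

lemma interval_Int_interval:
  "{a..b} \<inter> {s - \<delta>..s + \<delta>} = {max a (s - \<delta>)..min b (s + (\<delta>::real))}"
  by auto

lemma homogeneous_linear_zero_propagates: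
  assumes d: "lipschitz_primitive a b d (\<lambda>s. c s * d s)" and c: "bounded (c ` {a..b})"
    and s: "s \<in> {a..b}" "t \<in> {a..b}" "d s = 0"
  shows "d t = 0"
proof -
  obtain L where L: "\<And>s. s \<in> {a..b} \<Longrightarrow> norm (c s) \<le> L" "0 < L"
    using c unfolding bounded_pos by blast
  show ?thesis
  proof (rule zero_propagates[where ?s0.0 = s and L = L])
    show "continuous_on {a..b} d" using d by (rule lipschitz_primitive_continuous)
    fix s t m assume st: "s \<in> {a..b}" "t \<in> {a..b}" "s \<le> t" "\<And>r. r \<in> {s..t} \<Longrightarrow> norm (d r) \<le> m"
    show "norm (d t - d s) \<le> L * m * (t - s)"
    proof (rule lipschitz_primitive_norm_increment_le[OF d st(1-3)])
      fix r assume r: "r \<in> {s..t}"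
      then have "r \<in> {a..b}" using st by auto
      then show "norm (c r * d r) \<le> L * m"
        unfolding norm_mult using st(4)[OF r] L by (intro mult_mono) auto
    qed
  qed (use s in auto)
qed

text \<open>In the finite chart the defect \<open>q - x p\<close> satisfies \<open>d' = - \<i>\<kappa> x d\<close>; in the other chart the defect
\<open>p + x~ q\<close> satisfies \<open>d' = \<i>\<kappa> w x~ d\<close>, where \<open>x~ = - 1 / x\<close>.  Hence agreement of \<open>x\<close> with the projected
flow at one time spreads over the whole time window of a chart, and the times of agreement are open
and closed.  No separate uniqueness theorem for the Riccati equation is involved.\<close>

lemma trajectory_is_projected_flow:
  assumes x: "trajectory \<kappa> w a b x" and fl: "linear_flow \<kappa> 1 w a b p q"
    and N: "\<And>s. \<bar>w s\<bar> \<le> N"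
    and nz: "\<And>s. s \<in> {a..b} \<Longrightarrow> p s \<noteq> 0 \<or> q s \<noteq> 0"
    and x0: "x a = projective_ratio (p a) (q a)" and s: "s \<in> {a..b}"
  shows "x s = projective_ratio (p s) (q s)"
proof (rule connected_induction_simple[where S = "{a..b}" and a = a and b = s
      and P = "\<lambda>s. x s = projective_ratio (p s) (q s)"])
  fix s assume s: "s \<in> {a..b}"
  with x obtain \<delta> J where \<delta>: "\<delta> > 0" and J: "J = {a..b} \<inter> {s - \<delta>..s + \<delta>}" and
    chart: "((\<forall>r\<in>J. x r \<noteq> Infty) \<and>
           ae_primitive_on J (\<lambda>r. chart_fin (x r))
             (\<lambda>r. \<i> * \<kappa> * (- (chart_fin (x r))\<^sup>2 + of_real (w r)))
         \<or>
         (\<forall>r\<in>J. x r \<noteq> Fin 0) \<and>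
           ae_primitive_on J (\<lambda>r. chart_inf (x r))
             (\<lambda>r. \<i> * \<kappa> * (- 1 + of_real (w r) * (chart_inf (x r))\<^sup>2)))"
    unfolding trajectory_def by blast
  define c d where "c = max a (s - \<delta>)" and "d = min b (s + \<delta>)"
  have Jcd: "J = {c..d}" "a \<le> c" "d \<le> b" by (auto simp: J c_def d_def)
  have p: "lipschitz_primitive c d p (\<lambda>s. \<i> * \<kappa> * q s)"
    and q: "lipschitz_primitive c d q (\<lambda>s. \<i> * \<kappa> * of_real (w s) * p s)"
    using fl Jcd by (auto simp: linear_flow_def intro: lipschitz_primitive_subinterval)
  have iw: "bounded ((\<lambda>s. complex_of_real (w s)) ` {c..d})" using N by (rule bounded_of_real_image)
  have all: "x v = projective_ratio (p v) (q v)"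
    if u: "u \<in> J" "x u = projective_ratio (p u) (q u)" and v: "v \<in> J" for u v
    using chart
  proof (elim disjE conjE)
    assume fin: "\<forall>r\<in>J. x r \<noteq> Infty"
      and X: "ae_primitive_on J (\<lambda>r. chart_fin (x r))
             (\<lambda>r. \<i> * \<kappa> * (- (chart_fin (x r))\<^sup>2 + of_real (w r)))"
    define X where "X = (\<lambda>r. chart_fin (x r))"
    have cX: "continuous_on {c..d} X" using X unfolding X_def Jcd by (rule ae_primitive_on_continuous)
    have "bounded ((\<lambda>r. \<i> * \<kappa> * (- (X r)\<^sup>2)) ` {c..d})"
      by (intro bounded_image_continuous continuous_intros cX)
    moreover have "bounded ((\<lambda>r. \<i> * \<kappa> * of_real (w r)) ` {c..d})"
      by (intro bounded_mult_image iw) (auto simp: image_constant_conv)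
    ultimately have "bounded ((\<lambda>r. \<i> * \<kappa> * (- (X r)\<^sup>2) + \<i> * \<kappa> * of_real (w r)) ` {c..d})"
      by (rule bounded_plus_comp)
    with X have "lipschitz_primitive c d X (\<lambda>r. \<i> * \<kappa> * (- (X r)\<^sup>2 + of_real (w r)))"
      by (simp add: lipschitz_primitive_def X_def Jcd ring_distribs)
    from lipschitz_primitive_diff[OF q lipschitz_primitive_mult[OF this p]]
    have "lipschitz_primitive c d (\<lambda>s. q s - X s * p s) (\<lambda>s. (- \<i> * \<kappa> * X s) * (q s - X s * p s))"
      by (rule lipschitz_primitive_cong) (auto simp: algebra_simps power2_eq_square)
    moreover have "bounded ((\<lambda>s. - \<i> * \<kappa> * X s) ` {c..d})"
      by (intro bounded_image_continuous continuous_intros cX)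
    ultimately have propag: "q r - X r * p r = 0" if "q r' - X r' * p r' = 0" "r \<in> J" "r' \<in> J" for r r'
      using homogeneous_linear_zero_propagates[of c d "\<lambda>s. q s - X s * p s" "\<lambda>s. - \<i> * \<kappa> * X s" r' r] that
      by (simp add: Jcd)
    have iff: "x r = projective_ratio (p r) (q r) \<longleftrightarrow> q r - X r * p r = 0" if r: "r \<in> J" for r
    proof -
      have "x r = Fin (X r)" using fin r unfolding X_def by (cases "x r") auto
      moreover have "p r \<noteq> 0 \<or> q r \<noteq> 0" using nz r J by auto
      ultimately show ?thesis by (auto simp: projective_ratio_def field_simps)
    qed
    show ?thesis using iff[OF u(1)] iff[OF v] u v propag by blast
  next
    assume inf: "\<forall>r\<in>J. x r \<noteq> Fin 0"
      and Y: "ae_primitive_on J (\<lambda>r. chart_inf (x r))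
             (\<lambda>r. \<i> * \<kappa> * (- 1 + of_real (w r) * (chart_inf (x r))\<^sup>2))"
    define Y where "Y = (\<lambda>r. chart_inf (x r))"
    have cY: "continuous_on {c..d} Y" using Y unfolding Y_def Jcd by (rule ae_primitive_on_continuous)
    have "bounded ((\<lambda>r. \<i> * \<kappa> * (Y r)\<^sup>2) ` {c..d})"
      by (intro bounded_image_continuous continuous_intros cY)
    then have "bounded ((\<lambda>r. of_real (w r) * (\<i> * \<kappa> * (Y r)\<^sup>2)) ` {c..d})"
      by (rule bounded_mult_image[OF iw])
    moreover have "bounded ((\<lambda>r. - \<i> * \<kappa>) ` {c..d})" by (auto simp: image_constant_conv)
    ultimately have bdd: "bounded ((\<lambda>r. - \<i> * \<kappa> + of_real (w r) * (\<i> * \<kappa> * (Y r)\<^sup>2)) ` {c..d})"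
      by (intro bounded_plus_comp)
    have eq: "- \<i> * \<kappa> + of_real (w r) * (\<i> * \<kappa> * (Y r)\<^sup>2) = \<i> * \<kappa> * (- 1 + of_real (w r) * (Y r)\<^sup>2)" for r
      by (simp add: algebra_simps)
    have "lipschitz_primitive c d Y (\<lambda>r. \<i> * \<kappa> * (- 1 + of_real (w r) * (Y r)\<^sup>2))"
      unfolding lipschitz_primitive_def using Y bdd[unfolded eq] by (simp only: Y_def Jcd)
    from lipschitz_primitive_diff[OF p lipschitz_primitive_cmult[where c = "-1",
          OF lipschitz_primitive_mult[OF this q]]]
    have "lipschitz_primitive c d (\<lambda>s. p s + Y s * q s)
        (\<lambda>s. (of_real (w s) * (\<i> * \<kappa> * Y s)) * (p s + Y s * q s))"
      by (rule lipschitz_primitive_cong) (auto simp: algebra_simps power2_eq_square)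
    moreover have "bounded ((\<lambda>s. \<i> * \<kappa> * Y s) ` {c..d})"
      by (intro bounded_image_continuous continuous_intros cY)
    then have "bounded ((\<lambda>s. of_real (w s) * (\<i> * \<kappa> * Y s)) ` {c..d})"
      by (rule bounded_mult_image[OF iw])
    ultimately have propag: "p r + Y r * q r = 0" if "p r' + Y r' * q r' = 0" "r \<in> J" "r' \<in> J" for r r'
      using homogeneous_linear_zero_propagates[of c d "\<lambda>s. p s + Y s * q s" "\<lambda>s. of_real (w s) * (\<i> * \<kappa> * Y s)" r' r] that
      by (simp add: Jcd)
    have iff: "x r = projective_ratio (p r) (q r) \<longleftrightarrow> p r + Y r * q r = 0" if r: "r \<in> J" for r
    proof -
      have "p r \<noteq> 0 \<or> q r \<noteq> 0" using nz r J by auto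
      moreover have "x r \<noteq> Fin 0" using inf r by auto
      ultimately show ?thesis unfolding Y_def
        by (cases "x r") (auto simp: projective_ratio_def field_simps add_eq_0_iff)
    qed
    show ?thesis using iff[OF u(1)] iff[OF v] u v propag by blast
  qed
  show "\<exists>T. openin (top_of_set {a..b}) T \<and> s \<in> T \<and>
      (\<forall>u\<in>T. \<forall>v\<in>T. x u = projective_ratio (p u) (q u) \<longrightarrow> x v = projective_ratio (p v) (q v))"
  proof (intro exI conjI ballI impI)
    show "openin (top_of_set {a..b}) ({a..b} \<inter> ball s \<delta>)" by auto
    show "s \<in> {a..b} \<inter> ball s \<delta>" using s \<delta> by simp
    fix u v assume u: "u \<in> {a..b} \<inter> ball s \<delta>" and v: "v \<in> {a..b} \<inter> ball s \<delta>"
      and e: "x u = projective_ratio (p u) (q u)"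
    have "u \<in> J" "v \<in> J" using u v by (auto simp: J dist_real_def)
    then show "x v = projective_ratio (p v) (q v)" using all e by blast
  qed
qed (use x0 s in auto)

lemma continuous_nonzero_near:
  fixes f :: "real \<Rightarrow> complex"
  assumes f: "continuous_on {a..b} f" and s: "s \<in> {a..b}" "f s \<noteq> 0"
  obtains \<delta> where "\<delta> > 0" "\<And>r. r \<in> {a..b} \<inter> {s - \<delta>..s + \<delta>} \<Longrightarrow> f r \<noteq> 0"
proof -
  from f s(1) have "\<exists>d>0. \<forall>r\<in>{a..b}. dist r s < d \<longrightarrow> dist (f r) (f s) < norm (f s)"
    using s(2) unfolding continuous_on_iff by (metis zero_less_norm_iff)
  then obtain d where d: "d > 0" "\<And>r. r \<in> {a..b} \<Longrightarrow> dist r s < d \<Longrightarrow> dist (f r) (f s) < norm (f s)"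
    by blast
  show thesis
  proof (rule that[of "d / 2"])
    fix r assume "r \<in> {a..b} \<inter> {s - d / 2..s + d / 2}"
    then have "dist (f r) (f s) < norm (f s)" using d by (auto simp: dist_real_def intro!: d(2))
    then show "f r \<noteq> 0" by auto
  qed (use d in simp)
qed

text \<open>Near each time one of \<open>p\<close> and \<open>q\<close> has no zeros, and the quotient rule gives the Riccati equation in the
corresponding chart.\<close>

lemma projected_flow_is_trajectory:
  assumes fl: "linear_flow \<kappa> 1 w a b p q"
    and nz: "\<And>s. s \<in> {a..b} \<Longrightarrow> p s \<noteq> 0 \<or> q s \<noteq> 0"
  shows "trajectory \<kappa> w a b (\<lambda>s. projective_ratio (p s) (q s))"
  unfolding trajectory_def
proof (intro ballI)
  fix s assume s: "s \<in> {a..b}"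
  let ?x = "\<lambda>s. projective_ratio (p s) (q s)"
  have sub: "lipschitz_primitive c d p (\<lambda>s. \<i> * \<kappa> * q s)"
    "lipschitz_primitive c d q (\<lambda>s. \<i> * \<kappa> * of_real (w s) * p s)" if "a \<le> c" "d \<le> b" for c d
    using fl that by (auto simp: linear_flow_def intro: lipschitz_primitive_subinterval)
  have fin: "ae_primitive_on J (\<lambda>r. chart_fin (?x r)) (\<lambda>r. \<i> * \<kappa> * (- (chart_fin (?x r))\<^sup>2 + of_real (w r)))"
    if J: "J = {a..b} \<inter> {s - \<delta>..s + \<delta>}" and pz: "\<And>r. r \<in> J \<Longrightarrow> p r \<noteq> 0" for J \<delta>
  proof -
    obtain c d where cd: "J = {c..d}" "a \<le> c" "d \<le> b"
      using J interval_Int_interval[of a b s \<delta>] max.cobounded1 min.cobounded1 by metis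
    have pz': "\<And>r. r \<in> {c..d} \<Longrightarrow> p r \<noteq> 0" using pz cd by simp
    have "lipschitz_primitive c d (\<lambda>r. chart_fin (?x r)) (\<lambda>r. \<i> * \<kappa> * (- (chart_fin (?x r))\<^sup>2 + of_real (w r)))"
      by (rule lipschitz_primitive_cong[OF lipschitz_primitive_mult[OF sub(2)[OF cd(2,3)]
            lipschitz_primitive_inverse[OF sub(1)[OF cd(2,3)] pz']]])
        (auto simp: projective_ratio_def pz' field_simps power2_eq_square)
    then show ?thesis by (simp add: lipschitz_primitive_def cd)
  qed
  have inf: "ae_primitive_on J (\<lambda>r. chart_inf (?x r)) (\<lambda>r. \<i> * \<kappa> * (- 1 + of_real (w r) * (chart_inf (?x r))\<^sup>2))"
    if J: "J = {a..b} \<inter> {s - \<delta>..s + \<delta>}" and qz: "\<And>r. r \<in> J \<Longrightarrow> q r \<noteq> 0" for J \<delta>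
  proof -
    obtain c d where cd: "J = {c..d}" "a \<le> c" "d \<le> b"
      using J interval_Int_interval[of a b s \<delta>] max.cobounded1 min.cobounded1 by metis
    have qz': "\<And>r. r \<in> {c..d} \<Longrightarrow> q r \<noteq> 0" using qz cd by simp
    have "lipschitz_primitive c d (\<lambda>r. chart_inf (?x r)) (\<lambda>r. \<i> * \<kappa> * (- 1 + of_real (w r) * (chart_inf (?x r))\<^sup>2))"
      by (rule lipschitz_primitive_cong[OF lipschitz_primitive_cmult[where c = "-1", OF lipschitz_primitive_mult[OF sub(1)[OF cd(2,3)]
            lipschitz_primitive_inverse[OF sub(2)[OF cd(2,3)] qz']]]])
        (auto simp: projective_ratio_def qz' field_simps power2_eq_square)
    then show ?thesis by (simp add: lipschitz_primitive_def cd)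
  qed
  show "\<exists>\<delta>>0. \<exists>J. J = {a..b} \<inter> {s - \<delta>..s + \<delta>} \<and>
        ((\<forall>r\<in>J. ?x r \<noteq> Infty) \<and>
           ae_primitive_on J (\<lambda>r. chart_fin (?x r))
             (\<lambda>r. \<i> * \<kappa> * (- (chart_fin (?x r))\<^sup>2 + of_real (w r)))
         \<or>
         (\<forall>r\<in>J. ?x r \<noteq> Fin 0) \<and>
           ae_primitive_on J (\<lambda>r. chart_inf (?x r))
             (\<lambda>r. \<i> * \<kappa> * (- 1 + of_real (w r) * (chart_inf (?x r))\<^sup>2)))"
  proof (cases "p s = 0")
    case False
    obtain \<delta> where \<delta>: "\<delta> > 0" "\<And>r. r \<in> {a..b} \<inter> {s - \<delta>..s + \<delta>} \<Longrightarrow> p r \<noteq> 0"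
      using continuous_nonzero_near[OF linear_flow_continuous(1)[OF fl] s False] by blast
    then have "\<forall>r\<in>{a..b} \<inter> {s - \<delta>..s + \<delta>}. ?x r \<noteq> Infty" by (auto simp: projective_ratio_def)
    with fin[OF refl \<delta>(2)] \<delta>(1) show ?thesis by blast
  next
    case True
    then have "q s \<noteq> 0" using nz[OF s] by auto
    then obtain \<delta> where \<delta>: "\<delta> > 0" "\<And>r. r \<in> {a..b} \<inter> {s - \<delta>..s + \<delta>} \<Longrightarrow> q r \<noteq> 0"
      using continuous_nonzero_near[OF linear_flow_continuous(2)[OF fl] s] by blast
    then have "\<forall>r\<in>{a..b} \<inter> {s - \<delta>..s + \<delta>}. ?x r \<noteq> Fin 0" by (auto simp: projective_ratio_def)
    with inf[OF refl \<delta>(2)] \<delta>(1) show ?thesis by blast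
  qed
qed

lemma projective_ratio_eq:
  assumes "p * Q = q * P" "p \<noteq> 0 \<or> q \<noteq> 0" "P \<noteq> 0 \<or> Q \<noteq> 0"
  shows "projective_ratio P Q = projective_ratio p q"
  using assms by (auto simp: projective_ratio_def field_simps)

text \<open>The pairs \<open>(v, w)\<close> for which \<open>w / v\<close> is a control with values in \<open>[m1, m2]\<close> and the travel time is
strictly reduced.  In these coordinates the constraints are convex.\<close>

definition admissible :: "real \<Rightarrow> real \<Rightarrow> real \<Rightarrow> (real \<Rightarrow> real) \<Rightarrow> bool" where
  "admissible m1 m2 v w \<longleftrightarrow> 0 < v \<and> v < 1 \<and> w \<in> borel_measurable borel \<and>
     (\<forall>s. m1 * v \<le> w s \<and> w s \<le> m2 * v)"

lemma admissible_bound: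
  assumes m: "0 < m1" and adm: "admissible m1 m2 v w"
  shows "\<bar>w s\<bar> \<le> m2"
proof -
  have *: "m1 * v \<le> w s" "w s \<le> m2 * v" "0 < v" "v < 1" using adm by (auto simp: admissible_def)
  then have "m1 * v \<le> m2 * v" by linarith
  then have "m1 \<le> m2" using *(3) by simp
  then have "0 \<le> m1 * v" "m2 * v \<le> m2 * 1" using m * by (auto intro!: mult_left_mono)
  then show ?thesis using * by linarith
qed

text \<open>Undoing the time rescaling turns an admissible flow into a genuine trajectory of duration
\<open>v (sp - sm)\<close>, which is below the minimum time.\<close>

lemma faster_flow_misses_target:
  assumes n: "0 < n1" "n1 < n2" and s: "sm < sp" and \<kappa>: "\<kappa> \<noteq> 0"
    and min: "ereal (sp - sm) = min_time n1 n2 \<kappa> sm \<eta>m \<eta>p"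
    and adm: "admissible (n1\<^sup>2) (n2\<^sup>2) v w" and fl: "linear_flow \<kappa> v w sm sp P Q"
    and start: "P sm \<noteq> 0 \<or> Q sm \<noteq> 0" "projective_ratio (P sm) (Q sm) = \<eta>m"
  shows "projective_ratio (P sp) (Q sp) \<noteq> \<eta>p"
proof
  assume end_eq: "projective_ratio (P sp) (Q sp) = \<eta>p"
  have v: "0 < v" "v < 1" and wm: "w \<in> borel_measurable borel"
    and w: "\<And>s. n1\<^sup>2 * v \<le> w s" "\<And>s. w s \<le> n2\<^sup>2 * v"
    using adm by (auto simp: admissible_def)
  have n2: "0 < n1\<^sup>2" "0 \<le> n2\<^sup>2" using n by auto
  define w' where "w' = (\<lambda>\<tau>. w (sm + (\<tau> - sm) / v) / v)"
  define s' where "s' = sm + v * (sp - sm)"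
  define P' where "P' = (\<lambda>\<tau>. P (sm + (\<tau> - sm) / v))"
  define Q' where "Q' = (\<lambda>\<tau>. Q (sm + (\<tau> - sm) / v))"
  have fl': "linear_flow \<kappa> 1 w' sm s' P' Q'"
    unfolding w'_def s'_def P'_def Q'_def by (rule linear_flow_rescale[OF fl v(1)])
  have nz: "P r \<noteq> 0 \<or> Q r \<noteq> 0" if "r \<in> {sm..sp}" for r
  proof (rule ccontr)
    assume "\<not> (P r \<noteq> 0 \<or> Q r \<noteq> 0)"
    then have "P sm = 0 \<and> Q sm = 0"
      using linear_flow_zero_propagates[OF fl, of "n2\<^sup>2 + 1" r sm] admissible_bound[OF n2(1) adm] that s v n2
      by (auto simp: add_increasing2 intro: order_trans)
    with start show False by simp
  qed
  have nz': "P' r \<noteq> 0 \<or> Q' r \<noteq> 0" if "r \<in> {sm..s'}" for r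
  proof -
    have "sm + (r - sm) / v \<in> {sm..sp}" using that v by (auto simp: s'_def field_simps)
    then show ?thesis unfolding P'_def Q'_def by (rule nz)
  qed
  have "trajectory \<kappa> w' sm s' (\<lambda>r. projective_ratio (P' r) (Q' r))"
    by (rule projected_flow_is_trajectory[OF fl' nz'])
  moreover have "sm + (s' - sm) / v = sp" using v by (simp add: s'_def)
  ultimately have "steers \<kappa> w' sm s' \<eta>m \<eta>p"
    unfolding steers_def using start end_eq
    by (intro exI[of _ "\<lambda>r. projective_ratio (P' r) (Q' r)"]) (simp add: P'_def Q'_def)
  moreover have "feasible_control n1 n2 sm w'"
  proof -
    have "w' \<in> borel_measurable lborel" unfolding w'_def using wm by measurable
    then have "w' \<in> borel_measurable (lebesgue_on {sm<..})"
      by (intro measurable_restrict_space1 measurable_completion)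
    moreover have "n1\<^sup>2 \<le> w' s \<and> w' s \<le> n2\<^sup>2" for s
      using w[of "sm + (s - sm) / v"] v by (simp add: w'_def field_simps)
    ultimately show ?thesis by (simp add: feasible_control_def)
  qed
  ultimately have "min_time n1 n2 \<kappa> sm \<eta>m \<eta>p \<le> ereal (v * (sp - sm))"
    unfolding min_time_def s'_def using v s by (intro Inf_lower) auto
  then have "sp - sm \<le> v * (sp - sm)" using min by (metis ereal_less_eq(3))
  moreover have "v * (sp - sm) < 1 * (sp - sm)" using v s by (intro mult_strict_right_mono) auto
  ultimately show False by simp
qed

section \<open>The maximum principle\<close>

text \<open>The Wronskian at the final time decides whether both flows reach the same point of the sphere.  The
identity is exact: the nonlinearity of the endpoint map is hidden in the factors \<open>P\<close> and \<open>Q\<close> alone.\<close>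

lemma wronskian_identity:
  assumes f0: "linear_flow \<kappa> 1 w0 a b p q" and f: "linear_flow \<kappa> v w a b P Q"
    and i: "P a = p a" "Q a = q a" and ab: "a \<le> b"
  shows "p b * Q b - q b * P b
    = \<i> * \<kappa> * integral {a..b} (\<lambda>s. of_real (w s - w0 s) * (p s * P s) + of_real (1 - v) * (q s * Q s))"
proof -
  have *: "lipschitz_primitive a b p (\<lambda>s. \<i> * \<kappa> * q s)"
    "lipschitz_primitive a b q (\<lambda>s. \<i> * \<kappa> * of_real (w0 s) * p s)"
    "lipschitz_primitive a b P (\<lambda>s. \<i> * \<kappa> * of_real v * Q s)"
    "lipschitz_primitive a b Q (\<lambda>s. \<i> * \<kappa> * of_real (w s) * P s)"
    using f0 f by (auto simp: linear_flow_def)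
  have "lipschitz_primitive a b (\<lambda>s. p s * Q s - q s * P s)
     (\<lambda>s. \<i> * \<kappa> * (of_real (w s - w0 s) * (p s * P s) + of_real (1 - v) * (q s * Q s)))"
    by (rule lipschitz_primitive_cong[OF lipschitz_primitive_diff[OF
            lipschitz_primitive_mult[OF *(1,4)] lipschitz_primitive_mult[OF *(2,3)]]])
      (auto simp: algebra_simps)
  then have "integral {a..b} (\<lambda>s. \<i> * \<kappa> * (of_real (w s - w0 s) * (p s * P s) + of_real (1 - v) * (q s * Q s)))
     = (p b * Q b - q b * P b) - (p a * Q a - q a * P a)"
    using ab by (auto simp: lipschitz_primitive_def ae_primitive_on_def)
  then show ?thesis using i by simp
qed

text \<open>A convex set without interior lies in a hyperplane; otherwise its interior is separated from zero, and
the set is contained in the closure of its interior.\<close>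

lemma convex_zero_not_interior_separation:
  fixes K :: "'a::euclidean_space set"
  assumes K: "convex K" and 0: "0 \<notin> interior K"
  obtains d where "d \<noteq> 0" "\<And>k. k \<in> K \<Longrightarrow> 0 \<le> inner d k"
proof (cases "interior K = {}")
  case True
  obtain a c where a: "a \<noteq> 0" "K \<subseteq> {x. inner a x = c}"
    using empty_interior_subset_hyperplane[OF K True] .
  show thesis
  proof (cases "0 \<le> c")
    case True
    with a show thesis by (intro that[of a]) auto
  next
    case False
    with a show thesis by (intro that[of "- a"]) auto
  qed
next
  case False
  obtain d where d: "d \<noteq> 0" "\<And>x. x \<in> interior K \<Longrightarrow> 0 \<le> inner d x"
    using separating_hyperplane_set_0[OF convex_interior[OF K] 0] by blast
  have "closure (interior K) \<subseteq> {x. inner d x \<ge> 0}"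
    by (rule closure_minimal) (use d closed_halfspace_ge in auto)
  moreover have "K \<subseteq> closure (interior K)"
    using convex_closure_interior[OF K False] closure_subset by metis
  ultimately show thesis using d by (intro that[of d]) auto
qed

lemma brouwer_near_identity_zero:
  fixes g :: "'a::euclidean_space \<Rightarrow> 'a"
  assumes g: "continuous_on (cball 0 1) g" and near: "\<And>c. c \<in> cball 0 1 \<Longrightarrow> norm (g c - c) \<le> 1"
  obtains c where "c \<in> cball 0 1" "g c = 0"
proof -
  obtain c where "c \<in> cball 0 1" "c - g c = c"
  proof (rule brouwer[of "cball (0::'a) 1" "\<lambda>c. c - g c"])
    show "continuous_on (cball 0 1) (\<lambda>c. c - g c)" by (intro continuous_intros g)
    show "(\<lambda>c. c - g c) \<in> cball 0 1 \<rightarrow> cball 0 1"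
      using near by (auto simp: dist_norm norm_minus_commute)
  qed auto
  then show thesis by (intro that[of c]) auto
qed

text \<open>The last hypothesis says that no admissible pair, hence no control with a shorter travel time, reaches
the same target point from the same initial point.\<close>

locale optimal_flow =
  fixes \<kappa> :: complex and m1 m2 a b :: real and \<epsilon> :: "real \<Rightarrow> real" and p q :: "real \<Rightarrow> complex"
  assumes kappa: "\<kappa> \<noteq> 0" and m: "0 < m1" "m1 < m2" and ab: "a < b"
    and eps_borel: "\<epsilon> \<in> borel_measurable borel" and eps: "\<And>s. m1 \<le> \<epsilon> s" "\<And>s. \<epsilon> s \<le> m2"
    and flow: "linear_flow \<kappa> 1 \<epsilon> a b p q"
    and opt: "\<And>v w P Q. admissible m1 m2 v w \<Longrightarrow> linear_flow \<kappa> v w a b P Q \<Longrightarrow>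
        P a = p a \<Longrightarrow> Q a = q a \<Longrightarrow> p b * Q b \<noteq> q b * P b"
begin

lemma cont_p: "continuous_on {a..b} p" and cont_q: "continuous_on {a..b} q"
  using linear_flow_continuous[OF flow] by auto

text \<open>The first-order part of the integral in the Wronskian identity, with \<open>P\<close> and \<open>Q\<close> replaced by \<open>p\<close> and
\<open>q\<close>.\<close>

definition variation :: "real \<Rightarrow> (real \<Rightarrow> real) \<Rightarrow> complex" where
  "variation v w = integral {a..b} (\<lambda>s. of_real (w s - \<epsilon> s) * (p s)\<^sup>2 + of_real (1 - v) * (q s)\<^sup>2)"

lemma bounded_borel_integrable:
  fixes z :: "real \<Rightarrow> complex"
  assumes "w \<in> borel_measurable borel" "\<And>s. \<bar>w s\<bar> \<le> M" "continuous_on {a..b} z"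
  shows "(\<lambda>s. of_real (w s) * z s) integrable_on {a..b}"
  using bounded_borel_times_continuous[OF assms] by (simp add: set_lebesgue_integral_eq_integral)

lemma admissible_abs:
  assumes "admissible m1 m2 v w"
  shows "\<bar>w s\<bar> \<le> m2"
  using admissible_bound[OF m(1) assms] .

lemma variation_eq:
  assumes "w \<in> borel_measurable borel" "\<And>s. \<bar>w s\<bar> \<le> M"
  shows "variation v w = integral {a..b} (\<lambda>s. of_real (w s) * (p s)\<^sup>2)
    - integral {a..b} (\<lambda>s. of_real (\<epsilon> s) * (p s)\<^sup>2) + of_real (1 - v) * integral {a..b} (\<lambda>s. (q s)\<^sup>2)"
proof -
  have *: "\<bar>\<epsilon> s\<bar> \<le> m2" for s using eps[of s] m by linarith
  have i: "(\<lambda>s. of_real (w s) * (p s)\<^sup>2) integrable_on {a..b}" "(\<lambda>s. of_real (\<epsilon> s) * (p s)\<^sup>2) integrable_on {a..b}"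
    by (intro bounded_borel_integrable[OF assms] bounded_borel_integrable[OF eps_borel *] continuous_intros cont_p)+
  have j: "(\<lambda>s. of_real (1 - v) * (q s)\<^sup>2) integrable_on {a..b}"
    by (intro integrable_continuous_interval continuous_intros cont_q)
  have "variation v w = integral {a..b} (\<lambda>s. (of_real (w s) * (p s)\<^sup>2 - of_real (\<epsilon> s) * (p s)\<^sup>2) + of_real (1 - v) * (q s)\<^sup>2)"
    unfolding variation_def by (rule integral_cong) (simp add: algebra_simps)
  also have "\<dots> = integral {a..b} (\<lambda>s. of_real (w s) * (p s)\<^sup>2)
    - integral {a..b} (\<lambda>s. of_real (\<epsilon> s) * (p s)\<^sup>2) + integral {a..b} (\<lambda>s. of_real (1 - v) * (q s)\<^sup>2)"
    using i j by (simp add: Henstock_Kurzweil_Integration.integral_add Henstock_Kurzweil_Integration.integral_diff integrable_diff)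
  finally show ?thesis by simp
qed

lemma admissible_convex_sum:
  assumes I: "finite I" and adm: "\<And>i. i \<in> I \<Longrightarrow> admissible m1 m2 (v i) (w i)"
    and l: "\<And>i. i \<in> I \<Longrightarrow> 0 \<le> l i" "(\<Sum>i\<in>I. l i) = (1::real)"
  shows "admissible m1 m2 (\<Sum>i\<in>I. l i * v i) (\<lambda>s. \<Sum>i\<in>I. l i * w i s)"
    and "variation (\<Sum>i\<in>I. l i * v i) (\<lambda>s. \<Sum>i\<in>I. l i * w i s) = (\<Sum>i\<in>I. of_real (l i) * variation (v i) (w i))"
proof -
  have "\<exists>i\<in>I. l i \<noteq> 0" using l(2) by (metis sum.neutral zero_neq_one)
  then obtain i0 where i0: "i0 \<in> I" "0 < l i0" using l(1) by (metis less_eq_real_def)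
  have v: "0 < v i" "v i < 1" "w i \<in> borel_measurable borel" if "i \<in> I" for i
    using adm[OF that] by (auto simp: admissible_def)
  have "(\<Sum>i\<in>I. l i * v i) > 0"
    using v l i0 I by (intro sum_pos2[of I i0]) (auto simp: less_imp_le)
  moreover have "(\<Sum>i\<in>I. l i * v i) < (\<Sum>i\<in>I. l i * 1)"
  proof (rule sum_strict_mono_ex1[OF I])
    show "\<forall>i\<in>I. l i * v i \<le> l i * 1" using v l by (intro ballI mult_left_mono) (auto simp: less_imp_le)
    have "l i0 * v i0 < l i0 * 1" using v i0 by (intro mult_strict_left_mono) auto
    then show "\<exists>i\<in>I. l i * v i < l i * 1" using i0(1) by blast
  qed
  moreover have "m1 * (\<Sum>i\<in>I. l i * v i) \<le> (\<Sum>i\<in>I. l i * w i s)" "(\<Sum>i\<in>I. l i * w i s) \<le> m2 * (\<Sum>i\<in>I. l i * v i)" for s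
  proof -
    have *: "m1 * v i \<le> w i s" "w i s \<le> m2 * v i" if "i \<in> I" for i
      using adm[OF that] by (auto simp: admissible_def)
    have "m1 * (\<Sum>i\<in>I. l i * v i) = (\<Sum>i\<in>I. l i * (m1 * v i))" by (simp add: sum_distrib_left mult_ac)
    also have "\<dots> \<le> (\<Sum>i\<in>I. l i * w i s)" using l * by (intro sum_mono mult_left_mono) auto
    finally show "m1 * (\<Sum>i\<in>I. l i * v i) \<le> (\<Sum>i\<in>I. l i * w i s)" .
    have "(\<Sum>i\<in>I. l i * w i s) \<le> (\<Sum>i\<in>I. l i * (m2 * v i))" using l * by (intro sum_mono mult_left_mono) auto
    also have "\<dots> = m2 * (\<Sum>i\<in>I. l i * v i)" by (simp add: sum_distrib_left mult_ac)
    finally show "(\<Sum>i\<in>I. l i * w i s) \<le> m2 * (\<Sum>i\<in>I. l i * v i)" .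
  qed
  moreover have borel: "(\<lambda>s. \<Sum>i\<in>I. l i * w i s) \<in> borel_measurable borel"
    using v by (intro borel_measurable_sum borel_measurable_times) auto
  ultimately show adm': "admissible m1 m2 (\<Sum>i\<in>I. l i * v i) (\<lambda>s. \<Sum>i\<in>I. l i * w i s)"
    using l(2) unfolding admissible_def by simp
  have p2: "continuous_on {a..b} (\<lambda>s. (p s)\<^sup>2)" by (intro continuous_intros cont_p)
  have wi: "(\<lambda>s. of_real (w i s) * (p s)\<^sup>2) integrable_on {a..b}" if "i \<in> I" for i
    by (rule bounded_borel_integrable[OF v(3)[OF that] admissible_abs[OF adm[OF that]] p2])
  have "integral {a..b} (\<lambda>s. of_real (\<Sum>i\<in>I. l i * w i s) * (p s)\<^sup>2)
      = integral {a..b} (\<lambda>s. \<Sum>i\<in>I. of_real (l i) * (of_real (w i s) * (p s)\<^sup>2))"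
    by (rule integral_cong) (simp add: sum_distrib_right mult.assoc)
  also have "\<dots> = (\<Sum>i\<in>I. of_real (l i) * integral {a..b} (\<lambda>s. of_real (w i s) * (p s)\<^sup>2))"
    using wi I by (subst integral_sum) (auto intro: integrable_on_mult_right)
  finally have 1: "integral {a..b} (\<lambda>s. of_real (\<Sum>i\<in>I. l i * w i s) * (p s)\<^sup>2)
      = (\<Sum>i\<in>I. of_real (l i) * integral {a..b} (\<lambda>s. of_real (w i s) * (p s)\<^sup>2))" .
  define E where "E = integral {a..b} (\<lambda>s. of_real (\<epsilon> s) * (p s)\<^sup>2)"
  define R where "R = integral {a..b} (\<lambda>s. (q s)\<^sup>2)"
  have l2: "(\<Sum>i\<in>I. complex_of_real (l i)) = 1" using l(2) by (metis of_real_1 of_real_sum)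
  have "(\<Sum>i\<in>I. of_real (l i) * variation (v i) (w i))
     = (\<Sum>i\<in>I. of_real (l i) * integral {a..b} (\<lambda>s. of_real (w i s) * (p s)\<^sup>2)
         - of_real (l i) * E + of_real (l i) * R - of_real (l i * v i) * R)"
    by (intro sum.cong refl)
      (simp add: variation_eq[OF v(3) admissible_abs[OF adm]] E_def R_def algebra_simps)
  also have "\<dots> = (\<Sum>i\<in>I. of_real (l i) * integral {a..b} (\<lambda>s. of_real (w i s) * (p s)\<^sup>2))
       - E + R - of_real (\<Sum>i\<in>I. l i * v i) * R"
    using l2 by (simp add: sum.distrib sum_subtractf flip: sum_distrib_right)
  also have "\<dots> = variation (\<Sum>i\<in>I. l i * v i) (\<lambda>s. \<Sum>i\<in>I. l i * w i s)"
    unfolding variation_eq[OF borel admissible_abs[OF adm']] 1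
    by (simp add: E_def R_def algebra_simps)
  finally show "variation (\<Sum>i\<in>I. l i * v i) (\<lambda>s. \<Sum>i\<in>I. l i * w i s) = (\<Sum>i\<in>I. of_real (l i) * variation (v i) (w i))"
    by simp
qed

lemma convex_variations: "convex {variation v w |v w. admissible m1 m2 v w}"
  unfolding convex_def
proof (intro ballI allI impI)
  fix x y and u u' :: real
  assume x: "x \<in> {variation v w |v w. admissible m1 m2 v w}" and y: "y \<in> {variation v w |v w. admissible m1 m2 v w}"
    and u: "0 \<le> u" "0 \<le> u'" "u + u' = 1"
  obtain v w v' w' where 1: "x = variation v w" "admissible m1 m2 v w" "y = variation v' w'" "admissible m1 m2 v' w'"
    using x y by blast
  define V W l where "V = (\<lambda>i::bool. if i then v else v')" and "W = (\<lambda>i::bool. if i then w else w')"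
    and "l = (\<lambda>i. if i then u else u')"
  have "admissible m1 m2 (\<Sum>i\<in>UNIV. l i * V i) (\<lambda>s. \<Sum>i\<in>UNIV. l i * W i s)"
    "variation (\<Sum>i\<in>UNIV. l i * V i) (\<lambda>s. \<Sum>i\<in>UNIV. l i * W i s) = (\<Sum>i\<in>UNIV. of_real (l i) * variation (V i) (W i))"
    by (rule admissible_convex_sum; use 1 u in \<open>simp add: V_def W_def l_def UNIV_bool split: if_splits\<close>)+
  moreover have "(\<Sum>i\<in>UNIV. of_real (l i) * variation (V i) (W i)) = u *\<^sub>R x + u' *\<^sub>R y"
    using 1 by (simp add: V_def W_def l_def UNIV_bool scaleR_conv_of_real)
  ultimately show "u *\<^sub>R x + u' *\<^sub>R y \<in> {variation v w |v w. admissible m1 m2 v w}"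
    by (intro CollectI exI conjI) auto
qed

text \<open>If small complex numbers of all directions were variations, then convex combinations of four of them
would give a family of admissible pairs, depending continuously on \<open>c\<close> in the unit disc, whose
variation is a fixed positive multiple of \<open>c\<close>.  Mixing the pair into \<open>(1, \<epsilon>)\<close> with a small weight \<open>t\<close>
makes the rescaled Wronskian a continuous function within distance one of the identity.  It has a
zero by Brouwer's theorem, and a zero means that the target is reached faster.\<close>

lemma zero_not_interior_variations: "0 \<notin> interior {variation v w |v w. admissible m1 m2 v w}"
proof
  let ?K = "{variation v w |v w. admissible m1 m2 v w}"
  assume "0 \<in> interior ?K"
  then obtain e where e: "e > 0" "cball 0 e \<subseteq> ?K" by (auto simp: mem_interior_cball)
  have "\<forall>n. \<exists>v w. admissible m1 m2 v w \<and> variation v w = of_real e * \<i> ^ n"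
  proof
    fix n :: nat
    have "of_real e * \<i> ^ n \<in> cball 0 e" using e by (simp add: norm_mult norm_power)
    then have "of_real e * \<i> ^ n \<in> ?K" by (rule subsetD[OF e(2)])
    then show "\<exists>v w. admissible m1 m2 v w \<and> variation v w = of_real e * \<i> ^ n"
      unfolding mem_Collect_eq by metis
  qed
  then obtain v w where vw: "admissible m1 m2 (v n) (w n)" "variation (v n) (w n) = of_real e * \<i> ^ n" for n
    by metis
  \<comment> \<open>Weights of the four variations \<open>e \<i>\<^sup>n\<close>: nonnegative on the unit disc, with mean value \<open>e c / 2\<close>.\<close>
  define l where "l = (\<lambda>c (n::nat). (1 + inner c (\<i> ^ n)) / 4)"
  have l_sum: "(\<Sum>n<4. l c n) = 1" for c
    by (simp add: l_def eval_nat_numeral inner_complex_def) (simp add: field_simps)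
  have l_nonneg: "0 \<le> l c n" if "c \<in> cball 0 1" for c n
  proof -
    have "\<bar>inner c (\<i> ^ n)\<bar> \<le> norm c * norm (\<i> ^ n)" by (rule Cauchy_Schwarz_ineq2)
    then show ?thesis using that by (auto simp: l_def norm_power)
  qed
  have l_lip: "\<bar>l c n - l c' n\<bar> \<le> norm (c - c') / 4" for c c' n
  proof -
    have "\<bar>inner (c - c') (\<i> ^ n)\<bar> \<le> norm (c - c') * norm (\<i> ^ n)" by (rule Cauchy_Schwarz_ineq2)
    then show ?thesis by (simp add: l_def norm_power inner_diff_left flip: diff_divide_distrib)
  qed
  define V where "V = (\<lambda>c. \<Sum>n<4. l c n * v n)"
  define W where "W = (\<lambda>c s. \<Sum>n<4. l c n * w n s)"
  have adm: "admissible m1 m2 (V c) (W c)" if "c \<in> cball 0 1" for c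
    unfolding V_def W_def using that vw l_nonneg l_sum by (intro admissible_convex_sum) auto
  have var: "variation (V c) (W c) = of_real (e / 2) * c" if "c \<in> cball 0 1" for c
  proof -
    have "variation (V c) (W c) = (\<Sum>n<4. of_real (l c n) * (of_real e * \<i> ^ n))"
      unfolding V_def W_def
      using admissible_convex_sum(2)[of "{..<4}" v w "l c"] that vw l_nonneg l_sum by auto
    also have "\<dots> = of_real (e / 2) * c"
      by (simp add: l_def eval_nat_numeral inner_complex_def complex_eq_iff field_simps)
    finally show ?thesis .
  qed
  define N where "N = 1 + m2"
  have N: "1 \<le> N" "m2 \<le> N" using m by (auto simp: N_def)
  define X where "X = exp (2 * (norm \<kappa> * N) * (b - a))"
  define B where "B = 2 * (norm (p a) + norm (q a)) * X"
  define C where "C = 2 * (norm \<kappa> * B * (b - a)) * X"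
  have B0: "0 \<le> B" and C0: "0 \<le> C" using ab by (auto simp: B_def C_def X_def)
  define E where "E = N * B * (C * N) * (b - a)"
  have E0: "0 \<le> E" using B0 C0 N ab by (auto simp: E_def)
  \<comment> \<open>The error of the first-order approximation is at most \<open>t\<^sup>2 E\<close>, against the main term \<open>t e c / 2\<close>.\<close>
  define t where "t = min 1 (e / (4 * (E + 1)))"
  have t: "0 < t" "t \<le> 1" using e E0 by (auto simp: t_def)
  have tE: "t * E \<le> e / 4"
  proof -
    have "t * E \<le> t * (E + 1)" using t by simp
    also have "\<dots> \<le> e / (4 * (E + 1)) * (E + 1)" using E0 by (intro mult_right_mono) (auto simp: t_def)
    also have "\<dots> = e / 4" using E0 by (simp add: field_simps)
    finally show ?thesis .
  qed
  define v' where "v' = (\<lambda>c. 1 - t + t * V c)"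
  define w' where "w' = (\<lambda>c s. (1 - t) * \<epsilon> s + t * W c s)"
  have adm': "admissible m1 m2 (v' c) (w' c)" if c: "c \<in> cball 0 1" for c
  proof -
    have V: "0 < V c" "V c < 1" "W c \<in> borel_measurable borel" "m1 * V c \<le> W c s" "W c s \<le> m2 * V c" for s
      using adm[OF c] by (auto simp: admissible_def)
    have "0 < v' c" using t V(1) by (auto simp: v'_def intro: add_nonneg_pos)
    moreover have "t * V c < t * 1" using t V(2) by (intro mult_strict_left_mono) auto
    then have "v' c < 1" by (simp add: v'_def)
    moreover have "m1 * v' c \<le> w' c s" "w' c s \<le> m2 * v' c" for s
    proof -
      have "(1 - t) * m1 + t * (m1 * V c) \<le> w' c s"
        unfolding w'_def using t V eps by (intro add_mono mult_left_mono) auto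
      then show "m1 * v' c \<le> w' c s" by (simp add: v'_def algebra_simps)
      have "w' c s \<le> (1 - t) * m2 + t * (m2 * V c)"
        unfolding w'_def using t V eps by (intro add_mono mult_left_mono) auto
      then show "w' c s \<le> m2 * v' c" by (simp add: v'_def algebra_simps)
    qed
    moreover have "w' c \<in> borel_measurable borel"
      unfolding w'_def using V(3) eps_borel by simp
    ultimately show ?thesis by (auto simp: admissible_def)
  qed
  have absN: "\<bar>v' c\<bar> \<le> N" "\<bar>w' c s\<bar> \<le> N" if "c \<in> cball 0 1" for c s
    using adm'[OF that] admissible_abs[OF adm'[OF that], of s] N by (auto simp: admissible_def)
  have "\<forall>c\<in>cball 0 1. \<exists>P Q. linear_flow \<kappa> (v' c) (w' c) a b P Q \<and> P a = p a \<and> Q a = q a"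
  proof
    fix c :: complex assume c: "c \<in> cball 0 1"
    have "w' c \<in> borel_measurable borel" using adm'[OF c] by (simp add: admissible_def)
    from linear_flow_exists[OF kappa this admissible_abs[OF adm'[OF c]] less_imp_le[OF ab]]
    show "\<exists>P Q. linear_flow \<kappa> (v' c) (w' c) a b P Q \<and> P a = p a \<and> Q a = q a" by metis
  qed
  then obtain P Q where PQ: "linear_flow \<kappa> (v' c) (w' c) a b (P c) (Q c)" "P c a = p a" "Q c a = q a"
    if "c \<in> cball 0 1" for c by metis
  have bound: "norm (P c s) + norm (Q c s) \<le> B" if "c \<in> cball 0 1" "s \<in> {a..b}" for c s
    using linear_flow_bound[OF PQ(1)[OF that(1)] _ absN[OF that(1)] kappa that(2)] N PQ(2,3)[OF that(1)]
    by (simp add: B_def X_def)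
  have epsN: "\<bar>\<epsilon> s\<bar> \<le> N" for s using eps[of s] m by (auto simp: N_def)
  have bound0: "norm (p s) + norm (q s) \<le> B" if "s \<in> {a..b}" for s
    using linear_flow_bound[OF flow _ _ epsN kappa that] N by (simp add: B_def X_def)
  have near0: "norm (P c s - p s) + norm (Q c s - q s) \<le> C * N * t" if c: "c \<in> cball 0 1" and s: "s \<in> {a..b}" for c s
  proof -
    have "\<bar>v' c - 1\<bar> \<le> N * t"
    proof -
      have "\<bar>v' c - 1\<bar> = t * (1 - V c)" using adm[OF c] t by (simp add: v'_def admissible_def abs_if algebra_simps)
      also have "\<dots> \<le> t * N" using adm[OF c] t N by (intro mult_left_mono) (auto simp: admissible_def)
      finally show ?thesis by (simp add: mult.commute)
    qed
    moreover have "\<bar>w' c s - \<epsilon> s\<bar> \<le> N * t" for s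
    proof -
      have "w' c s - \<epsilon> s = t * (W c s - \<epsilon> s)" by (simp add: w'_def algebra_simps)
      then have "\<bar>w' c s - \<epsilon> s\<bar> = t * \<bar>W c s - \<epsilon> s\<bar>" using t by (simp add: abs_mult)
      moreover have "\<bar>W c s - \<epsilon> s\<bar> \<le> m2"
      proof -
        have "0 < m1 * V c" "m1 * V c \<le> W c s" using adm[OF c] m by (auto simp: admissible_def)
        moreover have "\<bar>W c s\<bar> \<le> m2" by (rule admissible_abs[OF adm[OF c]])
        ultimately show ?thesis using eps[of s] m by linarith
      qed
      ultimately show ?thesis using t N mult_left_mono[of "\<bar>W c s - \<epsilon> s\<bar>" N t] by (simp add: mult.commute)
    qed
    ultimately have "norm (P c s - p s) + norm (Q c s - q s) \<le> 2 * (norm \<kappa> * (N * t) * B * (b - a)) * X"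
      unfolding X_def using N PQ(2,3)[OF c]
      by (intro linear_flow_dependence[OF PQ(1)[OF c] flow _ absN[OF c] _ _ _ _ bound0 kappa s]) auto
    then show ?thesis by (simp add: C_def mult_ac)
  qed
  have near: "norm (P c b - P c' b) + norm (Q c b - Q c' b) \<le> C * N * norm (c - c')"
    if c: "c \<in> cball 0 1" and c': "c' \<in> cball 0 1" for c c'
  proof -
    have sum: "t * \<bar>(\<Sum>n<4. l c n * x n) - (\<Sum>n<4. l c' n * x n)\<bar> \<le> N * norm (c - c')"
      if x: "\<And>n. \<bar>x n\<bar> \<le> N" for x :: "nat \<Rightarrow> real"
    proof -
      have "\<bar>(\<Sum>n<4. l c n * x n) - (\<Sum>n<4. l c' n * x n)\<bar> = \<bar>\<Sum>n<4. (l c n - l c' n) * x n\<bar>"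
        by (simp add: sum_subtractf left_diff_distrib)
      also have "\<dots> \<le> (\<Sum>n<4. \<bar>l c n - l c' n\<bar> * \<bar>x n\<bar>)" by (rule order_trans[OF sum_abs]) (simp add: abs_mult)
      also have "\<dots> \<le> (\<Sum>n<4::nat. norm (c - c') / 4 * N)"
        using x l_lip by (intro sum_mono mult_mono) auto
      also have "\<dots> = N * norm (c - c')" by simp
      finally have "\<bar>(\<Sum>n<4. l c n * x n) - (\<Sum>n<4. l c' n * x n)\<bar> \<le> N * norm (c - c')" .
      moreover have "t * y \<le> y" if "0 \<le> y" for y using t that mult_right_mono[of t 1 y] by simp
      ultimately show ?thesis by (meson abs_ge_zero order_trans)
    qed
    have "\<bar>v' c - v' c'\<bar> \<le> N * norm (c - c')"
    proof -
      have "\<bar>v n\<bar> \<le> N" for n using vw(1)[of n] N by (auto simp: admissible_def)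
      then have "t * \<bar>V c - V c'\<bar> \<le> N * norm (c - c')" unfolding V_def by (rule sum)
      moreover have "v' c - v' c' = t * (V c - V c')" by (simp add: v'_def algebra_simps)
      ultimately show ?thesis using t by (simp add: abs_mult)
    qed
    moreover have "\<bar>w' c s - w' c' s\<bar> \<le> N * norm (c - c')" for s
    proof -
      have "\<bar>w n s\<bar> \<le> N" for n using admissible_abs[OF vw(1)[of n], of s] N by simp
      then have "t * \<bar>W c s - W c' s\<bar> \<le> N * norm (c - c')" unfolding W_def by (rule sum)
      moreover have "w' c s - w' c' s = t * (W c s - W c' s)" by (simp add: w'_def algebra_simps)
      ultimately show ?thesis using t by (simp add: abs_mult)
    qed
    ultimately have "norm (P c b - P c' b) + norm (Q c b - Q c' b)
       \<le> 2 * (norm \<kappa> * (N * norm (c - c')) * B * (b - a)) * X"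
      unfolding X_def using N PQ(2,3)[OF c] PQ(2,3)[OF c'] ab
      by (intro linear_flow_dependence[OF PQ(1)[OF c] PQ(1)[OF c'] _ absN[OF c] _ _ _ _ bound[OF c'] kappa]) auto
    then show ?thesis by (simp add: C_def algebra_simps)
  qed
  \<comment> \<open>Normalized so that the first-order part of the Wronskian becomes the identity.\<close>
  define g where "g = (\<lambda>c. of_real (2 / (t * e)) * (p b * Q c b - q b * P c b) / (\<i> * \<kappa>))"
  have "continuous_on (cball 0 1) (\<lambda>c. P c b)" "continuous_on (cball 0 1) (\<lambda>c. Q c b)"
  proof -
    have "(C * N)-lipschitz_on (cball 0 1) (\<lambda>c. P c b)" "(C * N)-lipschitz_on (cball 0 1) (\<lambda>c. Q c b)"
    proof -
      have "norm (P x b - P y b) \<le> C * N * norm (x - y)" "norm (Q x b - Q y b) \<le> C * N * norm (x - y)"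
        if "x \<in> cball 0 1" "y \<in> cball 0 1" for x y
        using near[OF that] norm_ge_zero[of "P x b - P y b"] norm_ge_zero[of "Q x b - Q y b"] by linarith+
      then show "(C * N)-lipschitz_on (cball 0 1) (\<lambda>c. P c b)" "(C * N)-lipschitz_on (cball 0 1) (\<lambda>c. Q c b)"
        using C0 N by (auto intro!: lipschitz_onI simp: dist_norm)
    qed
    then show "continuous_on (cball 0 1) (\<lambda>c. P c b)" "continuous_on (cball 0 1) (\<lambda>c. Q c b)"
      by (auto intro: lipschitz_on_continuous_on)
  qed
  then have gc: "continuous_on (cball 0 1) g"
    unfolding g_def using kappa by (intro continuous_intros) auto
  have g_near: "norm (g c - c) \<le> 1" if c: "c \<in> cball 0 1" for c
  proof -
    have adm_c: "0 < V c" "V c < 1" "W c \<in> borel_measurable borel" using adm[OF c] by (auto simp: admissible_def)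
    note cPQ = linear_flow_continuous[OF PQ(1)[OF c]]
    define f where "f = (\<lambda>s. of_real (W c s - \<epsilon> s) * (p s * P c s) + of_real (1 - V c) * (q s * Q c s))"
    define f0 where "f0 = (\<lambda>s. of_real (W c s - \<epsilon> s) * (p s)\<^sup>2 + of_real (1 - V c) * (q s)\<^sup>2)"
    have Wm: "(\<lambda>s. W c s - \<epsilon> s) \<in> borel_measurable borel" using adm_c eps_borel by simp
    have WN: "\<bar>W c s - \<epsilon> s\<bar> \<le> N" for s
    proof -
      have "0 < m1 * V c" "m1 * V c \<le> W c s" using adm[OF c] m by (auto simp: admissible_def)
      moreover have "\<bar>W c s\<bar> \<le> m2" by (rule admissible_abs[OF adm[OF c]])
      ultimately show ?thesis using eps[of s] m N by linarith
    qed
    have int: "f integrable_on {a..b}" "f0 integrable_on {a..b}"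
      unfolding f_def f0_def
      by (intro integrable_add bounded_borel_integrable[OF Wm WN] integrable_continuous_interval
          continuous_intros cont_p cont_q cPQ)+
    have "p b * Q c b - q b * P c b = \<i> * \<kappa> * integral {a..b} (\<lambda>s. of_real (w' c s - \<epsilon> s) * (p s * P c s)
        + of_real (1 - v' c) * (q s * Q c s))"
      by (rule wronskian_identity[OF flow PQ(1)[OF c] PQ(2,3)[OF c]]) (use ab in simp)
    also have "(\<lambda>s. of_real (w' c s - \<epsilon> s) * (p s * P c s) + of_real (1 - v' c) * (q s * Q c s))
        = (\<lambda>s. of_real t * f s)"
      by (auto simp: f_def w'_def v'_def algebra_simps)
    finally have wr: "p b * Q c b - q b * P c b = \<i> * \<kappa> * (of_real t * integral {a..b} f)" by simp
    have "g c = of_real (2 / (t * e)) * (\<i> * \<kappa> * (of_real t * integral {a..b} f)) / (\<i> * \<kappa>)"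
      unfolding g_def wr ..
    also have "\<dots> = of_real (2 / (t * e) * t) * integral {a..b} f" using kappa by simp
    also have "2 / (t * e) * t = 2 / e" using t by simp
    finally have "g c = of_real (2 / e) * integral {a..b} f" .
    moreover have "c = of_real (2 / e) * integral {a..b} f0"
      using var[OF c] e by (simp add: variation_def f0_def field_simps)
    ultimately have "g c - c = of_real (2 / e) * (integral {a..b} f - integral {a..b} f0)"
      by (metis right_diff_distrib)
    also have "integral {a..b} f - integral {a..b} f0 = integral {a..b} (\<lambda>s. f s - f0 s)"
      using int by (simp add: Henstock_Kurzweil_Integration.integral_diff)
    finally have gcc: "g c - c = of_real (2 / e) * integral {a..b} (\<lambda>s. f s - f0 s)" .
    have "norm (integral {a..b} (\<lambda>s. f s - f0 s)) \<le> (N * B * (C * N * t)) * (b - a)"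
    proof (rule norm_integral_le)
      fix s assume s: "s \<in> {a..b}"
      have "f s - f0 s = of_real (W c s - \<epsilon> s) * (p s * (P c s - p s)) + of_real (1 - V c) * (q s * (Q c s - q s))"
        by (simp add: f_def f0_def algebra_simps power2_eq_square)
      also have "norm \<dots> \<le> \<bar>W c s - \<epsilon> s\<bar> * (norm (p s) * norm (P c s - p s)) + \<bar>1 - V c\<bar> * (norm (q s) * norm (Q c s - q s))"
        by (rule norm_triangle_le) (simp add: norm_mult del: of_real_diff)
      also have "\<dots> \<le> N * (B * norm (P c s - p s)) + N * (B * norm (Q c s - q s))"
      proof -
        have "norm (p s) \<le> B" "norm (q s) \<le> B" 
          using bound0[OF s] norm_ge_zero[of "p s"] norm_ge_zero[of "q s"] by linarith+
        then show ?thesis using WN[of s] adm_c N B0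
          by (intro add_mono mult_mono) auto
      qed
      also have "\<dots> = N * B * (norm (P c s - p s) + norm (Q c s - q s))" by (simp add: algebra_simps)
      also have "\<dots> \<le> N * B * (C * N * t)"
        using near0[OF c s] N B0 by (intro mult_left_mono) auto
      finally show "norm (f s - f0 s) \<le> N * B * (C * N * t)" .
    qed (use ab int in \<open>auto intro: integrable_diff\<close>)
    also have "\<dots> = t * E" by (simp add: E_def)
    finally have "norm (integral {a..b} (\<lambda>s. f s - f0 s)) \<le> e / 4" using tE by linarith
    then have "2 / e * norm (integral {a..b} (\<lambda>s. f s - f0 s)) \<le> 2 / e * (e / 4)"
      using e by (intro mult_left_mono) auto
    moreover have "norm (complex_of_real (2 / e)) = 2 / e" using e by (simp only: norm_of_real) simp
    ultimately show ?thesis unfolding gcc norm_mult using e by (simp only:) simp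
  qed
  obtain c where c: "c \<in> cball 0 1" "g c = 0"
    using brouwer_near_identity_zero[OF gc g_near] by blast
  then have "p b * Q c b = q b * P c b" using kappa t e by (simp add: g_def)
  with opt[OF adm'[OF c(1)] PQ[OF c(1)]] show False by simp
qed

lemma first_order_condition:
  obtains c where "c \<noteq> 0" "\<And>v w. admissible m1 m2 v w \<Longrightarrow> Im (c\<^sup>2 * variation v w) \<le> 0"
proof -
  obtain d where d: "d \<noteq> 0" "\<And>k. k \<in> {variation v w |v w. admissible m1 m2 v w} \<Longrightarrow> 0 \<le> inner d k"
    using convex_zero_not_interior_separation[OF convex_variations zero_not_interior_variations] by blast
  \<comment> \<open>A square root is taken because the solution, not its square, is later multiplied by \<open>c\<close>.\<close>
  show thesis
  proof (rule that[of "csqrt (- \<i> * cnj d)"])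
    show "csqrt (- \<i> * cnj d) \<noteq> 0" using d(1) by simp
    fix v w assume "admissible m1 m2 v w"
    then have "0 \<le> inner d (variation v w)" by (intro d(2)) blast
    then show "Im ((csqrt (- \<i> * cnj d))\<^sup>2 * variation v w) \<le> 0"
      by (simp add: inner_complex_def)
  qed
qed

text \<open>The pairs \<open>v = 1 - \<alpha>\<close>, \<open>w = (1 - \<alpha>) w\<^sub>0\<close> with \<open>\<alpha>\<close> tending to zero compare \<open>\<epsilon>\<close> with an arbitrary
control \<open>w\<^sub>0\<close>.  For \<open>w\<^sub>0 = \<epsilon>\<close> the variation is a negative multiple of the integral of
\<open>\<epsilon> p\<^sup>2 - q\<^sup>2\<close>.\<close>

lemma maximum_principle_integrated:
  obtains c where "c \<noteq> 0"
    "\<And>w. w \<in> borel_measurable borel \<Longrightarrow> (\<And>s. m1 \<le> w s \<and> w s \<le> m2) \<Longrightarrow>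
        Im (c\<^sup>2 * integral {a..b} (\<lambda>s. of_real (w s - \<epsilon> s) * (p s)\<^sup>2)) \<le> 0"
    "0 \<le> Im (c\<^sup>2 * (integral {a..b} (\<lambda>s. of_real (\<epsilon> s) * (p s)\<^sup>2 - (q s)\<^sup>2)))"
proof -
  obtain c where c: "c \<noteq> 0" "\<And>v w. admissible m1 m2 v w \<Longrightarrow> Im (c\<^sup>2 * variation v w) \<le> 0"
    using first_order_condition by blast
  have p2: "continuous_on {a..b} (\<lambda>s. (p s)\<^sup>2)" and q2: "continuous_on {a..b} (\<lambda>s. (q s)\<^sup>2)"
    by (intro continuous_intros cont_p cont_q)+
  have eps_bd: "\<bar>\<epsilon> s\<bar> \<le> m2" for s using eps[of s] m by linarith
  define J where "J = (\<lambda>w :: real \<Rightarrow> real. integral {a..b} (\<lambda>s. of_real (w s) * (p s)\<^sup>2))"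
  define R where "R = integral {a..b} (\<lambda>s. (q s)\<^sup>2)"
  have key: "Im (c\<^sup>2 * (J w - J \<epsilon>)) + \<alpha> * Im (c\<^sup>2 * (R - J w)) \<le> 0"
    if w: "w \<in> borel_measurable borel" "\<And>s. m1 \<le> w s \<and> w s \<le> m2" and \<alpha>: "0 < \<alpha>" "\<alpha> < 1" for w \<alpha>
  proof -
    have bw: "(\<lambda>s. (1 - \<alpha>) * w s) \<in> borel_measurable borel" using w(1) by simp
    have adm: "admissible m1 m2 (1 - \<alpha>) (\<lambda>s. (1 - \<alpha>) * w s)"
      using w \<alpha> bw unfolding admissible_def by (auto simp: mult.commute[of _ "1 - \<alpha>"])
    have "integral {a..b} (\<lambda>s. of_real ((1 - \<alpha>) * w s) * (p s)\<^sup>2) = of_real (1 - \<alpha>) * J w"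
      unfolding J_def by (simp flip: integral_mult_right add: mult.assoc)
    then have "variation (1 - \<alpha>) (\<lambda>s. (1 - \<alpha>) * w s) = of_real (1 - \<alpha>) * J w - J \<epsilon> + of_real \<alpha> * R"
      using variation_eq[OF bw admissible_abs[OF adm], of "1 - \<alpha>"] by (simp add: J_def R_def)
    also have "\<dots> = (J w - J \<epsilon>) + of_real \<alpha> * (R - J w)" by (simp add: algebra_simps)
    finally have "Im (c\<^sup>2 * ((J w - J \<epsilon>) + of_real \<alpha> * (R - J w))) \<le> 0" using c(2)[OF adm] by simp
    moreover have "c\<^sup>2 * ((J w - J \<epsilon>) + of_real \<alpha> * (R - J w))
        = c\<^sup>2 * (J w - J \<epsilon>) + of_real \<alpha> * (c\<^sup>2 * (R - J w))" by (simp add: algebra_simps)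
    moreover have "Im (of_real \<alpha> * (c\<^sup>2 * (R - J w))) = \<alpha> * Im (c\<^sup>2 * (R - J w))" by simp
    ultimately show ?thesis by (metis plus_complex.sel(2))
  qed
  have lim: "x \<le> 0" if "\<And>\<alpha>. 0 < \<alpha> \<Longrightarrow> \<alpha> < 1 \<Longrightarrow> x + \<alpha> * y \<le> 0" for x y :: real
  proof (rule ccontr)
    assume x: "\<not> x \<le> 0"
    \<comment> \<open>Small enough for \<open>\<alpha> \<bar>y\<bar> \<le> x / 2\<close>.\<close>
    define \<alpha> where "\<alpha> = min (1/2) (x / (2 * (\<bar>y\<bar> + 1)))"
    have \<alpha>: "0 < \<alpha>" "\<alpha> < 1" using x by (auto simp: \<alpha>_def)
    have "\<alpha> * \<bar>y\<bar> \<le> x / (2 * (\<bar>y\<bar> + 1)) * (\<bar>y\<bar> + 1)"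
      using x by (intro mult_mono) (auto simp: \<alpha>_def)
    also have "\<dots> = x / 2" by (simp add: field_simps)
    finally have "\<alpha> * \<bar>y\<bar> \<le> x / 2" .
    moreover have "- (\<alpha> * \<bar>y\<bar>) \<le> \<alpha> * y" using \<alpha> by (metis abs_ge_minus_self abs_mult abs_of_pos minus_le_iff)
    ultimately show False using that[OF \<alpha>] x by linarith
  qed
  show thesis
  proof (rule that[OF c(1)])
    fix w :: "real \<Rightarrow> real" assume w: "w \<in> borel_measurable borel" "\<And>s. m1 \<le> w s \<and> w s \<le> m2"
    have bd: "\<bar>w s\<bar> \<le> m2" for s using w(2)[of s] m by linarith
    have "integral {a..b} (\<lambda>s. of_real (w s - \<epsilon> s) * (p s)\<^sup>2) = J w - J \<epsilon>"
      unfolding J_def of_real_diff left_diff_distrib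
      by (intro Henstock_Kurzweil_Integration.integral_diff bounded_borel_integrable[OF w(1) bd p2]
          bounded_borel_integrable[OF eps_borel eps_bd p2])
    with lim[OF key[OF w]] show "Im (c\<^sup>2 * integral {a..b} (\<lambda>s. of_real (w s - \<epsilon> s) * (p s)\<^sup>2)) \<le> 0" by simp
  next
    have "Im (c\<^sup>2 * (J \<epsilon> - J \<epsilon>)) + 1/2 * Im (c\<^sup>2 * (R - J \<epsilon>)) \<le> 0"
      by (rule key) (use eps_borel eps in auto)
    moreover have "integral {a..b} (\<lambda>s. of_real (\<epsilon> s) * (p s)\<^sup>2 - (q s)\<^sup>2) = J \<epsilon> - R"
      unfolding J_def R_def
      by (intro Henstock_Kurzweil_Integration.integral_diff bounded_borel_integrable[OF eps_borel eps_bd p2]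
          integrable_continuous_interval q2)
    moreover have "c\<^sup>2 * (J \<epsilon> - R) = - (c\<^sup>2 * (R - J \<epsilon>))" by (simp add: algebra_simps)
    ultimately show "0 \<le> Im (c\<^sup>2 * (integral {a..b} (\<lambda>s. of_real (\<epsilon> s) * (p s)\<^sup>2 - (q s)\<^sup>2)))" by simp
  qed
qed

end

section \<open>Switching times and the Hamiltonian\<close>

lemma finite_set_partition:
  fixes a b :: real
  assumes Z: "finite Z" and ab: "a < b"
  obtains n p where "p 0 = a" "p (Suc n) = b"
    "\<And>j. j \<le> n \<Longrightarrow> p j < p (Suc j)" "\<And>j. j \<le> n \<Longrightarrow> {p j<..<p (Suc j)} \<inter> Z = {}"
    "\<And>j. j \<le> n \<Longrightarrow> {p j..p (Suc j)} \<subseteq> {a..b}"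
proof -
  define A where "A = insert a (insert b (Z \<inter> {a..b}))"
  define xs where "xs = sorted_list_of_set A"
  have A: "finite A" "A \<subseteq> {a..b}" "a \<in> A" "b \<in> A" using Z ab by (auto simp: A_def)
  have set: "set xs = A" using A by (simp add: xs_def)
  have strict: "xs ! i < xs ! j" if "i < j" "j < length xs" for i j
    using strict_sorted_list_of_set[of A] that unfolding xs_def by (rule sorted_wrt_nth_less)
  have mono: "xs ! i \<le> xs ! j" if "i \<le> j" "j < length xs" for i j
    using strict[of i j] that by (cases "i = j") auto
  have inA: "xs ! i \<in> {a..b}" if "i < length xs" for i using that A set nth_mem by blast
  have "card {a, b} \<le> card A" using A by (intro card_mono) auto
  then have len: "2 \<le> length xs" using ab A by (simp add: xs_def)
  obtain ia where ia: "ia < length xs" "xs ! ia = a" using A(3) set by (metis in_set_conv_nth)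
  obtain ib where ib: "ib < length xs" "xs ! ib = b" using A(4) set by (metis in_set_conv_nth)
  show thesis
  proof (rule that[of "\<lambda>j. xs ! j" "length xs - 2"])
    show "xs ! 0 = a"
    proof (rule antisym)
      show "xs ! 0 \<le> a" using mono[of 0 ia] ia by auto
      have "xs ! 0 \<in> {a..b}" by (rule inA) (use len in auto)
      then show "a \<le> xs ! 0" by simp
    qed
    show "xs ! Suc (length xs - 2) = b"
    proof (rule antisym)
      show "xs ! Suc (length xs - 2) \<le> b" using inA[of "Suc (length xs - 2)"] len by auto
      show "b \<le> xs ! Suc (length xs - 2)" using mono[of ib "Suc (length xs - 2)"] ib len by auto
    qed
    fix j assume j: "j \<le> length xs - 2"
    then show "xs ! j < xs ! Suc j" using len by (intro strict) auto
    show "{xs ! j<..<xs ! Suc j} \<inter> Z = {}"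
    proof (rule ccontr)
      assume "{xs ! j<..<xs ! Suc j} \<inter> Z \<noteq> {}"
      then obtain x where x: "x \<in> Z" "xs ! j < x" "x < xs ! Suc j" by auto
      have jl: "j < length xs" "Suc j < length xs" using j len by linarith+
      then have "x \<in> A" using x inA[of j] inA[of "Suc j"] by (auto simp: A_def)
      then obtain k where k: "k < length xs" "xs ! k = x" using set by (metis in_set_conv_nth)
      have "j < k" using mono[of k j] x k jl by (cases "j < k") auto
      then show False using mono[of "Suc j" k] k x by auto
    qed
    show "{xs ! j..xs ! Suc j} \<subseteq> {a..b}"
      using inA[of j] inA[of "Suc j"] j len by auto
  qed
qed

text \<open>Writing \<open>z = y' / (\<i>\<kappa>)\<close>, these are the nontrivial solutions of \<open>y'' = - \<kappa>\<^sup>2 \<epsilon> y\<close>.  The signs of the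
real and imaginary parts of \<open>\<kappa>\<close> enter only through \<open>Im \<kappa>\<^sup>2 < 0\<close>.\<close>

locale dissipative_flow =
  fixes \<kappa> :: complex and m1 m2 a b :: real and \<epsilon> :: "real \<Rightarrow> real" and y z :: "real \<Rightarrow> complex"
  assumes kappa: "Re \<kappa> > 0" "Im \<kappa> < 0" and m: "0 < m1" and ab: "a < b"
    and eps: "\<And>s. m1 \<le> \<epsilon> s" "\<And>s. \<epsilon> s \<le> m2"
    and flow: "linear_flow \<kappa> 1 \<epsilon> a b y z"
    and nonzero: "\<And>s. s \<in> {a..b} \<Longrightarrow> y s \<noteq> 0 \<or> z s \<noteq> 0"
begin

lemma kappa_nz: "\<kappa> \<noteq> 0" using kappa by auto

lemma cont_y: "continuous_on {a..b} y" and cont_z: "continuous_on {a..b} z"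
  using linear_flow_continuous[OF flow] by auto

lemma y_primitive: "lipschitz_primitive a b y (\<lambda>s. \<i> * \<kappa> * z s)"
  and z_primitive: "lipschitz_primitive a b z (\<lambda>s. \<i> * \<kappa> * of_real (\<epsilon> s) * y s)"
  using flow by (auto simp: linear_flow_def)

lemma y_deriv:
  assumes "s \<in> {a..b}"
  shows "(y has_vector_derivative \<i> * \<kappa> * z s) (at s within {a..b})"
  by (rule lipschitz_primitive_has_vector_derivative[OF y_primitive _ assms]) (intro continuous_intros cont_z)

text \<open>The angular momentum of the plane curve \<open>y\<close>: the argument of \<open>y\<close> changes at the rate
\<open>momentum / \<bar>y\<bar>\<^sup>2\<close>.\<close>

definition momentum :: "real \<Rightarrow> real" where
  "momentum s = Im (cnj (y s) * (\<i> * \<kappa> * z s))"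

text \<open>The derivative \<open>Im (cnj y y'')\<close> equals \<open>- Im \<kappa>\<^sup>2 \<epsilon> \<bar>y\<bar>\<^sup>2\<close>, and \<open>y\<close> cannot vanish on an interval because
\<open>y'\<close> would then vanish there too.\<close>

lemma momentum_strict_mono:
  assumes st: "s \<in> {a..b}" "t \<in> {a..b}" "s < t"
  shows "momentum s < momentum t"
proof -
  define f where "f = (\<lambda>s. \<kappa> * (cnj (\<i> * \<kappa> * z s) * z s + cnj (y s) * (\<i> * \<kappa> * of_real (\<epsilon> s) * y s)))"
  \<comment> \<open>This is \<open>- Im \<kappa>\<^sup>2\<close>.\<close>
  define \<mu> where "\<mu> = - 2 * Re \<kappa> * Im \<kappa>"
  have \<mu>: "\<mu> > 0" using kappa by (simp add: \<mu>_def mult_pos_neg)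
  have Ref: "Re (f s) = \<mu> * \<epsilon> s * (norm (y s))\<^sup>2" for s
  proof -
    have "f s = (\<kappa> * cnj \<kappa>) * (z s * cnj (z s)) * (- \<i>) + \<i> * \<kappa>\<^sup>2 * (of_real (\<epsilon> s) * (y s * cnj (y s)))"
      by (simp add: f_def algebra_simps power2_eq_square)
    also have "\<dots> = of_real ((norm \<kappa>)\<^sup>2 * (norm (z s))\<^sup>2) * (- \<i>) + \<i> * \<kappa>\<^sup>2 * of_real (\<epsilon> s * (norm (y s))\<^sup>2)"
      by (simp only: of_real_mult complex_norm_square)
    finally have "f s = of_real ((norm \<kappa>)\<^sup>2 * (norm (z s))\<^sup>2) * (- \<i>) + \<i> * \<kappa>\<^sup>2 * of_real (\<epsilon> s * (norm (y s))\<^sup>2)" .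
    then show ?thesis by (simp add: \<mu>_def power2_eq_square del: of_real_mult of_real_power)
  qed
  have "lipschitz_primitive a b (\<lambda>s. \<kappa> * (cnj (y s) * z s)) f"
    unfolding f_def
    by (rule lipschitz_primitive_cmult[OF lipschitz_primitive_mult[OF lipschitz_primitive_cnj[OF y_primitive] z_primitive]])
  then have f: "f absolutely_integrable_on {s..t}"
    "integral {s..t} f = \<kappa> * (cnj (y t) * z t) - \<kappa> * (cnj (y s) * z s)"
    using st by (auto simp: lipschitz_primitive_def ae_primitive_on_def)
  have mom: "momentum s = Re (\<kappa> * (cnj (y s) * z s))" for s
    by (simp add: momentum_def algebra_simps)
  have fi: "f integrable_on {s..t}" using f by (simp add: set_lebesgue_integral_eq_integral)
  have cy: "continuous_on {s..t} y" by (rule continuous_on_subset[OF cont_y]) (use st in auto)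
  have "integral {s..t} (\<lambda>r. (norm (y r))\<^sup>2) \<noteq> 0"
  proof
    assume "integral {s..t} (\<lambda>r. (norm (y r))\<^sup>2) = 0"
    then have "\<forall>r\<in>{s..t}. (norm (y r))\<^sup>2 = 0"
      using st by (subst (asm) integral_eq_0_iff) (auto intro!: continuous_intros cy)
    then have y0: "\<And>r. r \<in> {s..t} \<Longrightarrow> y r = 0" by auto
    have "(y has_vector_derivative \<i> * \<kappa> * z s) (at s within {s..t})"
      by (rule has_vector_derivative_within_subset[OF y_deriv[OF st(1)]]) (use st in auto)
    moreover have "(y has_vector_derivative 0) (at s within {s..t})"
      by (rule has_vector_derivative_transform[OF _ _ has_vector_derivative_const[of 0]]) (use st y0 in auto)
    ultimately have "\<i> * \<kappa> * z s = 0"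
      using vector_derivative_unique_within_closed_interval[of s t s y "\<i> * \<kappa> * z s" 0] st by auto
    then show False using nonzero[OF st(1)] y0[of s] st kappa_nz by auto
  qed
  moreover have "integral {s..t} (\<lambda>r. (norm (y r))\<^sup>2) \<ge> 0"
    by (intro integral_nonneg integrable_continuous_interval continuous_intros cy) auto
  ultimately have "0 < \<mu> * m1 * integral {s..t} (\<lambda>r. (norm (y r))\<^sup>2)" using \<mu> m by simp
  also have "\<dots> = integral {s..t} (\<lambda>r. \<mu> * m1 * (norm (y r))\<^sup>2)" by simp
  also have "\<dots> \<le> integral {s..t} (\<lambda>r. Re (f r))"
  proof (rule integral_le)
    show "(\<lambda>r. \<mu> * m1 * (norm (y r))\<^sup>2) integrable_on {s..t}"
      by (intro integrable_continuous_interval continuous_intros cy)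
    show "(\<lambda>r. Re (f r)) integrable_on {s..t}"
      using integrable_linear[OF fi bounded_linear_Re] by (simp add: o_def)
    show "\<mu> * m1 * (norm (y r))\<^sup>2 \<le> Re (f r)" for r
      unfolding Ref using \<mu> eps(1) by (intro mult_right_mono mult_left_mono) auto
  qed
  also have "\<dots> = Re (integral {s..t} f)"
    using integral_linear[OF fi bounded_linear_Re] by (simp add: o_def)
  also have "\<dots> = momentum t - momentum s" using f(2) by (simp add: mom)
  finally show ?thesis by simp
qed

text \<open>As long as \<open>y\<close> stays off the line orthogonal to \<open>c\<close>, the function \<open>Im (y cnj c) / Re (y cnj c)\<close> is the
tangent of the argument of \<open>y / c\<close>.  Its derivative is \<open>\<bar>c\<bar>\<^sup>2 momentum / (Re (y cnj c))\<^sup>2\<close>, and it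
takes the same value whenever \<open>e y\<close> is real, so Rolle's theorem applies.\<close>

lemma real_phase_unique:
  assumes st: "s \<in> {a..b}" "t \<in> {a..b}" "s < t"
    and c: "\<And>r. r \<in> {s..t} \<Longrightarrow> Re (y r * cnj c) \<noteq> 0"
    and J: "\<And>r. r \<in> {s<..<t} \<Longrightarrow> momentum r \<noteq> 0"
    and e: "e \<noteq> 0" and zs: "Im (e * y s) = 0" and zt: "Im (e * y t) = 0"
  shows False
proof -
  define f where "f = (\<lambda>r. Im (y r * cnj c) / Re (y r * cnj c))"
  define f' where "f' = (\<lambda>r. (norm c)\<^sup>2 * momentum r / (Re (y r * cnj c))\<^sup>2)"
  have tan: "f r = Im (cnj c / e) / Re (cnj c / e)" if r: "r \<in> {s..t}" and 0: "Im (e * y r) = 0" for r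
  proof -
    define \<rho> where "\<rho> = Re (e * y r)"
    have "e * y r = of_real \<rho>" using 0 by (simp add: \<rho>_def complex_eq_iff)
    then have eq: "y r * cnj c = of_real \<rho> * (cnj c / e)" using e by (simp add: field_simps)
    define w where "w = cnj c / e"
    have "y r * cnj c = of_real \<rho> * w" using eq by (simp only: w_def)
    with c[OF r] show ?thesis unfolding f_def w_def[symmetric] by auto
  qed
  have "f s = f t" using tan[of s] tan[of t] zs zt st by simp
  moreover have "continuous_on {s..t} f"
    unfolding f_def by (intro continuous_intros continuous_on_subset[OF cont_y]) (use c st in auto)
  moreover have der: "(f has_derivative (\<lambda>h. f' r * h)) (at r)" if r: "r \<in> {s<..<t}" for r
  proof -
    have "at r within {a..b} = at r" using r st by (intro at_within_Icc_at) auto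
    with y_deriv[of r] r st have d: "(y has_vector_derivative \<i> * \<kappa> * z r) (at r)" by auto
    have d2: "((\<lambda>r. y r * cnj c) has_vector_derivative \<i> * \<kappa> * z r * cnj c) (at r)"
      by (rule has_vector_derivative_mult_left[OF d])
    have Im: "((\<lambda>r. Im (y r * cnj c)) has_real_derivative Im (\<i> * \<kappa> * z r * cnj c)) (at r)"
      using bounded_linear.has_vector_derivative[OF bounded_linear_Im d2]
      by (simp add: has_real_derivative_iff_has_vector_derivative)
    have Re: "((\<lambda>r. Re (y r * cnj c)) has_real_derivative Re (\<i> * \<kappa> * z r * cnj c)) (at r)"
      using bounded_linear.has_vector_derivative[OF bounded_linear_Re d2]
      by (simp add: has_real_derivative_iff_has_vector_derivative)
    have "(f has_real_derivative (Im (\<i> * \<kappa> * z r * cnj c) * Re (y r * cnj c) - Im (y r * cnj c) * Re (\<i> * \<kappa> * z r * cnj c))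
        / (Re (y r * cnj c) * Re (y r * cnj c))) (at r)"
      unfolding f_def by (rule DERIV_divide[OF Im Re]) (use c r in auto)
    moreover have "Im (u * cnj c) * Re (v * cnj c) - Im (v * cnj c) * Re (u * cnj c) = (norm c)\<^sup>2 * Im (cnj v * u)" for u v
      unfolding cmod_power2 by (simp add: power2_eq_square algebra_simps)
    ultimately have "(f has_real_derivative f' r) (at r)"
      unfolding f'_def momentum_def power2_eq_square by (metis power2_eq_square)
    then show ?thesis by (simp add: has_field_derivative_def)
  qed
  ultimately obtain r where r: "s < r" "r < t" "(\<lambda>h. f' r * h) = (\<lambda>h. 0)"
    using Rolle_deriv[of s t f "\<lambda>r h. f' r * h"] st(3) by auto
  then have "f' r = 0" by (metis mult.right_neutral)
  then show False using J[of r] c[of r] r by (auto simp: f'_def)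
qed

text \<open>If \<open>y s0 \<noteq> 0\<close>, take \<open>c = y s0\<close>.  If \<open>y s0 = 0\<close>, then \<open>y\<close> leaves the origin in the direction of
\<open>c = y' s0 \<noteq> 0\<close>, on opposite sides before and after \<open>s0\<close>.\<close>

lemma direction_near:
  assumes s0: "s0 \<in> {a..b}"
  obtains c \<delta> where "\<delta> > 0" "\<And>r. r \<in> {a..b} \<Longrightarrow> r \<noteq> s0 \<Longrightarrow> \<bar>r - s0\<bar> < \<delta> \<Longrightarrow> Re (y r * cnj c) \<noteq> 0"
proof (cases "y s0 = 0")
  case False
  define c where "c = y s0"
  have "continuous_on {a..b} (\<lambda>r. complex_of_real (Re (y r * cnj c)))"
    by (intro continuous_intros cont_y)
  moreover have "Re (y s0 * cnj c) = (norm (y s0))\<^sup>2"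
    by (simp only: c_def complex_norm_square[symmetric] Re_complex_of_real)
  then have "complex_of_real (Re (y s0 * cnj c)) \<noteq> 0" using False by simp
  ultimately obtain \<delta> where \<delta>: "\<delta> > 0"
    "\<And>r. r \<in> {a..b} \<inter> {s0 - \<delta>..s0 + \<delta>} \<Longrightarrow> complex_of_real (Re (y r * cnj c)) \<noteq> 0"
    using continuous_nonzero_near[OF _ s0, of "\<lambda>r. complex_of_real (Re (y r * cnj c))"] by metis
  show thesis
  proof (rule that[of \<delta> c])
    fix r assume "r \<in> {a..b}" "\<bar>r - s0\<bar> < \<delta>"
    then have "r \<in> {a..b} \<inter> {s0 - \<delta>..s0 + \<delta>}" by auto
    from \<delta>(2)[OF this] show "Re (y r * cnj c) \<noteq> 0" by (metis of_real_0)
  qed (use \<delta> in auto)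
next
  case True
  define c where "c = \<i> * \<kappa> * z s0"
  have c: "c \<noteq> 0" using True nonzero[OF s0] kappa_nz by (auto simp: c_def)
  have "(y has_derivative (\<lambda>h. h *\<^sub>R c)) (at s0 within {a..b})"
    using y_deriv[OF s0] by (simp add: has_vector_derivative_def c_def)
  then obtain \<delta> where \<delta>: "\<delta> > 0" "\<And>r. r \<in> {a..b} \<Longrightarrow> norm (r - s0) < \<delta> \<Longrightarrow>
      norm (y r - y s0 - (r - s0) *\<^sub>R c) \<le> norm c / 2 * norm (r - s0)"
    unfolding has_derivative_within_alt using c by (metis half_gt_zero zero_less_norm_iff)
  show thesis
  proof (rule that[OF \<delta>(1)])
    fix r assume r: "r \<in> {a..b}" "r \<noteq> s0" "\<bar>r - s0\<bar> < \<delta>"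
    define R where "R = y r - (r - s0) *\<^sub>R c"
    have "norm R \<le> norm c / 2 * \<bar>r - s0\<bar>" using \<delta>(2)[OF r(1)] r(3) True by (simp add: R_def)
    then have "norm (R * cnj c) \<le> norm c / 2 * \<bar>r - s0\<bar> * norm c"
      unfolding norm_mult complex_mod_cnj by (intro mult_right_mono) auto
    then have "\<bar>Re (R * cnj c)\<bar> \<le> (norm c)\<^sup>2 * \<bar>r - s0\<bar> / 2"
      using abs_Re_le_cmod[of "R * cnj c"] by (simp add: power2_eq_square mult_ac)
    moreover have "Re (y r * cnj c) = (r - s0) * (norm c)\<^sup>2 + Re (R * cnj c)"
    proof -
      have "y r * cnj c = of_real (r - s0) * (c * cnj c) + R * cnj c"
        by (simp add: R_def scaleR_conv_of_real algebra_simps)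
      also have "c * cnj c = of_real ((norm c)\<^sup>2)" by (rule complex_norm_square[symmetric])
      finally show ?thesis by (simp del: of_real_power of_real_diff)
    qed
    moreover have "\<bar>(r - s0) * (norm c)\<^sup>2\<bar> = (norm c)\<^sup>2 * \<bar>r - s0\<bar>" by (simp add: abs_mult)
    moreover have "(norm c)\<^sup>2 * \<bar>r - s0\<bar> > 0" using c r by simp
    ultimately show "Re (y r * cnj c) \<noteq> 0" by linarith
  qed
qed

lemma momentum_nonzero_near:
  assumes "s0 \<in> {a..b}"
  obtains \<delta> where "\<delta> > 0" "\<And>r. r \<in> {a..b} \<Longrightarrow> r \<noteq> s0 \<Longrightarrow> \<bar>r - s0\<bar> < \<delta> \<Longrightarrow> momentum r \<noteq> 0"
proof (cases "\<exists>r\<in>{a..b}. r \<noteq> s0 \<and> momentum r = 0")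
  case True
  then obtain s where s: "s \<in> {a..b}" "s \<noteq> s0" "momentum s = 0" by blast
  show thesis
  proof (rule that[of "\<bar>s - s0\<bar>"])
    fix r assume r: "r \<in> {a..b}" "\<bar>r - s0\<bar> < \<bar>s - s0\<bar>"
    then have "r \<noteq> s" by auto
    then show "momentum r \<noteq> 0"
      using momentum_strict_mono[OF r(1) s(1)] momentum_strict_mono[OF s(1) r(1)] s(3)
      by (cases r s rule: linorder_cases) auto
  qed (use s in auto)
next
  case False
  then show thesis by (intro that[of 1]) auto
qed

text \<open>Near every time, at most one zero lies on each side, so the zeros cannot accumulate in the compact
interval.\<close>

lemma finite_real_phase:
  assumes e: "e \<noteq> 0"
  shows "finite {s \<in> {a..b}. Im (e * y s) = 0}"
proof (rule ccontr)
  define Z where "Z = {s \<in> {a..b}. Im (e * y s) = 0}"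
  assume "infinite {s \<in> {a..b}. Im (e * y s) = 0}"
  then have "infinite Z" "Z \<subseteq> {a..b}" by (auto simp: Z_def)
  then obtain s0 where s0: "s0 \<in> {a..b}" "s0 islimpt Z"
    using compact_Icc[of a b] unfolding compact_eq_Bolzano_Weierstrass by metis
  obtain c \<delta>1 where 1: "\<delta>1 > 0" "\<And>r. r \<in> {a..b} \<Longrightarrow> r \<noteq> s0 \<Longrightarrow> \<bar>r - s0\<bar> < \<delta>1 \<Longrightarrow> Re (y r * cnj c) \<noteq> 0"
    using direction_near[OF s0(1)] by metis
  obtain \<delta>2 where 2: "\<delta>2 > 0" "\<And>r. r \<in> {a..b} \<Longrightarrow> r \<noteq> s0 \<Longrightarrow> \<bar>r - s0\<bar> < \<delta>2 \<Longrightarrow> momentum r \<noteq> 0"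
    using momentum_nonzero_near[OF s0(1)] by metis
  define \<delta> where "\<delta> = min \<delta>1 \<delta>2"
  have \<delta>: "\<delta> > 0" using 1 2 by (simp add: \<delta>_def)
  have uniq: False if "s \<in> Z" "t \<in> Z" "s < t" "\<And>r. r \<in> {s..t} \<Longrightarrow> r \<noteq> s0 \<and> \<bar>r - s0\<bar> < \<delta>" for s t
  proof (rule real_phase_unique[of s t c e])
    have sub: "{s..t} \<subseteq> {a..b}" using that by (auto simp: Z_def)
    show "Re (y r * cnj c) \<noteq> 0" if "r \<in> {s..t}" for r
      using 1(2)[of r] that sub \<open>\<And>r. r \<in> {s..t} \<Longrightarrow> r \<noteq> s0 \<and> \<bar>r - s0\<bar> < \<delta>\<close>[of r] by (auto simp: \<delta>_def)
    show "momentum r \<noteq> 0" if "r \<in> {s<..<t}" for r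
      using 2(2)[of r] that sub \<open>\<And>r. r \<in> {s..t} \<Longrightarrow> r \<noteq> s0 \<and> \<bar>r - s0\<bar> < \<delta>\<close>[of r] by (auto simp: \<delta>_def)
  qed (use that e in \<open>auto simp: Z_def\<close>)
  have fin: "finite A" if "\<And>s t. s \<in> A \<Longrightarrow> t \<in> A \<Longrightarrow> \<not> s < t" for A :: "real set"
  proof (cases "A = {}")
    case False
    then obtain x where "x \<in> A" by blast
    have "A \<subseteq> {x}"
    proof
      fix t assume "t \<in> A"
      with \<open>x \<in> A\<close> that[of x t] that[of t x] show "t \<in> {x}" by auto
    qed
    then show ?thesis by (rule finite_subset) simp
  qed auto
  have "finite (Z \<inter> {s0<..<s0 + \<delta>})" "finite (Z \<inter> {s0 - \<delta><..<s0})"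
    by (rule fin; use uniq in force)+
  then have "finite ((Z \<inter> {s0<..<s0 + \<delta>}) \<union> (Z \<inter> {s0 - \<delta><..<s0}) \<union> {s0})" by simp
  moreover have "Z \<inter> ball s0 \<delta> \<subseteq> (Z \<inter> {s0<..<s0 + \<delta>}) \<union> (Z \<inter> {s0 - \<delta><..<s0}) \<union> {s0}"
    by (auto simp: dist_real_def)
  ultimately have "finite (Z \<inter> ball s0 \<delta>)" by (rule finite_subset[rotated])
  with s0(2) \<delta> show False by (auto simp: islimpt_eq_infinite_ball)
qed

text \<open>The number \<open>y\<^sup>2\<close> is real exactly if \<open>y\<close> or \<open>\<i> y\<close> is real.\<close>

lemma finite_switching_times: "finite {s \<in> {a..b}. Im ((y s)\<^sup>2) = 0}"
proof (rule finite_subset)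
  show "{s \<in> {a..b}. Im ((y s)\<^sup>2) = 0} \<subseteq> {s \<in> {a..b}. Im (1 * y s) = 0} \<union> {s \<in> {a..b}. Im (\<i> * y s) = 0}"
    by (auto simp: power2_eq_square)
  show "finite ({s \<in> {a..b}. Im (1 * y s) = 0} \<union> {s \<in> {a..b}. Im (\<i> * y s) = 0})"
    by (intro finite_UnI finite_real_phase) auto
qed

lemma sign_constant_between_switches:
  assumes uv: "{u<..<v} \<subseteq> {a..b}" and nz: "\<And>r. r \<in> {u<..<v} \<Longrightarrow> Im ((y r)\<^sup>2) \<noteq> 0"
    and st: "s \<in> {u<..<v}" "t \<in> {u<..<v}" and pos: "Im ((y s)\<^sup>2) > 0"
  shows "Im ((y t)\<^sup>2) > 0"
proof (rule ccontr)
  assume "\<not> Im ((y t)\<^sup>2) > 0"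
  moreover have "connected ((\<lambda>r. Im ((y r)\<^sup>2)) ` {u<..<v})"
    by (intro connected_continuous_image continuous_intros continuous_on_subset[OF cont_y uv]) auto
  ultimately have "0 \<in> (\<lambda>r. Im ((y r)\<^sup>2)) ` {u<..<v}"
    using st pos by (elim connectedD_interval[of _ "Im ((y t)\<^sup>2)" "Im ((y s)\<^sup>2)"]) auto
  with nz show False by auto
qed

lemma bang_bang:
  assumes sw: "\<And>s. s \<in> {a..b} \<Longrightarrow> \<epsilon> s = (if 0 < Im ((y s)\<^sup>2) then n2\<^sup>2 else n1\<^sup>2)"
  shows "bang_bang_on n1 n2 a b \<epsilon>"
proof -
  obtain n p where p: "p 0 = a" "p (Suc n) = b"
    "\<And>j. j \<le> n \<Longrightarrow> p j < p (Suc j)" "\<And>j. j \<le> n \<Longrightarrow> {p j<..<p (Suc j)} \<inter> {s \<in> {a..b}. Im ((y s)\<^sup>2) = 0} = {}"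
    "\<And>j. j \<le> n \<Longrightarrow> {p j..p (Suc j)} \<subseteq> {a..b}"
    by (rule finite_set_partition[OF finite_switching_times ab]) (rule that)
  have "\<epsilon> constant_on {p j<..<p (Suc j)}" if j: "j \<le> n" for j
  proof -
    have sub: "{p j<..<p (Suc j)} \<subseteq> {a..b}" using p(5)[OF j] greaterThanLessThan_subseteq_atLeastAtMost_iff by force
    have nz: "Im ((y r)\<^sup>2) \<noteq> 0" if "r \<in> {p j<..<p (Suc j)}" for r using p(4)[OF j] that subsetD[OF sub that] by auto
    have "\<epsilon> s = \<epsilon> t" if st: "s \<in> {p j<..<p (Suc j)}" "t \<in> {p j<..<p (Suc j)}" for s t
      using sw[OF subsetD[OF sub st(1)]] sw[OF subsetD[OF sub st(2)]] sign_constant_between_switches[OF sub nz st]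
        sign_constant_between_switches[OF sub nz st(2,1)] by auto
    then show ?thesis unfolding constant_on_def by metis
  qed
  then have "\<exists>n p. p 0 = a \<and> p (Suc n) = b \<and> (\<forall>j\<le>n. p j < p (Suc j) \<and> \<epsilon> constant_on {p j<..<p (Suc j)})"
    using p by (intro exI[of _ n] exI[of _ p]) blast
  then show ?thesis unfolding bang_bang_on_def using sw by auto
qed

text \<open>Under the switching law \<open>\<epsilon> Im (y\<^sup>2)\<close> is continuous across switches, since \<open>Im (y\<^sup>2)\<close> vanishes there.
Between switches \<open>\<epsilon>\<close> is constant and \<open>(\<epsilon> y\<^sup>2 - z\<^sup>2)' = 2 \<i>\<kappa> (\<epsilon> - \<epsilon>) y z = 0\<close>.\<close>

lemma hamiltonian_constant:
  assumes sw: "\<And>s. s \<in> {a..b} \<Longrightarrow> \<epsilon> s = (if 0 < Im ((y s)\<^sup>2) then k2 else k1)"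
    and s: "s \<in> {a..b}"
  shows "\<epsilon> s * Im ((y s)\<^sup>2) - Im ((z s)\<^sup>2) = \<epsilon> a * Im ((y a)\<^sup>2) - Im ((z a)\<^sup>2)"
proof -
  define g where "g = (\<lambda>s. Im ((y s)\<^sup>2))"
  define H where "H = (\<lambda>s. \<epsilon> s * g s - Im ((z s)\<^sup>2))"
  have cg: "continuous_on {a..b} g" unfolding g_def by (intro continuous_intros cont_y)
  \<comment> \<open>The switching law written without a case distinction, to see continuity.\<close>
  have "continuous_on {a..b} (\<lambda>s. k2 * max (g s) 0 + k1 * min (g s) 0 - Im ((z s)\<^sup>2))"
    by (intro continuous_intros cg cont_z)
  then have cH: "continuous_on {a..b} H"
    by (rule continuous_on_eq) (auto simp: H_def sw g_def)
  define Z where "Z = insert a (insert b {s \<in> {a..b}. g s = 0})"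
  have Z: "finite Z" using finite_switching_times by (simp add: Z_def g_def)
  have "H s = H a"
  proof (rule has_derivative_zero_unique_strong_interval[OF Z cH refl _ s])
    fix x assume x: "x \<in> {a..b} - Z"
    then have xab: "x \<in> {a<..<b}" "g x \<noteq> 0" by (auto simp: Z_def)
    have "\<exists>d>0. \<forall>r\<in>{a..b}. dist r x < d \<longrightarrow> dist (g r) (g x) < \<bar>g x\<bar>"
      using continuous_on_iff[THEN iffD1, rule_format, OF cg, of x "\<bar>g x\<bar>"] x xab(2) by auto
    then obtain d where d: "d > 0" "\<And>r. r \<in> {a..b} \<Longrightarrow> dist r x < d \<Longrightarrow> dist (g r) (g x) < \<bar>g x\<bar>" by blast
    have same: "0 < g r \<longleftrightarrow> 0 < g x" if "r \<in> {a..b}" "dist r x < d" for r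
      using d(2)[OF that] xab(2) by (auto simp: dist_real_def abs_if split: if_splits)
    define e where "e = d / 2"
    define u v where "u = max a (x - e)" and "v = min b (x + e)"
    have uv: "a \<le> u" "v \<le> b" "x \<in> {u<..<v}" using xab d by (auto simp: u_def v_def e_def)
    have eps_uv: "\<epsilon> r = \<epsilon> x" if "r \<in> {u..v}" for r
    proof -
      have "r \<in> {a..b}" using that uv by auto
      moreover have "dist r x < d" using that d(1) by (auto simp: dist_real_def u_def v_def e_def)
      ultimately show ?thesis using sw[of r] sw[of x] same[of r] x by (auto simp: g_def)
    qed
    have y: "lipschitz_primitive u v y (\<lambda>s. \<i> * \<kappa> * z s)"
      and z: "lipschitz_primitive u v z (\<lambda>s. \<i> * \<kappa> * of_real (\<epsilon> s) * y s)"
      using lipschitz_primitive_subinterval[OF y_primitive uv(1,2)]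
        lipschitz_primitive_subinterval[OF z_primitive uv(1,2)] by auto
    have "lipschitz_primitive u v (\<lambda>s. of_real (\<epsilon> x) * (y s * y s) - z s * z s) (\<lambda>_. 0)"
      by (rule lipschitz_primitive_cong[OF lipschitz_primitive_diff[OF lipschitz_primitive_cmult[OF
              lipschitz_primitive_mult[OF y y], of "of_real (\<epsilon> x)"] lipschitz_primitive_mult[OF z z]]])
        (auto simp: eps_uv algebra_simps)
    then have inc: "of_real (\<epsilon> x) * (y t * y t) - z t * z t = of_real (\<epsilon> x) * (y s * y s) - z s * z s"
      if "s \<in> {u..v}" "t \<in> {u..v}" "s \<le> t" for s t
      using that by (auto simp: lipschitz_primitive_def ae_primitive_on_def)
    have Hx: "H r = H x" if r: "r \<in> {u<..<v}" for r
    proof -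
      have "of_real (\<epsilon> x) * (y r * y r) - z r * z r = of_real (\<epsilon> x) * (y x * y x) - z x * z x"
        using inc[of r x] inc[of x r] r uv(3) by (cases "r \<le> x") auto
      then have "Im (of_real (\<epsilon> x) * (y r)\<^sup>2 - (z r)\<^sup>2) = Im (of_real (\<epsilon> x) * (y x)\<^sup>2 - (z x)\<^sup>2)"
        by (simp add: power2_eq_square)
      then show ?thesis using eps_uv[of r] r by (simp add: H_def g_def)
    qed
    show "(H has_derivative (\<lambda>h. 0)) (at x within {a..b})"
    proof (rule has_derivative_transform_within_open[OF has_derivative_const[of "H x"], of "{u<..<v}"])
      show "\<And>r. r \<in> {u<..<v} \<Longrightarrow> H x = H r" using Hx by simp
    qed (use uv in auto)
  qed
  then show ?thesis by (simp add: H_def g_def)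
qed

text \<open>Compare \<open>\<epsilon>\<close> with the pointwise maximizer of \<open>Im (w y\<^sup>2)\<close>: the integrand is nonnegative with a
nonpositive integral, so it vanishes almost everywhere, and \<open>Im (y\<^sup>2) \<noteq> 0\<close> off a finite set.\<close>

lemma maximizing_control_AE:
  assumes eps_borel: "\<epsilon> \<in> borel_measurable borel" and m12: "m1 \<le> m2"
    and max: "\<And>w. w \<in> borel_measurable borel \<Longrightarrow> (\<And>s. m1 \<le> w s \<and> w s \<le> m2) \<Longrightarrow>
        Im (integral {a..b} (\<lambda>s. of_real (w s - \<epsilon> s) * (y s)\<^sup>2)) \<le> 0"
  shows "negligible {s \<in> {a..b}. \<epsilon> s \<noteq> (if 0 < Im ((y s)\<^sup>2) then m2 else m1)}"
proof -
  define g where "g = (\<lambda>s. Im ((y s)\<^sup>2))"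
  have cg: "continuous_on {a..b} g" unfolding g_def by (intro continuous_intros cont_y)
  \<comment> \<open>The indicator makes the comparison control Borel measurable on the whole line.\<close>
  define w where "w = (\<lambda>s. if 0 < indicator {a..b} s *\<^sub>R g s then m2 else m1)"
  have gm: "(\<lambda>s. indicator {a..b} s *\<^sub>R g s) \<in> borel_measurable borel"
    by (rule borel_measurable_continuous_on_indicator[OF _ cg]) auto
  have wm: "w \<in> borel_measurable borel"
    unfolding w_def using gm by measurable
  have w: "m1 \<le> w s \<and> w s \<le> m2" for s using m12 by (simp add: w_def)
  have weq: "w s = (if 0 < Im ((y s)\<^sup>2) then m2 else m1)" if "s \<in> {a..b}" for s
    using that by (simp add: w_def g_def)
  have dm: "(\<lambda>s. w s - \<epsilon> s) \<in> borel_measurable borel" using wm eps_borel by simp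
  have bd: "\<bar>w s - \<epsilon> s\<bar> \<le> m2" for s using w[of s] eps[of s] m by linarith
  have "continuous_on {a..b} (\<lambda>s. (y s)\<^sup>2)" by (intro continuous_intros cont_y)
  then have I: "(\<lambda>s. of_real (w s - \<epsilon> s) * (y s)\<^sup>2) absolutely_integrable_on {a..b}"
    by (rule bounded_borel_times_continuous[OF dm bd])
  define h where "h = (\<lambda>s. Im (of_real (w s - \<epsilon> s) * (y s)\<^sup>2))"
  have heq: "h s = (w s - \<epsilon> s) * g s" for s by (simp add: h_def g_def del: of_real_diff)
  have h: "h absolutely_integrable_on {a..b}"
    using absolutely_integrable_linear[OF I bounded_linear_Im] by (simp add: h_def o_def)
  have nn: "0 \<le> h s" if "s \<in> {a..b}" for s
    using weq[OF that] eps[of s] unfolding heq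
    by (cases "0 < g s") (auto simp: g_def mult_nonpos_nonpos)
  have "integral {a..b} h = Im (integral {a..b} (\<lambda>s. of_real (w s - \<epsilon> s) * (y s)\<^sup>2))"
    using integral_linear[OF _ bounded_linear_Im, of "\<lambda>s. of_real (w s - \<epsilon> s) * (y s)\<^sup>2" "{a..b}"] I
    by (simp add: h_def o_def set_lebesgue_integral_eq_integral)
  also have "\<dots> \<le> 0" by (rule max[OF wm w])
  finally have "integral {a..b} h \<le> 0" .
  moreover have "0 \<le> integral {a..b} h"
    using nn h by (intro integral_nonneg) (auto simp: set_lebesgue_integral_eq_integral)
  ultimately have "AE s in lebesgue_on {a..b}. h s = 0"
    using nonneg_integral_zero_AE[OF h nn] by simp
  then have "negligible ({s \<in> {a..b}. h s \<noteq> 0} \<union> {s \<in> {a..b}. Im ((y s)\<^sup>2) = 0})"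
    unfolding AE_lebesgue_on_negligible
    by (rule negligible_Un[OF _ negligible_finite[OF finite_switching_times]])
  then show ?thesis
    by (rule negligible_subset) (use weq in \<open>auto simp: heq g_def split: if_splits\<close>)
qed

end

section \<open>Structure of minimum-time controls\<close>

theorem theorem5p1:
  fixes n1 n2 sm sp :: real and \<kappa> :: complex
    and \<eta>m \<eta>p :: riemann_sphere and \<epsilon> :: "real \<Rightarrow> real"
  assumes "0 < n1" and "n1 < n2"
    and "Re \<kappa> > 0" and "Im \<kappa> < 0"
    and "\<eta>m \<noteq> \<eta>p"
    and "min_time_control n1 n2 \<kappa> sm sp \<eta>m \<eta>p \<epsilon>"
  shows "\<exists>\<epsilon>'. (AE s in lebesgue_on {sm..sp}. \<epsilon>' s = \<epsilon> s) \<and>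
           bang_bang_on n1 n2 sm sp \<epsilon>' \<and>
           (\<exists>(lam0 :: real) y dy.
              0 \<le> lam0 \<and>
              schroedinger_solution \<kappa> \<epsilon>' sm sp y dy \<and>
              (\<exists>s\<in>{sm..sp}. y s \<noteq> 0) \<and>
              riccati_quotient \<kappa> (y sm) (dy sm) = \<eta>m \<and>
              riccati_quotient \<kappa> (y sp) (dy sp) = \<eta>p \<and>
              (\<forall>s\<in>{sm..sp}. (Im ((y s)\<^sup>2) < 0 \<longrightarrow> \<epsilon>' s = n1\<^sup>2) \<and>
                             (Im ((y s)\<^sup>2) > 0 \<longrightarrow> \<epsilon>' s = n2\<^sup>2)) \<and>
              (\<forall>s\<in>{sm..sp}. Im (of_real (\<epsilon>' s) * (y s)\<^sup>2 + (dy s)\<^sup>2 / \<kappa>\<^sup>2) = lam0))"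
proof -
  define m1 m2 where "m1 = n1\<^sup>2" and "m2 = n2\<^sup>2"
  have m: "0 < m1" "m1 < m2" using assms(1,2) by (auto simp: m1_def m2_def power_strict_mono)
  have kappa: "\<kappa> \<noteq> 0" using assms(3) by auto
  have feas: "feasible_control n1 n2 sm \<epsilon>" and min: "ereal (sp - sm) = min_time n1 n2 \<kappa> sm \<eta>m \<eta>p"
    and "steers \<kappa> \<epsilon> sm sp \<eta>m \<eta>p"
    using assms(6) by (auto simp: min_time_control_def)
  then obtain x where x: "trajectory \<kappa> \<epsilon> sm sp x" "x sm = \<eta>m" "x sp = \<eta>p" by (auto simp: steers_def)
  have "0 \<le> min_time n1 n2 \<kappa> sm \<eta>m \<eta>p"
    unfolding min_time_def by (rule Inf_greatest) auto
  then have "sm \<le> sp" using min by (metis diff_ge_0_iff_ge ereal_less_eq(5))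
  with x assms(5) have ab: "sm < sp" by (cases "sm = sp") auto
  have eps: "\<epsilon> \<in> borel_measurable (lebesgue_on {sm<..})" "AE s in lebesgue_on {sm<..}. m1 \<le> \<epsilon> s \<and> \<epsilon> s \<le> m2"
    using feas by (auto simp: feasible_control_def m1_def m2_def)
  obtain \<epsilon>1 S where e1: "\<epsilon>1 \<in> borel_measurable borel" "\<And>s. m1 \<le> \<epsilon>1 s" "\<And>s. \<epsilon>1 s \<le> m2"
    and S: "negligible S" "\<And>s. sm \<le> s \<Longrightarrow> s \<notin> S \<Longrightarrow> \<epsilon> s = \<epsilon>1 s"
    by (rule bounded_borel_representative[OF eps less_imp_le[OF m(2)]]) (rule that)
  have x1: "trajectory \<kappa> \<epsilon>1 sm sp x" by (rule trajectory_spike[OF x(1) S(1)]) (use S(2) in auto)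
  have e1_bd: "\<bar>\<epsilon>1 s\<bar> \<le> m2" for s using e1(2,3)[of s] m by linarith
  \<comment> \<open>Homogeneous coordinates of the initial point.\<close>
  obtain p0 q0 where pq0: "projective_ratio p0 q0 = \<eta>m" "p0 \<noteq> 0 \<or> q0 \<noteq> 0"
  proof (cases \<eta>m)
    case (Fin c)
    then show thesis by (intro that[of 1 c]) (auto simp: projective_ratio_def)
  next
    case Infty
    then show thesis by (intro that[of 0 1]) (auto simp: projective_ratio_def)
  qed
  obtain p q where fl: "linear_flow \<kappa> 1 \<epsilon>1 sm sp p q" and pq: "p sm = p0" "q sm = q0"
    using linear_flow_exists[OF kappa e1(1) e1_bd less_imp_le[OF ab], of 1 p0 q0] by metis
  have nz: "p s \<noteq> 0 \<or> q s \<noteq> 0" if s: "s \<in> {sm..sp}" for s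
  proof (rule ccontr)
    assume "\<not> (p s \<noteq> 0 \<or> q s \<noteq> 0)"
    moreover have "\<bar>\<epsilon>1 r\<bar> \<le> 1 + m2" for r using e1_bd[of r] by linarith
    ultimately have "p sm = 0 \<and> q sm = 0"
      using linear_flow_zero_propagates[OF fl, of "1 + m2" s sm] s ab m by auto
    with pq pq0 show False by simp
  qed
  have ratio: "projective_ratio (p s) (q s) = x s" if "s \<in> {sm..sp}" for s
    using trajectory_is_projected_flow[OF x1 fl e1_bd nz _ that] x(2) pq pq0 by simp
  interpret opt: optimal_flow \<kappa> m1 m2 sm sp \<epsilon>1 p q
  proof
    fix v w P Q assume vw: "admissible m1 m2 v w" and PQ: "linear_flow \<kappa> v w sm sp P Q" "P sm = p sm" "Q sm = q sm"
    have "projective_ratio (P sp) (Q sp) \<noteq> \<eta>p"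
      by (rule faster_flow_misses_target[OF assms(1,2) ab kappa min vw[unfolded m1_def m2_def] PQ(1)])
        (use PQ pq pq0 in auto)
    moreover have "P sp \<noteq> 0 \<or> Q sp \<noteq> 0"
    proof (rule ccontr)
      assume "\<not> (P sp \<noteq> 0 \<or> Q sp \<noteq> 0)"
      moreover have "\<bar>w s\<bar> \<le> 1 + m2" for s using admissible_bound[OF m(1) vw, of s] by linarith
      moreover have "\<bar>v\<bar> \<le> 1 + m2" using vw m by (auto simp: admissible_def)
      ultimately have "P sm = 0 \<and> Q sm = 0"
        using linear_flow_zero_propagates[OF PQ(1), of "1 + m2" sp sm] ab by auto
      with PQ pq pq0 show False by simp
    qed
    ultimately show "p sp * Q sp \<noteq> q sp * P sp"
      using projective_ratio_eq[of "p sp" "Q sp" "q sp" "P sp"] nz[of sp] ratio[of sp] x(3) ab by auto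
  qed (use kappa m ab e1 fl in auto)
  obtain c where c: "c \<noteq> 0"
    "\<And>w. w \<in> borel_measurable borel \<Longrightarrow> (\<And>s. m1 \<le> w s \<and> w s \<le> m2) \<Longrightarrow>
        Im (c\<^sup>2 * integral {sm..sp} (\<lambda>s. of_real (w s - \<epsilon>1 s) * (p s)\<^sup>2)) \<le> 0"
    "0 \<le> Im (c\<^sup>2 * (integral {sm..sp} (\<lambda>s. of_real (\<epsilon>1 s) * (p s)\<^sup>2 - (q s)\<^sup>2)))"
    using opt.maximum_principle_integrated by blast
  define y z where "y = (\<lambda>s. c * p s)" and "z = (\<lambda>s. c * q s)"
  have fl1: "linear_flow \<kappa> 1 \<epsilon>1 sm sp y z" unfolding y_def z_def by (rule linear_flow_scale[OF fl])
  have nz1: "y s \<noteq> 0 \<or> z s \<noteq> 0" if "s \<in> {sm..sp}" for s using nz[OF that] c(1) by (simp add: y_def z_def)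
  interpret d1: dissipative_flow \<kappa> m1 m2 sm sp \<epsilon>1 y z
    by unfold_locales (use assms(3,4) m ab e1 fl1 nz1 in auto)
  have Y2: "c\<^sup>2 * integral {sm..sp} (\<lambda>s. of_real (w s - \<epsilon>1 s) * (p s)\<^sup>2)
      = integral {sm..sp} (\<lambda>s. of_real (w s - \<epsilon>1 s) * (y s)\<^sup>2)" for w
    unfolding y_def by (simp flip: integral_mult_right add: power_mult_distrib mult_ac)
  have max: "Im (integral {sm..sp} (\<lambda>s. of_real (w s - \<epsilon>1 s) * (y s)\<^sup>2)) \<le> 0"
    if "w \<in> borel_measurable borel" "\<And>s. m1 \<le> w s \<and> w s \<le> m2" for w
    using c(2)[OF that] by (simp only: Y2)
  \<comment> \<open>The value \<open>m1\<close> at the finitely many times with real \<open>y\<^sup>2\<close> is an arbitrary choice.\<close>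
  define \<epsilon>' where "\<epsilon>' = (\<lambda>s. if 0 < Im ((y s)\<^sup>2) then m2 else m1)"
  have S': "negligible {s \<in> {sm..sp}. \<epsilon>1 s \<noteq> \<epsilon>' s}"
    unfolding \<epsilon>'_def by (rule d1.maximizing_control_AE[OF e1(1) less_imp_le[OF m(2)] max])
  have e'_bd: "m1 \<le> \<epsilon>' s" "\<epsilon>' s \<le> m2" "\<bar>\<epsilon>' s\<bar> \<le> m2" for s using m by (auto simp: \<epsilon>'_def)
  have fl': "linear_flow \<kappa> 1 \<epsilon>' sm sp y z"
    by (rule linear_flow_spike[OF fl1 S' _ e'_bd(3)]) auto
  interpret d: dissipative_flow \<kappa> m1 m2 sm sp \<epsilon>' y z
    by unfold_locales (use assms(3,4) m ab e'_bd fl' nz1 in auto)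
  define lam0 where "lam0 = \<epsilon>' sm * Im ((y sm)\<^sup>2) - Im ((z sm)\<^sup>2)"
  have ham: "\<epsilon>' s * Im ((y s)\<^sup>2) - Im ((z s)\<^sup>2) = lam0" if "s \<in> {sm..sp}" for s
    unfolding lam0_def by (rule d.hamiltonian_constant[OF _ that]) (simp add: \<epsilon>'_def)
  \<comment> \<open>The integral of the Hamiltonian is \<open>lam0 (sp - sm)\<close>, and the maximum principle bounds it below by zero.\<close>
  have "0 \<le> lam0"
  proof -
    have int: "(\<lambda>s. of_real (\<epsilon>1 s) * (y s)\<^sup>2 - (z s)\<^sup>2) integrable_on {sm..sp}"
      by (intro integrable_diff opt.bounded_borel_integrable[OF e1(1) e1_bd] integrable_continuous_interval
          continuous_intros d1.cont_y d1.cont_z)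
    have "c\<^sup>2 * integral {sm..sp} (\<lambda>s. of_real (\<epsilon>1 s) * (p s)\<^sup>2 - (q s)\<^sup>2)
      = integral {sm..sp} (\<lambda>s. of_real (\<epsilon>1 s) * (y s)\<^sup>2 - (z s)\<^sup>2)"
      unfolding y_def z_def by (simp flip: integral_mult_right add: power_mult_distrib algebra_simps)
    with c(3) have "0 \<le> Im (integral {sm..sp} (\<lambda>s. of_real (\<epsilon>1 s) * (y s)\<^sup>2 - (z s)\<^sup>2))" by simp
    also have "\<dots> = integral {sm..sp} (\<lambda>s. Im (of_real (\<epsilon>1 s) * (y s)\<^sup>2 - (z s)\<^sup>2))"
      using integral_linear[OF int bounded_linear_Im] by (simp add: o_def)
    also have "\<dots> = integral {sm..sp} (\<lambda>s. lam0)"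
    proof (rule integral_spike[OF S'])
      fix s assume "s \<in> {sm..sp} - {s \<in> {sm..sp}. \<epsilon>1 s \<noteq> \<epsilon>' s}"
      with ham[of s] show "lam0 = Im (of_real (\<epsilon>1 s) * (y s)\<^sup>2 - (z s)\<^sup>2)" by auto
    qed
    finally show ?thesis using ab by (simp add: zero_le_mult_iff)
  qed
  define dy where "dy = (\<lambda>s. \<i> * \<kappa> * z s)"
  have schr: "schroedinger_solution \<kappa> \<epsilon>' sm sp y dy"
    unfolding schroedinger_solution_def
  proof
    show "\<forall>s\<in>{sm..sp}. (y has_vector_derivative dy s) (at s within {sm..sp})"
      unfolding dy_def using d.y_deriv by blast
    have "lipschitz_primitive sm sp dy (\<lambda>s. - \<kappa>\<^sup>2 * of_real (\<epsilon>' s) * y s)"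
      unfolding dy_def
      by (rule lipschitz_primitive_cong[OF lipschitz_primitive_cmult[OF d.z_primitive, of "\<i> * \<kappa>"]])
        (auto simp: power2_eq_square algebra_simps)
    then show "ae_primitive_on {sm..sp} dy (\<lambda>s. - \<kappa>\<^sup>2 * of_real (\<epsilon>' s) * y s)"
      by (simp add: lipschitz_primitive_def)
  qed
  have quot: "riccati_quotient \<kappa> (y s) (dy s) = x s" if "s \<in> {sm..sp}" for s
    using ratio[OF that] c(1) kappa
    by (auto simp: riccati_quotient_def projective_ratio_def y_def z_def dy_def)
  \<comment> \<open>Otherwise both end points would be \<open>Infty\<close>, hence equal.\<close>
  have "\<exists>s\<in>{sm..sp}. y s \<noteq> 0"
    using quot[of sm] quot[of sp] x(2,3) assms(5) ab
    by (auto simp: riccati_quotient_def split: if_splits)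
  moreover have "AE s in lebesgue_on {sm..sp}. \<epsilon>' s = \<epsilon> s"
    unfolding AE_lebesgue_on_negligible
    by (rule negligible_subset[OF negligible_Un[OF S(1) S']]) (use S(2) in auto)
  moreover have "bang_bang_on n1 n2 sm sp \<epsilon>'"
    by (rule d.bang_bang) (simp add: \<epsilon>'_def m1_def m2_def)
  moreover have "Im (of_real (\<epsilon>' s) * (y s)\<^sup>2 + (dy s)\<^sup>2 / \<kappa>\<^sup>2) = lam0" if "s \<in> {sm..sp}" for s
  proof -
    have "(dy s)\<^sup>2 / \<kappa>\<^sup>2 = - (z s)\<^sup>2" using kappa by (simp add: dy_def power_mult_distrib)
    then show ?thesis using ham[OF that] by simp
  qed
  moreover have "(Im ((y s)\<^sup>2) < 0 \<longrightarrow> \<epsilon>' s = n1\<^sup>2) \<and> (Im ((y s)\<^sup>2) > 0 \<longrightarrow> \<epsilon>' s = n2\<^sup>2)" for s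
    by (auto simp: \<epsilon>'_def m1_def m2_def)
  ultimately show ?thesis
    using \<open>0 \<le> lam0\<close> schr quot[of sm] quot[of sp] x(2,3) ab
    by (intro exI[of _ \<epsilon>'] conjI exI[of _ lam0] exI[of _ y] exI[of _ dy]) auto
qed

end
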